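(* Fix constants $0<\theta\le 1$ and $b>0$ not depending on $n$. For each $n$ let $p=p_n\ge 2$ be an integer, and let $X_1,\dots,X_n$ be i.i.d. random vectors in $\mathbb{R}^p$, $X_i=(X_{i1},\dots,X_{ip})^\top$, whose common distribution may depend on $n$, with mean vector $\mathbb{E}X_i=0$ and covariance matrix $\Sigma=\mathrm{Cov}(X_i)$. Assume that $$\min_{j\le p}\mathbb{E}|X_{ij}|^2\ge b \qquad\text{and}\qquad M_\theta:=\max_{j\le p}\mathbb{E}|X_{ij}|^{2+\theta}<\infty$$ (where $M_\theta$ may depend on $n$), and that, as $n\to\infty$, $$(\log p)^{4+3\theta}M_\theta^2=o(n^\theta).$$ Let $\kappa=\kappa_n>0$ satisfy $\kappa\asymp (nM_\theta/\log p)^{1/(2+\theta)}$, and let $\hat\mu_\kappa=\frac1n\sum_{i=1}^n t_\kappa(X_i)$ be the truncated sample mean vector. Let $Y=(Y_1,\dots,Y_p)^\top$ be a centered Gaussian vector in $\mathbb{R}^p$ with $\mathrm{Cov}(Y)=\Sigma$. Then, as $n\to\infty$, $$\sup_{t\in\mathbb{R}}\Big|\mathbb{P}\big(\sqrt n\,|\hat\mu_\kappa|_\infty\le t\big)-\mathbb{P}\big(|Y|_\infty\le t\big)\Big|\to 0.$$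
   Context: For $\kappa>0$, the truncation function $t_\kappa:\mathbb{R}\to[-\kappa,\kappa]$ is $t_\kappa(x)=\max(\min(x,\kappa),-\kappa)$; for a vector $x=(x_1,\dots,x_p)^\top\in\mathbb{R}^p$ it is applied coordinatewise, $t_\kappa(x)=(t_\kappa(x_1),\dots,t_\kappa(x_p))^\top$. For $x\in\mathbb{R}^p$, $|x|_\infty=\max_{j\le p}|x_j|$. The setting is a triangular array: the dimension $p=p_n$ (possibly tending to infinity), the distribution of the $X_i$, $\Sigma$, $Y$, $M_\theta$ and $\kappa$ may all depend on $n$, while $\theta$ and $b$ are fixed. For positive sequences, $a_n\asymp b_n$ means there are constants $0<c\le C<\infty$ independent of $n$ with $c\,b_n\le a_n\le C\,b_n$ for all large $n$. *)

theory Defs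
  imports "HOL-Probability.Probability" "HOL-Library.Landau_Symbols"
begin

text \<open>
  Since the dimension \<open>p\<close> varies with the sample size, a vector in $\mathbb{R}^p$ is a
  function \<open>nat \<Rightarrow> real\<close> of which only the coordinates in \<open>{1..p}\<close> matter, and a random
  vector is a measurable map into the product Borel space \<open>borel_vec p\<close>.
\<close>

abbreviation borel_vec :: "nat \<Rightarrow> (nat \<Rightarrow> real) measure" where
  "borel_vec p \<equiv> PiM {1..p} (\<lambda>_. borel)"

definition linf_norm :: "nat \<Rightarrow> (nat \<Rightarrow> real) \<Rightarrow> real" where
  "linf_norm p x = (MAX j\<in>{1..p}. \<bar>x j\<bar>)"

definition trunc :: "real \<Rightarrow> real \<Rightarrow> real" where
  "trunc \<kappa> x = max (min x \<kappa>) (- \<kappa>)"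

definition trunc_vec :: "real \<Rightarrow> (nat \<Rightarrow> real) \<Rightarrow> (nat \<Rightarrow> real)" where
  "trunc_vec \<kappa> x = (\<lambda>j. trunc \<kappa> (x j))"

definition trunc_mean :: "nat \<Rightarrow> real \<Rightarrow> (nat \<Rightarrow> 'a \<Rightarrow> nat \<Rightarrow> real) \<Rightarrow> 'a \<Rightarrow> nat \<Rightarrow> real" where
  "trunc_mean n \<kappa> X \<omega> = (\<lambda>j. (1 / real n) * (\<Sum>i=1..n. trunc_vec \<kappa> (X i \<omega>) j))"

definition iid_vars :: "'a measure \<Rightarrow> 'b measure \<Rightarrow> (nat \<Rightarrow> 'a \<Rightarrow> 'b) \<Rightarrow> nat set \<Rightarrow> bool" where
  "iid_vars M S X I \<longleftrightarrow>
     prob_space.indep_vars M (\<lambda>_. S) X I \<and>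
     (\<forall>i\<in>I. \<forall>i'\<in>I. distr M S (X i) = distr M S (X i'))"

definition covariance :: "'a measure \<Rightarrow> ('a \<Rightarrow> real) \<Rightarrow> ('a \<Rightarrow> real) \<Rightarrow> real" where
  "covariance M U V =
     (\<integral>\<omega>. (U \<omega> - (\<integral>\<omega>. U \<omega> \<partial>M)) * (V \<omega> - (\<integral>\<omega>. V \<omega> \<partial>M)) \<partial>M)"

definition has_cov_matrix ::
  "'a measure \<Rightarrow> nat \<Rightarrow> ('a \<Rightarrow> nat \<Rightarrow> real) \<Rightarrow> (nat \<Rightarrow> nat \<Rightarrow> real) \<Rightarrow> bool" where
  "has_cov_matrix M p Z \<Sigma> \<longleftrightarrow>
     (\<forall>j\<in>{1..p}. \<forall>k\<in>{1..p}. covariance M (\<lambda>\<omega>. Z \<omega> j) (\<lambda>\<omega>. Z \<omega> k) = \<Sigma> j k)"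

text \<open>
  Point masses count as (degenerate) normal laws, so that Gaussian vectors may have a singular
  covariance matrix.
\<close>

definition gaussian_var :: "'a measure \<Rightarrow> ('a \<Rightarrow> real) \<Rightarrow> bool" where
  "gaussian_var M Z \<longleftrightarrow>
     (\<exists>\<mu> \<sigma>. \<sigma> > 0 \<and> distributed M lborel Z (normal_density \<mu> \<sigma>)) \<or>
     (\<exists>\<mu>. Z \<in> borel_measurable M \<and> (AE \<omega> in M. Z \<omega> = \<mu>))"

definition gaussian_vector :: "'a measure \<Rightarrow> nat \<Rightarrow> ('a \<Rightarrow> nat \<Rightarrow> real) \<Rightarrow> bool" where
  "gaussian_vector M p Z \<longleftrightarrow>
     Z \<in> measurable M (borel_vec p) \<and>
     (\<forall>a :: nat \<Rightarrow> real. gaussian_var M (\<lambda>\<omega>. \<Sum>j=1..p. a j * Z \<omega> j))"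

end

theory Submission
  imports Defs
begin

text \<open>
  The indicator of \<open>|x|\<^sub>\<infinity> \<le> t\<close> is replaced by a logistic function \<open>f\<close> of the soft maximum
  \<open>ln (\<Sum>\<^sub>j 2 cosh (\<beta> x\<^sub>j))\<close>. Interpolating between the truncated sum \<open>S\<close> and \<open>Y\<close> along
  \<open>sin s * S + cos s * Y\<close>, the derivative of \<open>E f\<close> is handled by Stein's identity on the Gaussian side
  and by leaving out one summand on the other. The derivatives of \<open>f\<close> at \<open>z + v\<close> with \<open>\<beta> |v|\<^sub>\<infinity> \<le> 1\<close>
  are dominated by softmax weights at \<open>z\<close>, which are independent of the summand left out; so only
  \<open>max\<^sub>j E|\<xi>\<^sub>j|\<^sup>3\<close> enters the error, and never the expectation of a maximum over coordinates.
  Truncating at \<open>\<kappa>\<close> is exactly what makes \<open>\<beta> |\<xi>|\<^sub>\<infinity> \<le> 1\<close>. The passage back to indicators costs an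
  anti-concentration bound of order \<open>sqrt (ln p)\<close> for \<open>|Y|\<^sub>\<infinity>\<close>, so \<open>\<beta>\<close> is taken to be a large constant
  times \<open>(ln (2p))\<^sup>3\<^sup>/\<^sup>2\<close>; all error terms are then powers of the growth ratio in the hypothesis.
\<close>

text \<open>\<open>gaussian_vector\<close> speaks only of one-dimensional linear combinations. Both
  Gaussian ingredients, anti-concentration and Stein's identity, come from one decomposition: the
  regression residual of \<open>Y\<close> on a coordinate is independent of that coordinate. This
  independence has to be read off from characteristic functions, so a multivariate uniqueness
  theorem is built from the univariate one. The exponents arise as follows. Write \<open>L\<close>
  for \<open>ln (2 * p)\<close>. The soft maximum exceeds \<open>\<beta>\<close> times the maximum
  by up to \<open>L\<close>, and anti-concentration multiplies by a factor of order
  \<open>sqrt L\<close>, so \<open>L * sqrt L / \<beta>\<close> must be small. The logistic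
  steepness \<open>\<alpha> = 1 / L\<close> spreads the transition over a width of order
  \<open>L / \<beta>\<close>, no more than the soft maximum already loses, and gains a factor
  \<open>1 / L\<close> in every derivative. The third-order error then carries
  \<open>L powr (7/2)\<close> instead of \<open>L powr (9/2)\<close>; after inserting the truncation
  level this is exactly what the exponent \<open>4 + 3 * \<theta>\<close> pays for.\<close>

declare One_nat_def [simp del]

section \<open>Multivariate characteristic functions\<close>

lemma finite_measure_char_eqI:
  fixes \<mu> \<nu> :: "real measure"
  assumes "finite_measure \<mu>" "finite_measure \<nu>"
    and sets: "sets \<mu> = sets borel" "sets \<nu> = sets borel"
    and char: "\<And>t. (CLINT x|\<mu>. iexp (t * x)) = (CLINT x|\<nu>. iexp (t * x))"
  shows "\<mu> = \<nu>"
proof -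
  interpret m: finite_measure \<mu> by fact
  interpret n: finite_measure \<nu> by fact
  have sp: "space \<mu> = UNIV" "space \<nu> = UNIV"
    using sets[THEN sets_eq_imp_space_eq] by simp_all
  define c where "c = measure \<mu> UNIV"
  have "complex_of_real (measure \<mu> UNIV) = complex_of_real (measure \<nu> UNIV)"
    using char[of 0] sp by (simp add: of_real_def)
  then have cn: "c = measure \<nu> UNIV" unfolding c_def using of_real_eq_iff by blast
  show ?thesis
  proof (cases "c = 0")
    case True
    have z: "emeasure \<mu> A = 0 \<and> emeasure \<nu> A = 0" for A
    proof -
      have "emeasure \<mu> UNIV = 0" "emeasure \<nu> UNIV = 0"
        using True cn by (simp_all add: m.emeasure_eq_measure n.emeasure_eq_measure c_def)
      moreover have "emeasure \<mu> A \<le> emeasure \<mu> UNIV" "emeasure \<nu> A \<le> emeasure \<nu> UNIV"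
        using sp sets by (metis emeasure_space)+
      ultimately show ?thesis by simp
    qed
    show ?thesis by (rule measure_eqI) (use z sets in auto)
  next
    case False
    then have c0: "c > 0" by (simp add: c_def order_less_le)
    have real: "real_distribution (density \<rho> (\<lambda>_. ennreal (1 / c)))"
      if "finite_measure \<rho>" "sets \<rho> = sets borel" "measure \<rho> UNIV = c" for \<rho>
    proof -
      interpret r: finite_measure \<rho> by fact
      have sp': "space \<rho> = UNIV" using that(2)[THEN sets_eq_imp_space_eq] by simp
      have "prob_space (density \<rho> (\<lambda>_. ennreal (1 / c)))"
        by (rule prob_spaceI)
          (use that c0 sp' in \<open>simp add: emeasure_density_const r.emeasure_eq_measure ennreal_mult[symmetric]\<close>)
      then show ?thesis
        unfolding real_distribution_def real_distribution_axioms_def using that sp' by simp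
    qed
    have ch: "char (density \<rho> (\<lambda>_. ennreal (1 / c))) t = (1 / c) *\<^sub>R (CLINT x|\<rho>. iexp (t * x))"
      if "sets \<rho> = sets borel" for \<rho> t
    proof -
      have [measurable_cong]: "sets \<rho> = sets borel" by fact
      show ?thesis
        unfolding char_def using c0 by (subst integral_density) auto
    qed
    have eq: "density \<mu> (\<lambda>_. ennreal (1 / c)) = density \<nu> (\<lambda>_. ennreal (1 / c))"
    proof (rule Levy_uniqueness)
      show "char (density \<mu> (\<lambda>_. ennreal (1 / c))) = char (density \<nu> (\<lambda>_. ennreal (1 / c)))"
        by (rule ext) (simp only: ch[OF sets(1)] ch[OF sets(2)] char)
    qed (use real[OF \<open>finite_measure \<mu>\<close>] real[OF \<open>finite_measure \<nu>\<close>] sets cn in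
          \<open>auto simp: c_def\<close>)
    show ?thesis
    proof (rule measure_eqI)
      show "sets \<mu> = sets \<nu>" using sets by simp
      fix A assume A: "A \<in> sets \<mu>"
      have "ennreal (1 / c) * emeasure \<mu> A = ennreal (1 / c) * emeasure \<nu> A"
        using eq A sets by (metis emeasure_density_const)
      then have "ennreal (measure \<mu> A / c) = ennreal (measure \<nu> A / c)"
        using c0 by (simp add: m.emeasure_eq_measure n.emeasure_eq_measure ennreal_mult[symmetric])
      then show "emeasure \<mu> A = emeasure \<nu> A"
        using c0 by (simp add: m.emeasure_eq_measure n.emeasure_eq_measure)
    qed
  qed
qed

text \<open>A signed weight \<open>g\<close> is not a density, but \<open>1 + g\<close> is
  nonnegative when \<open>g\<close> is bounded by 1. Integrals against \<open>g\<close> are then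
  differences between the tilted and the plain law of \<open>U\<close>, both finite
  measures.\<close>

lemma tilted_distr:
  fixes g :: "'a \<Rightarrow> real"
  assumes "finite_measure P" and [measurable]: "U \<in> borel_measurable P" "g \<in> borel_measurable P"
    and bd: "\<And>x. \<bar>g x\<bar> \<le> 1"
  defines "D \<equiv> distr (density P (\<lambda>x. ennreal (1 + g x))) borel U"
  shows "finite_measure D" "(CLINT x|D. iexp (t * x)) = (CLINT x|P. iexp (t * U x)) + (CLINT x|P. g x *\<^sub>R iexp (t * U x))"
    "C \<in> sets borel \<Longrightarrow> measure D C = (LINT x|P. indicator C (U x)) + (LINT x|P. g x * indicator C (U x))"
proof -
  interpret P: finite_measure P by fact
  have nn: "0 \<le> 1 + g x" for x using bd[of x] by linarith
  have "(\<integral>\<^sup>+ x. ennreal (1 + g x) \<partial>P) \<le> (\<integral>\<^sup>+ x. ennreal 2 \<partial>P)"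
    using bd by (intro nn_integral_mono ennreal_leI) (simp add: abs_le_iff)
  also have "\<dots> < \<infinity>" by (simp add: P.emeasure_eq_measure ennreal_mult_less_top)
  finally have "finite_measure (density P (\<lambda>x. ennreal (1 + g x)))"
    by (intro finite_measureI) (simp add: emeasure_density cong: nn_integral_cong)
  then show "finite_measure D" unfolding D_def by (rule finite_measure.finite_measure_distr) simp
  have "integrable P (\<lambda>x. iexp (t * U x))" "integrable P (\<lambda>x. g x *\<^sub>R iexp (t * U x))"
    by (rule P.integrable_const_bound[where B=1]; use bd in \<open>simp add: norm_mult\<close>)+
  then show "(CLINT x|D. iexp (t * x)) = (CLINT x|P. iexp (t * U x)) + (CLINT x|P. g x *\<^sub>R iexp (t * U x))"
    unfolding D_def by (simp add: integral_distr integral_density nn scaleR_add_left)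
  assume [measurable]: "C \<in> sets borel"
  have "integrable P (\<lambda>x. indicator C (U x) :: real)" "integrable P (\<lambda>x. g x * indicator C (U x))"
    by (rule P.integrable_const_bound[where B=1]; use bd in \<open>simp add: indicator_def\<close>)+
  moreover have "measure D C = (LINT x|D. indicator C x)" by (simp add: D_def)
  moreover have "\<dots> = (LINT x|P. (1 + g x) * indicator C (U x))"
    unfolding D_def by (subst integral_distr, simp, simp, subst integral_density) (simp_all add: nn)
  ultimately show "measure D C = (LINT x|P. indicator C (U x)) + (LINT x|P. g x * indicator C (U x))"
    by (simp add: distrib_right)
qed

text \<open>Uniqueness for signed weights: \<open>ch1\<close> identifies the plain laws,
  \<open>ch1\<close> and \<open>ch2\<close> together the tilted ones, and subtraction isolates the
  weighted part.\<close>

lemma weighted_char_eqI: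
  fixes g :: "'a \<Rightarrow> real" and g' :: "'b \<Rightarrow> real"
  assumes fin: "finite_measure P" "finite_measure Q"
    and P: "U \<in> borel_measurable P" "g \<in> borel_measurable P" "\<And>x. \<bar>g x\<bar> \<le> 1"
    and Q: "U' \<in> borel_measurable Q" "g' \<in> borel_measurable Q" "\<And>x. \<bar>g' x\<bar> \<le> 1"
    and C: "C \<in> sets borel"
    and ch1: "\<And>t. (CLINT x|P. iexp (t * U x)) = (CLINT x|Q. iexp (t * U' x))"
    and ch2: "\<And>t. (CLINT x|P. g x *\<^sub>R iexp (t * U x)) = (CLINT x|Q. g' x *\<^sub>R iexp (t * U' x))"
  shows "(LINT x|P. g x * indicator C (U x)) = (LINT x|Q. g' x * indicator C (U' x))"
proof -
  note tP = tilted_distr[OF fin(1) P] and tQ = tilted_distr[OF fin(2) Q]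
  note [measurable] = P(1,2) Q(1,2) C
  have "distr (density P (\<lambda>x. ennreal (1 + g x))) borel U = distr (density Q (\<lambda>x. ennreal (1 + g' x))) borel U'"
    by (rule finite_measure_char_eqI) (simp_all only: tP tQ ch1 ch2 sets_distr)
  moreover have "distr P borel U = distr Q borel U'"
    by (rule finite_measure_char_eqI)
      (use ch1 in \<open>auto intro!: finite_measure.finite_measure_distr fin simp: integral_distr\<close>)
  moreover have "measure (distr P borel U) C = (LINT x|P. indicator C (U x))"
    "measure (distr Q borel U') C = (LINT x|Q. indicator C (U' x))"
    using integral_distr[of U P borel "indicator C :: real \<Rightarrow> real"]
      integral_distr[of U' Q borel "indicator C :: real \<Rightarrow> real"] by simp_all
  ultimately show ?thesis using tP(3)[OF C] tQ(3)[OF C] by simp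
qed

text \<open>One frequency is traded for an indicator. The real and imaginary parts of
  \<open>iexp (W x)\<close> serve as bounded weights in \<open>weighted_char_eqI\<close>; the
  hypothesis enters at \<open>s\<close> equal to 0, 1 and -1.\<close>

lemma char_eq_imp_partial_eq:
  fixes U W :: "'a \<Rightarrow> real" and U' W' :: "'b \<Rightarrow> real"
  assumes "finite_measure P" "finite_measure Q"
    and [measurable]: "U \<in> borel_measurable P" "W \<in> borel_measurable P"
      "U' \<in> borel_measurable Q" "W' \<in> borel_measurable Q" "C \<in> sets borel"
    and ch: "\<And>s t. (CLINT x|P. iexp (s * W x + t * U x)) = (CLINT x|Q. iexp (s * W' x + t * U' x))"
  shows "(CLINT x|P. indicator C (U x) *\<^sub>R iexp (W x)) = (CLINT x|Q. indicator C (U' x) *\<^sub>R iexp (W' x))"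
proof -
  interpret P: finite_measure P by fact
  interpret Q: finite_measure Q by fact
  have ip: "integrable P (\<lambda>x. iexp (s * W x + t * U x))" for s t
    by (rule P.integrable_const_bound[where B=1]) simp_all
  have iq: "integrable Q (\<lambda>x. iexp (s * W' x + t * U' x))" for s t
    by (rule Q.integrable_const_bound[where B=1]) simp_all
  \<comment> \<open>Product-to-sum form: a cosine or sine weight times a character is a combination
    of two joint characters. The factors \<open>1 *\<close> and \<open>- 1 *\<close> are kept so
    that \<open>ch\<close> applies by rewriting.\<close>
  have cs: "cos w *\<^sub>R iexp u = (1/2) * (iexp (1 * w + u) + iexp (- 1 * w + u))"
      "sin w *\<^sub>R iexp u = (- \<i>/2) * (iexp (1 * w + u) - iexp (- 1 * w + u))" for w u :: real
    by (simp_all add: complex_eq_iff Re_exp Im_exp cos_add sin_add cos_diff sin_diff)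
  have c: "(LINT x|P. cos (W x) * indicator C (U x)) = (LINT x|Q. cos (W' x) * indicator C (U' x))"
  proof (rule weighted_char_eqI[OF assms(1,2)])
    show "(CLINT x|P. iexp (t * U x)) = (CLINT x|Q. iexp (t * U' x))" for t
      using ch[of 0 t] by simp
    show "(CLINT x|P. cos (W x) *\<^sub>R iexp (t * U x)) = (CLINT x|Q. cos (W' x) *\<^sub>R iexp (t * U' x))" for t
      unfolding cs integral_mult_right_zero Bochner_Integration.integral_add[OF ip ip]
        Bochner_Integration.integral_add[OF iq iq] ch ..
  qed (simp_all add: abs_cos_le_one)
  have s: "(LINT x|P. sin (W x) * indicator C (U x)) = (LINT x|Q. sin (W' x) * indicator C (U' x))"
  proof (rule weighted_char_eqI[OF assms(1,2)])
    show "(CLINT x|P. iexp (t * U x)) = (CLINT x|Q. iexp (t * U' x))" for t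
      using ch[of 0 t] by simp
    show "(CLINT x|P. sin (W x) *\<^sub>R iexp (t * U x)) = (CLINT x|Q. sin (W' x) *\<^sub>R iexp (t * U' x))" for t
      unfolding cs integral_mult_right_zero Bochner_Integration.integral_diff[OF ip ip]
        Bochner_Integration.integral_diff[OF iq iq] ch ..
  qed (simp_all add: abs_sin_le_one)
  have "integrable P (\<lambda>x. indicator C (U x) *\<^sub>R iexp (W x))"
    by (rule P.integrable_const_bound[where B=1]) (simp_all add: indicator_def)
  moreover have "integrable Q (\<lambda>x. indicator C (U' x) *\<^sub>R iexp (W' x))"
    by (rule Q.integrable_const_bound[where B=1]) (simp_all add: indicator_def)
  ultimately show ?thesis
    using c s by (simp add: complex_eq_iff integral_Re[symmetric] integral_Im[symmetric] Re_exp Im_exp mult.commute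
        del: integral_Re integral_Im)
qed

lemma sets_rectangle:
  fixes B :: "'k \<Rightarrow> real set"
  assumes "finite J" "\<And>k. k \<in> J \<Longrightarrow> X k \<in> borel_measurable \<mu>" "\<And>k. k \<in> J \<Longrightarrow> B k \<in> sets borel"
  shows "{x \<in> space \<mu>. \<forall>k\<in>J. X k x \<in> B k} \<in> sets \<mu>"
proof (rule sets.sets_Collect_finite_All[OF _ assms(1)])
  fix k assume "k \<in> J"
  then have "X k -` B k \<inter> space \<mu> \<in> sets \<mu>" using assms by (intro measurable_sets) auto
  then show "{x \<in> space \<mu>. X k x \<in> B k} \<in> sets \<mu>" by (simp add: vimage_def Int_def conj_commute)
qed

text \<open>Induction over the coordinates, generalising the measures: restricting to
  \<open>x k \<in> B k\<close> turns the frequency of coordinate \<open>k\<close> into an indicator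
  by \<open>char_eq_imp_partial_eq\<close>, and the restricted measures still agree on characters in
  the remaining coordinates.\<close>

lemma char_eq_imp_rectangle_eq:
  fixes \<mu> \<nu> :: "(nat \<Rightarrow> real) measure"
  assumes "finite J" "J \<subseteq> I" "finite_measure \<mu>" "finite_measure \<nu>"
    "sets \<mu> = sets (PiM I (\<lambda>_. borel))" "sets \<nu> = sets (PiM I (\<lambda>_. borel))"
    "\<And>k. B k \<in> sets borel"
    "\<And>a. (CLINT x|\<mu>. iexp (\<Sum>k\<in>J. a k * x k)) = (CLINT x|\<nu>. iexp (\<Sum>k\<in>J. a k * x k))"
  shows "measure \<mu> {x\<in>space \<mu>. \<forall>k\<in>J. x k \<in> B k} = measure \<nu> {x\<in>space \<nu>. \<forall>k\<in>J. x k \<in> B k}"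
  using assms
proof (induction J arbitrary: \<mu> \<nu> rule: finite_induct)
  case empty
  have "complex_of_real (measure \<mu> (space \<mu>)) = complex_of_real (measure \<nu> (space \<nu>))"
    using empty.prems(7)[of "\<lambda>_. 0"] by (simp add: of_real_def)
  then show ?case unfolding of_real_eq_iff by simp
next
  case (insert k J)
  note [measurable_cong] = insert.prems(4,5)
  note B[measurable] = insert.prems(6)
  have kI[measurable]: "k \<in> I" and JI: "J \<subseteq> I" using insert.prems by auto
  have [measurable]: "j \<in> J \<Longrightarrow> j \<in> I" for j using JI by auto
  interpret m: finite_measure \<mu> by fact
  interpret n: finite_measure \<nu> by fact
  have [measurable]: "(\<lambda>x. \<Sum>k\<in>J. a k * x k) \<in> borel_measurable \<mu>"
    "(\<lambda>x. \<Sum>k\<in>J. a k * x k) \<in> borel_measurable \<nu>" for a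
    by (intro borel_measurable_sum borel_measurable_times; measurable)+
  define \<mu>' where "\<mu>' = density \<mu> (\<lambda>x. ennreal (indicator (B k) (x k)))"
  define \<nu>' where "\<nu>' = density \<nu> (\<lambda>x. ennreal (indicator (B k) (x k)))"
  have comp: "(\<lambda>x. x j) \<in> borel_measurable \<mu>" "(\<lambda>x. x j) \<in> borel_measurable \<nu>" if "j \<in> I" for j
    using that by measurable
  have [measurable]: "(\<lambda>x. x k) \<in> borel_measurable \<mu>" "(\<lambda>x. x k) \<in> borel_measurable \<nu>"
    using comp[OF kI] .
  have restrict: "finite_measure (density \<rho> (\<lambda>x. ennreal (indicator (B k) (x k))))"
    "measure (density \<rho> (\<lambda>x. ennreal (indicator (B k) (x k)))) {x\<in>space \<rho>. \<forall>k\<in>J. x k \<in> B k} =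
      measure \<rho> {x\<in>space \<rho>. \<forall>k\<in>insert k J. x k \<in> B k}"
    if "finite_measure \<rho>" and comp: "\<And>j. j \<in> I \<Longrightarrow> (\<lambda>x. x j) \<in> borel_measurable \<rho>" for \<rho>
  proof -
    interpret finite_measure \<rho> by fact
    have S: "{x\<in>space \<rho>. \<forall>k\<in>J. x k \<in> B k} \<in> sets \<rho>"
      and S'[measurable]: "{x\<in>space \<rho>. \<forall>k\<in>insert k J. x k \<in> B k} \<in> sets \<rho>"
      by (rule sets_rectangle; use insert.hyps JI kI comp B in auto)+
    have [measurable]: "(\<lambda>x. x k) \<in> borel_measurable \<rho>" by (rule comp[OF kI])
    have "emeasure (density \<rho> (\<lambda>x. ennreal (indicator (B k) (x k)))) {x\<in>space \<rho>. \<forall>k\<in>J. x k \<in> B k} =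
        (\<integral>\<^sup>+x. indicator {x\<in>space \<rho>. \<forall>k\<in>insert k J. x k \<in> B k} x \<partial>\<rho>)"
      by (subst emeasure_density[OF _ S], measurable) (auto intro!: nn_integral_cong simp: indicator_def)
    also have "\<dots> = emeasure \<rho> {x\<in>space \<rho>. \<forall>k\<in>insert k J. x k \<in> B k}"
      by (rule nn_integral_indicator) measurable
    finally show "measure (density \<rho> (\<lambda>x. ennreal (indicator (B k) (x k)))) {x\<in>space \<rho>. \<forall>k\<in>J. x k \<in> B k} =
      measure \<rho> {x\<in>space \<rho>. \<forall>k\<in>insert k J. x k \<in> B k}" by (simp add: measure_def)
    have "emeasure (density \<rho> (\<lambda>x. ennreal (indicator (B k) (x k)))) (space \<rho>) \<le> (\<integral>\<^sup>+x. 1 \<partial>\<rho>)"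
      by (subst emeasure_density) (simp, simp, rule nn_integral_mono, simp add: indicator_def)
    also have "\<dots> < \<infinity>" by (simp add: emeasure_eq_measure)
    finally show "finite_measure (density \<rho> (\<lambda>x. ennreal (indicator (B k) (x k))))" by (intro finite_measureI) simp
  qed
  have sp: "space \<mu>' = space \<mu>" "space \<nu>' = space \<nu>" by (simp_all add: \<mu>'_def \<nu>'_def)
  have "measure \<mu>' {x\<in>space \<mu>'. \<forall>k\<in>J. x k \<in> B k} = measure \<nu>' {x\<in>space \<nu>'. \<forall>k\<in>J. x k \<in> B k}"
  proof (rule insert.IH)
    show "finite_measure \<mu>'" "finite_measure \<nu>'"
      unfolding \<mu>'_def \<nu>'_def by (rule restrict; use insert.prems comp in auto)+
    fix a :: "nat \<Rightarrow> real"
    have "(CLINT x|\<mu>'. iexp (\<Sum>k\<in>J. a k * x k)) = (CLINT x|\<mu>. indicator (B k) (x k) *\<^sub>R iexp (\<Sum>k\<in>J. a k * x k))"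
      unfolding \<mu>'_def by (subst integral_density) (simp_all del: of_real_sum of_real_mult)
    also have "\<dots> = (CLINT x|\<nu>. indicator (B k) (x k) *\<^sub>R iexp (\<Sum>k\<in>J. a k * x k))"
    proof (rule char_eq_imp_partial_eq)
      fix s t
      have *: "(\<Sum>i\<in>insert k J. (if i = k then t else s * a i) * x i) = s * (\<Sum>k\<in>J. a k * x k) + t * x k" for x :: "nat \<Rightarrow> real"
      proof -
        have "(\<Sum>i\<in>J. (if i = k then t else s * a i) * x i) = (\<Sum>i\<in>J. s * (a i * x i))"
          using insert.hyps by (intro sum.cong) auto
        then show ?thesis using insert.hyps by (simp add: sum_distrib_left)
      qed
      show "(CLINT x|\<mu>. iexp (s * (\<Sum>k\<in>J. a k * x k) + t * x k)) = (CLINT x|\<nu>. iexp (s * (\<Sum>k\<in>J. a k * x k) + t * x k))"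
        using insert.prems(7)[of "\<lambda>i. if i = k then t else s * a i"] unfolding * .
    qed (use insert.prems in \<open>auto\<close>)
    also have "\<dots> = (CLINT x|\<nu>'. iexp (\<Sum>k\<in>J. a k * x k))"
      unfolding \<nu>'_def by (subst integral_density) (simp_all del: of_real_sum of_real_mult)
    finally show "(CLINT x|\<mu>'. iexp (\<Sum>k\<in>J. a k * x k)) = (CLINT x|\<nu>'. iexp (\<Sum>k\<in>J. a k * x k))" .
  qed (use insert.prems JI in \<open>auto simp: \<mu>'_def \<nu>'_def\<close>)
  moreover have "measure \<mu>' {x\<in>space \<mu>'. \<forall>k\<in>J. x k \<in> B k} = measure \<mu> {x\<in>space \<mu>. \<forall>k\<in>insert k J. x k \<in> B k}"
    "measure \<nu>' {x\<in>space \<nu>'. \<forall>k\<in>J. x k \<in> B k} = measure \<nu> {x\<in>space \<nu>. \<forall>k\<in>insert k J. x k \<in> B k}"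
    unfolding sp unfolding \<mu>'_def \<nu>'_def by (rule restrict(2); use insert.prems comp in auto)+
  ultimately show ?case by simp
qed

text \<open>Rectangles form an intersection-stable generator of the product sigma-algebra, and on
  them \<open>char_eq_imp_rectangle_eq\<close> gives equality.\<close>

theorem PiM_char_eqI:
  fixes \<mu> \<nu> :: "(nat \<Rightarrow> real) measure"
  assumes "finite I" "finite_measure \<mu>" "finite_measure \<nu>"
    and sets: "sets \<mu> = sets (PiM I (\<lambda>_. borel))" "sets \<nu> = sets (PiM I (\<lambda>_. borel))"
    and ch: "\<And>a. (CLINT x|\<mu>. iexp (\<Sum>k\<in>I. a k * x k)) = (CLINT x|\<nu>. iexp (\<Sum>k\<in>I. a k * x k))"
  shows "\<mu> = \<nu>"
proof -
  interpret m: finite_measure \<mu> by fact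
  interpret n: finite_measure \<nu> by fact
  have sp: "space \<mu> = PiE I (\<lambda>_. UNIV)" "space \<nu> = PiE I (\<lambda>_. UNIV)"
    using sets[THEN sets_eq_imp_space_eq] by (simp_all add: space_PiM)
  have 1: "emeasure \<mu> (PiE I A) = emeasure \<nu> (PiE I A)" if A: "\<And>i. i \<in> I \<Longrightarrow> A i \<in> sets borel" for A
  proof -
    \<comment> \<open>\<open>char_eq_imp_rectangle_eq\<close> asks for Borel sets at every index, so
      indices outside \<open>I\<close> receive the empty set as a dummy.\<close>
    let ?A = "\<lambda>i. if i \<in> I then A i else {}"
    have "{x \<in> PiE I (\<lambda>_. UNIV). \<forall>k\<in>I. x k \<in> ?A k} = PiE I A"
      by (auto simp: PiE_iff extensional_def)
    moreover have "measure \<mu> {x\<in>space \<mu>. \<forall>k\<in>I. x k \<in> ?A k} = measure \<nu> {x\<in>space \<nu>. \<forall>k\<in>I. x k \<in> ?A k}"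
      by (rule char_eq_imp_rectangle_eq[where I=I]) (use assms A in auto)
    ultimately show ?thesis
      by (simp add: m.emeasure_eq_measure n.emeasure_eq_measure sp)
  qed
  have 2: "range (\<lambda>_::nat. PiE I (\<lambda>_. UNIV :: real set)) \<subseteq> prod_algebra I (\<lambda>_. borel)"
    using assms(1) by (auto intro!: prod_algebraI_finite)
  have 3: "(\<Union>i::nat. PiE I (\<lambda>_. UNIV :: real set)) = space (PiM I (\<lambda>_. borel))"
    by (simp add: space_PiM)
  show ?thesis
    by (rule measure_eqI_PiM_finite[OF assms(1) sets 1 2 3]) (simp_all add: m.emeasure_eq_measure)
qed

text \<open>Kac's criterion for independence. For a fixed event \<open>U \<in> C\<close>, the law of
  \<open>V\<close> restricted to that event is compared with \<open>q\<close> times the law of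
  \<open>V\<close>; equal characters make them equal, and this is the product formula on
  rectangles.\<close>

lemma (in prob_space) distr_pair_charI:
  fixes U :: "'a \<Rightarrow> real" and V :: "'a \<Rightarrow> nat \<Rightarrow> real"
  assumes fin: "finite I"
    and U[measurable]: "U \<in> borel_measurable M" and V[measurable]: "V \<in> measurable M (PiM I (\<lambda>_. borel))"
    and ch: "\<And>t a. (CLINT x|M. iexp ((\<Sum>k\<in>I. a k * V x k) + t * U x)) =
        (CLINT x|M. iexp (\<Sum>k\<in>I. a k * V x k)) * (CLINT x|M. iexp (t * U x))"
  shows "distr M (PiM I (\<lambda>_. borel)) V \<Otimes>\<^sub>M distr M borel U =
    distr M (PiM I (\<lambda>_. borel) \<Otimes>\<^sub>M borel) (\<lambda>x. (V x, U x))"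
proof -
  have [measurable]: "(\<lambda>x. V x k) \<in> borel_measurable M" if "k \<in> I" for k
    using measurable_compose[OF V measurable_component_singleton[OF that]] .
  have [measurable]: "(\<lambda>x. \<Sum>k\<in>I. a k * V x k) \<in> borel_measurable M" for a
    by (intro borel_measurable_sum borel_measurable_times) simp_all
  interpret V: prob_space "distr M (PiM I (\<lambda>_. borel)) V" by (rule prob_space_distr) simp
  interpret U: prob_space "distr M borel U" by (rule prob_space_distr) simp
  interpret PP: pair_prob_space M M ..
  have rect: "emeasure (distr M (PiM I (\<lambda>_. borel)) V) B * emeasure (distr M borel U) C =
      emeasure (distr M (PiM I (\<lambda>_. borel) \<Otimes>\<^sub>M borel) (\<lambda>x. (V x, U x))) (B \<times> C)"
    if B[measurable]: "B \<in> sets (PiM I (\<lambda>_. borel))" and C[measurable]: "C \<in> sets borel" for B C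
  proof -
    define q where "q = measure M (U -` C \<inter> space M)"
    define \<mu> where "\<mu> = distr (density M (\<lambda>x. ennreal (indicator C (U x)))) (PiM I (\<lambda>_. borel)) V"
    define \<nu> where "\<nu> = distr (density M (\<lambda>x. ennreal q)) (PiM I (\<lambda>_. borel)) V"
    have eq: "\<mu> = \<nu>"
    proof (rule PiM_char_eqI[OF fin])
      have "emeasure (density M (\<lambda>x. ennreal (indicator C (U x)))) (space M) \<le> (\<integral>\<^sup>+x. 1 \<partial>M)"
        by (subst emeasure_density) (simp, simp, rule nn_integral_mono, simp add: indicator_def)
      also have "\<dots> < \<infinity>" by (simp add: emeasure_eq_measure)
      finally have "finite_measure (density M (\<lambda>x. ennreal (indicator C (U x))))"
        by (intro finite_measureI) simp
      then show "finite_measure \<mu>" unfolding \<mu>_def by (rule finite_measure.finite_measure_distr) simp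
      have "finite_measure (density M (\<lambda>x. ennreal q))"
        by (intro finite_measureI)
          (simp add: emeasure_density_const emeasure_eq_measure ennreal_mult_eq_top_iff)
      then show "finite_measure \<nu>" unfolding \<nu>_def by (rule finite_measure.finite_measure_distr) simp
      fix a :: "nat \<Rightarrow> real"
      let ?W = "\<lambda>x. \<Sum>k\<in>I. a k * V x k"
      have [simp]: "integrable M (\<lambda>x. iexp (s * ?W x + t))" "integrable M (\<lambda>x. iexp (t * U x))" for s t
        by (rule integrable_const_bound[where B=1]; simp)+
      have "(CLINT x|\<mu>. iexp (\<Sum>k\<in>I. a k * x k)) = (CLINT x|M. indicator C (U x) *\<^sub>R iexp (?W x))"
        unfolding \<mu>_def by (simp add: integral_distr integral_density)
      \<comment> \<open>\<open>M \<Otimes>\<^sub>M M\<close> supplies an independent copy of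
        \<open>U\<close>: there the product of the two characters is again a joint character, so
        \<open>char_eq_imp_partial_eq\<close> can compare \<open>U\<close> with its copy.\<close>
      also have "\<dots> = (CLINT x|(M \<Otimes>\<^sub>M M). indicator C (U (snd x)) *\<^sub>R iexp (?W (fst x)))"
      proof (rule char_eq_imp_partial_eq)
        show "finite_measure M" by (rule finite_measure_axioms)
        show "finite_measure (M \<Otimes>\<^sub>M M)" by (rule PP.finite_measure_axioms)
        fix s t
        have i2: "integrable (M \<Otimes>\<^sub>M M) (\<lambda>x. iexp (s * ?W (fst x) + t * U (snd x)))"
          by (rule PP.integrable_const_bound[where B=1]) simp_all
        have e: "(\<Sum>k\<in>I. (s * a k) * V x k) = s * ?W x" for x
          by (simp add: sum_distrib_left mult.assoc)
        have "(CLINT x|M. iexp (s * ?W x + t * U x)) =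
            (CLINT x|M. iexp (s * ?W x)) * (CLINT x|M. iexp (t * U x))"
          using ch[of "\<lambda>k. s * a k" t] unfolding e .
        also have "\<dots> = (CLINT x|M. (CLINT y|M. iexp (s * ?W x + t * U y)))"
          by (simp add: distrib_left exp_add)
        also have "\<dots> = (CLINT x|(M \<Otimes>\<^sub>M M). iexp (s * ?W (fst x) + t * U (snd x)))"
          using PP.integral_fst'[OF i2] by simp
        finally show "(CLINT x|M. iexp (s * ?W x + t * U x)) =
            (CLINT x|(M \<Otimes>\<^sub>M M). iexp (s * ?W (fst x) + t * U (snd x)))" .
      qed simp_all
      also have "\<dots> = (CLINT x|M. (CLINT y|M. indicator C (U y) *\<^sub>R iexp (?W x)))"
      proof -
        have "integrable (M \<Otimes>\<^sub>M M) (\<lambda>x. indicator C (U (snd x)) *\<^sub>R iexp (?W (fst x)))"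
          by (rule PP.integrable_const_bound[where B=1]) (simp_all add: indicator_def)
        from PP.integral_fst'[OF this] show ?thesis by simp
      qed
      also have "\<dots> = (CLINT x|M. q *\<^sub>R iexp (?W x))"
      proof -
        have "(LINT y|M. indicator C (U y) :: real) = q"
        proof -
          have "(LINT y|M. indicator C (U y) :: real) = (LINT y|M. indicator (U -` C \<inter> space M) y)"
            by (rule Bochner_Integration.integral_cong) (auto simp: indicator_def)
          then show ?thesis unfolding q_def by simp
        qed
        moreover have "integrable M (\<lambda>y. indicator C (U y) :: real)"
          by (rule integrable_const_bound[where B=1]) (simp_all add: indicator_def)
        ultimately show ?thesis by (simp add: integral_scaleR_left)
      qed
      also have "\<dots> = (CLINT x|\<nu>. iexp (\<Sum>k\<in>I. a k * x k))"
        unfolding \<nu>_def by (simp add: integral_distr integral_density q_def)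
      finally show "(CLINT x|\<mu>. iexp (\<Sum>k\<in>I. a k * x k)) = (CLINT x|\<nu>. iexp (\<Sum>k\<in>I. a k * x k))" .
    qed (simp_all add: \<mu>_def \<nu>_def)
    have S: "V -` B \<inter> space M \<in> sets M" "V -` B \<inter> space M \<inter> (U -` C \<inter> space M) \<in> sets M" by measurable
    have "emeasure \<mu> B = emeasure (density M (\<lambda>x. ennreal (indicator C (U x)))) (V -` B \<inter> space M)"
      unfolding \<mu>_def by (subst emeasure_distr) simp_all
    also have "\<dots> = (\<integral>\<^sup>+x. indicator (V -` B \<inter> space M \<inter> (U -` C \<inter> space M)) x \<partial>M)"
      by (subst emeasure_density[OF _ S(1)]) (simp, rule nn_integral_cong, simp split: split_indicator)
    also have "\<dots> = emeasure M (V -` B \<inter> space M \<inter> (U -` C \<inter> space M))"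
      by (rule nn_integral_indicator[OF S(2)])
    finally have "emeasure \<mu> B = emeasure M (V -` B \<inter> space M \<inter> (U -` C \<inter> space M))" .
    moreover have "emeasure \<nu> B = ennreal q * emeasure M (V -` B \<inter> space M)"
      unfolding \<nu>_def by (subst emeasure_distr, simp, simp) (simp add: emeasure_density_const)
    moreover have "emeasure (distr M (PiM I (\<lambda>_. borel) \<Otimes>\<^sub>M borel) (\<lambda>x. (V x, U x))) (B \<times> C) =
        emeasure M (V -` B \<inter> space M \<inter> (U -` C \<inter> space M))"
      by (subst emeasure_distr) (auto intro!: arg_cong[where f="emeasure M"])
    ultimately show ?thesis
      using eq by (simp add: emeasure_distr q_def emeasure_eq_measure mult.commute)
  qed
  show ?thesis
  proof (rule pair_measure_eqI)
    show "sets (distr M (PiM I (\<lambda>_. borel)) V \<Otimes>\<^sub>M distr M borel U) =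
        sets (distr M (PiM I (\<lambda>_. borel) \<Otimes>\<^sub>M borel) (\<lambda>x. (V x, U x)))"
      by (simp only: sets_distr) (rule sets_pair_measure_cong; simp only: sets_distr)
  qed (simp_all only: sets_distr rect V.sigma_finite_measure_axioms U.sigma_finite_measure_axioms)
qed

section \<open>Gaussian vectors\<close>

text \<open>In the density alternative this is the standard normal character after scaling by
  \<open>\<sigma>\<close>. The point mass is the case of variance 0: the mean forces it to sit at 0,
  the character is 1 and the last claim is vacuous.\<close>

lemma (in prob_space) gaussian_var_char:
  assumes g: "gaussian_var M W" and m: "expectation W = 0"
  shows "integrable M W" "integrable M (\<lambda>x. (W x)\<^sup>2)"
    "(CLINT x|M. iexp (W x)) = complex_of_real (exp (- expectation (\<lambda>x. (W x)\<^sup>2) / 2))"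
    "expectation (\<lambda>x. (W x)\<^sup>2) > 0 \<Longrightarrow>
      distributed M lborel W (normal_density 0 (sqrt (expectation (\<lambda>x. (W x)\<^sup>2))))"
proof -
  have "integrable M W \<and> integrable M (\<lambda>x. (W x)\<^sup>2) \<and>
    (CLINT x|M. iexp (W x)) = complex_of_real (exp (- expectation (\<lambda>x. (W x)\<^sup>2) / 2)) \<and>
    (expectation (\<lambda>x. (W x)\<^sup>2) > 0 \<longrightarrow>
      distributed M lborel W (normal_density 0 (sqrt (expectation (\<lambda>x. (W x)\<^sup>2)))))"
    using g unfolding gaussian_var_def
  proof (elim disjE exE conjE)
    fix \<mu> \<sigma> :: real
    assume s: "\<sigma> > 0" and d: "distributed M lborel W (normal_density \<mu> \<sigma>)"
    have "\<mu> = 0" using normal_distributed_expectation[OF s d] m by simp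
    note d = d[unfolded this]
    have var: "expectation (\<lambda>x. (W x)\<^sup>2) = \<sigma>\<^sup>2"
      using normal_distributed_variance[OF s d] m by simp
    have W[measurable]: "W \<in> borel_measurable M"
      using distributed_measurable[OF d] by simp
    have i1: "integrable M W"
      using distributed_integrable[OF d, of "\<lambda>x. x"] integrable_normal_moment_nz_1[OF s, of 0] by simp
    have i2: "integrable M (\<lambda>x. (W x)\<^sup>2)"
      using distributed_integrable[OF d, of "\<lambda>x. x\<^sup>2"] integrable_normal_moment[OF s, of 0 2] by simp
    have "distributed M lborel (\<lambda>x. W x / \<sigma>) std_normal_density"
      using normal_standard_normal_convert[OF s, of W 0] d by simp
    then have st: "distr M borel (\<lambda>x. W x / \<sigma>) = std_normal_distribution"
      using distributed_distr_eq_density[of M lborel "\<lambda>x. W x / \<sigma>" std_normal_density]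
      by (metis distr_cong sets_lborel)
    have "(CLINT x|M. iexp (W x)) = (CLINT x|distr M borel (\<lambda>x. W x / \<sigma>). iexp (\<sigma> * x))"
      using s by (simp add: integral_distr)
    also have "\<dots> = complex_of_real (exp (- \<sigma>\<^sup>2 / 2))"
      using char_std_normal_distribution unfolding st char_def by (metis (no_types))
    finally show ?thesis using i1 i2 var d s by simp
  next
    fix \<mu> assume W[measurable]: "W \<in> borel_measurable M" and ae: "AE x in M. W x = \<mu>"
    have "expectation W = expectation (\<lambda>x. \<mu>)"
      by (rule integral_cong_AE) (use ae in auto)
    then have "\<mu> = 0" using m by (simp add: prob_space)
    note ae = ae[unfolded this]
    have v: "expectation (\<lambda>x. (W x)\<^sup>2) = expectation (\<lambda>x. 0)"
      by (rule integral_cong_AE) (use ae in auto)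
    have c: "(CLINT x|M. iexp (W x)) = (CLINT x|M. 1)"
      by (rule integral_cong_AE) (use ae in auto)
    have "integrable M W \<longleftrightarrow> integrable M (\<lambda>x. 0::real)"
      by (rule integrable_cong_AE) (use ae in auto)
    moreover have "integrable M (\<lambda>x. (W x)\<^sup>2) \<longleftrightarrow> integrable M (\<lambda>x. 0::real)"
      by (rule integrable_cong_AE) (use ae in auto)
    ultimately show ?thesis using v c by (simp add: prob_space)
  qed
  then show "integrable M W" "integrable M (\<lambda>x. (W x)\<^sup>2)"
    "(CLINT x|M. iexp (W x)) = complex_of_real (exp (- expectation (\<lambda>x. (W x)\<^sup>2) / 2))"
    "expectation (\<lambda>x. (W x)\<^sup>2) > 0 \<Longrightarrow>
      distributed M lborel W (normal_density 0 (sqrt (expectation (\<lambda>x. (W x)\<^sup>2))))"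
    by auto
qed

locale gaussian_centered = prob_space N for N :: "'b measure" +
  fixes d :: nat and Y :: "'b \<Rightarrow> nat \<Rightarrow> real"
  assumes gauss: "gaussian_vector N d Y"
    and mean: "\<And>j. j \<in> {1..d} \<Longrightarrow> expectation (\<lambda>\<omega>. Y \<omega> j) = 0"
begin

definition cov :: "nat \<Rightarrow> nat \<Rightarrow> real" where "cov j k = expectation (\<lambda>\<omega>. Y \<omega> j * Y \<omega> k)"

text \<open>The residual of the linear regression of each coordinate on coordinate \<open>j\<close>.
  For \<open>cov j j > 0\<close> the coefficient makes every entry uncorrelated with
  \<open>Y \<omega> j\<close>, and entry \<open>j\<close> itself is 0.\<close>

definition resid :: "nat \<Rightarrow> 'b \<Rightarrow> nat \<Rightarrow> real" where
  "resid j \<omega> = (\<lambda>k\<in>{1..d}. Y \<omega> k - cov j k / cov j j * Y \<omega> j)"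

lemma Y_measurable[measurable]: "Y \<in> measurable N (borel_vec d)"
  using gauss by (simp add: gaussian_vector_def)

lemma comp_measurable: "j \<in> {1..d} \<Longrightarrow> (\<lambda>\<omega>. Y \<omega> j) \<in> borel_measurable N"
  using measurable_compose[OF Y_measurable measurable_component_singleton] by blast

lemma gaussian_coord: "j \<in> {1..d} \<Longrightarrow> gaussian_var N (\<lambda>\<omega>. Y \<omega> j)"
proof -
  assume j: "j \<in> {1..d}"
  have "gaussian_var N (\<lambda>\<omega>. \<Sum>k=1..d. a k * Y \<omega> k)" for a :: "nat \<Rightarrow> real"
    using gauss unfolding gaussian_vector_def by blast
  from this[of "\<lambda>k. if k = j then 1 else 0"]
  have "gaussian_var N (\<lambda>\<omega>. \<Sum>k=1..d. (if k = j then 1 else 0) * Y \<omega> k)" .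
  moreover have "(\<lambda>\<omega>. \<Sum>k=1..d. (if k = j then 1 else 0) * Y \<omega> k) = (\<lambda>\<omega>. Y \<omega> j)"
    using j by (simp add: if_distrib[of "\<lambda>x. x * _"] sum.delta cong: if_cong)
  ultimately show ?thesis by simp
qed

lemma integrable_coord: "j \<in> {1..d} \<Longrightarrow> integrable N (\<lambda>\<omega>. Y \<omega> j)"
  using gaussian_var_char(1)[OF gaussian_coord mean] .

lemma integrable_coord_mult:
  assumes "j \<in> {1..d}" "k \<in> {1..d}"
  shows "integrable N (\<lambda>\<omega>. Y \<omega> j * Y \<omega> k)"
proof (rule Bochner_Integration.integrable_bound)
  show "integrable N (\<lambda>\<omega>. (Y \<omega> j)\<^sup>2 + (Y \<omega> k)\<^sup>2)"
    using gaussian_var_char(2)[OF gaussian_coord mean] assms by auto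
  have "\<bar>x * y\<bar> \<le> x\<^sup>2 + y\<^sup>2" for x y :: real
  proof -
    have "2 * (\<bar>x\<bar> * \<bar>y\<bar>) \<le> x\<^sup>2 + y\<^sup>2"
      using sum_squares_bound[of "\<bar>x\<bar>" "\<bar>y\<bar>"] by simp
    moreover have "0 \<le> \<bar>x\<bar> * \<bar>y\<bar>" by simp
    ultimately show ?thesis unfolding abs_mult by linarith
  qed
  then show "AE \<omega> in N. norm (Y \<omega> j * Y \<omega> k) \<le> norm ((Y \<omega> j)\<^sup>2 + (Y \<omega> k)\<^sup>2)" by auto
qed (use comp_measurable assms in auto)

lemma cov_sym: "cov j k = cov k j" by (simp add: cov_def mult.commute)

lemma lincomb:
  fixes a :: "nat \<Rightarrow> real"
  defines "W \<equiv> (\<lambda>\<omega>. \<Sum>k=1..d. a k * Y \<omega> k)"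
  shows "gaussian_var N W" "expectation W = 0"
    "expectation (\<lambda>\<omega>. (W \<omega>)\<^sup>2) = (\<Sum>j=1..d. \<Sum>k=1..d. a j * a k * cov j k)"
proof -
  show "gaussian_var N W" using gauss unfolding gaussian_vector_def W_def by blast
  have "expectation W = (\<Sum>k=1..d. expectation (\<lambda>\<omega>. a k * Y \<omega> k))"
    unfolding W_def by (rule Bochner_Integration.integral_sum) (use integrable_coord in auto)
  then show "expectation W = 0" using mean by simp
  have "(W \<omega>)\<^sup>2 = (\<Sum>j=1..d. \<Sum>k=1..d. a j * a k * (Y \<omega> j * Y \<omega> k))" for \<omega>
    unfolding W_def power2_eq_square sum_product by (intro sum.cong refl) (simp add: ac_simps)
  then have "expectation (\<lambda>\<omega>. (W \<omega>)\<^sup>2) = expectation (\<lambda>\<omega>. \<Sum>j=1..d. \<Sum>k=1..d. a j * a k * (Y \<omega> j * Y \<omega> k))"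
    by simp
  also have "\<dots> = (\<Sum>j=1..d. \<Sum>k=1..d. a j * a k * cov j k)"
    unfolding cov_def
    by (subst Bochner_Integration.integral_sum, intro Bochner_Integration.integrable_sum integrable_mult_right integrable_coord_mult, simp_all)
      (intro sum.cong refl, subst Bochner_Integration.integral_sum, intro integrable_mult_right integrable_coord_mult, simp_all)
  finally show "expectation (\<lambda>\<omega>. (W \<omega>)\<^sup>2) = (\<Sum>j=1..d. \<Sum>k=1..d. a j * a k * cov j k)" .
qed

lemma lincomb_char:
  "(CLINT \<omega>|N. iexp (\<Sum>k=1..d. a k * Y \<omega> k)) =
    complex_of_real (exp (- (\<Sum>j=1..d. \<Sum>k=1..d. a j * a k * cov j k) / 2))"
  using gaussian_var_char(3)[OF lincomb(1,2)] unfolding lincomb(3) .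

lemma resid_measurable[measurable]: "j \<in> {1..d} \<Longrightarrow> resid j \<in> measurable N (borel_vec d)"
  unfolding resid_def by (rule measurable_restrict) (use comp_measurable in auto)

text \<open>Any combination of residual entries and \<open>Y \<omega> j\<close> is a combination of
  entries of \<open>Y\<close>, so its character is the exponential of a quadratic form in
  \<open>cov\<close>. Since the residual and \<open>Y \<omega> j\<close> are uncorrelated
  (\<open>orth\<close>), the cross terms \<open>x1\<close> and \<open>x2\<close> vanish and the
  exponential factors.\<close>

lemma resid_indep:
  assumes j: "j \<in> {1..d}" and v: "cov j j > 0"
  shows "distr N (borel_vec d) (resid j) \<Otimes>\<^sub>M distr N borel (\<lambda>\<omega>. Y \<omega> j) =
    distr N (borel_vec d \<Otimes>\<^sub>M borel) (\<lambda>\<omega>. (resid j \<omega>, Y \<omega> j))"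
proof (rule distr_pair_charI)
  fix t :: real and a :: "nat \<Rightarrow> real"
  define s where "s = (\<Sum>k=1..d. a k * (cov j k / cov j j))"
  \<comment> \<open>\<open>c t\<close> are the coefficients with respect to \<open>Y\<close>:
    expanding the residuals removes \<open>s\<close> from entry \<open>j\<close>, the extra term
    adds \<open>t\<close>. At \<open>t = 0\<close> the pure residual combination remains, and
    \<open>c t = c 0 + e\<close>.\<close>
  define c where "c = (\<lambda>(t::real) k. a k + (if k = j then t - s else 0))"
  define e where "e = (\<lambda>k. if k = j then t else 0)"
  have delta: "(\<Sum>k=1..d. (if k = j then u else 0) * f k) = u * f j" for u and f :: "nat \<Rightarrow> real"
    using j by (simp add: if_distrib[of "\<lambda>x. x * _"] sum.delta cong: if_cong)
  have 1: "(\<Sum>k=1..d. a k * resid j \<omega> k) + t * Y \<omega> j = (\<Sum>k=1..d. c t k * Y \<omega> k)" for \<omega> t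
  proof -
    have "(\<Sum>k=1..d. a k * resid j \<omega> k) = (\<Sum>k=1..d. a k * Y \<omega> k - a k * (cov j k / cov j j) * Y \<omega> j)"
      by (intro sum.cong refl) (simp add: resid_def right_diff_distrib mult.assoc)
    also have "\<dots> = (\<Sum>k=1..d. a k * Y \<omega> k) - s * Y \<omega> j"
      by (simp only: sum_subtractf s_def sum_distrib_right)
    finally show ?thesis
      by (simp add: c_def distrib_right sum.distrib delta left_diff_distrib)
  qed
  have 0: "(\<Sum>k=1..d. a k * resid j \<omega> k) = (\<Sum>k=1..d. c 0 k * Y \<omega> k)" for \<omega>
    using 1[of \<omega> 0] by simp
  have 2: "t * Y \<omega> j = (\<Sum>k=1..d. e k * Y \<omega> k)" for \<omega>
    unfolding e_def by (simp add: delta)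
  have q: "c t k = c 0 k + e k" for k by (simp add: c_def e_def)
  have orth: "(\<Sum>k=1..d. c 0 k * cov j k) = 0"
    using v by (simp add: c_def distrib_right sum.distrib delta s_def sum_distrib_right)
  have x1: "(\<Sum>i=1..d. \<Sum>k=1..d. e i * c 0 k * cov i k) = 0"
  proof -
    have "(\<Sum>i=1..d. \<Sum>k=1..d. e i * c 0 k * cov i k) = (\<Sum>i=1..d. e i * (\<Sum>k=1..d. c 0 k * cov i k))"
      by (simp add: sum_distrib_left mult.assoc)
    also have "\<dots> = 0" unfolding e_def using orth by (simp add: delta)
    finally show ?thesis .
  qed
  have x2: "(\<Sum>i=1..d. \<Sum>k=1..d. c 0 i * e k * cov i k) = 0"
    using x1 by (subst sum.swap) (simp add: cov_sym mult.commute mult.left_commute)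
  have "(\<Sum>i=1..d. \<Sum>k=1..d. c t i * c t k * cov i k) =
      (\<Sum>i=1..d. \<Sum>k=1..d. c 0 i * c 0 k * cov i k) + (\<Sum>i=1..d. \<Sum>k=1..d. e i * e k * cov i k) +
      (\<Sum>i=1..d. \<Sum>k=1..d. e i * c 0 k * cov i k) + (\<Sum>i=1..d. \<Sum>k=1..d. c 0 i * e k * cov i k)"
    unfolding q sum.distrib[symmetric] by (intro sum.cong refl) (simp add: algebra_simps)
  then have Q: "(\<Sum>i=1..d. \<Sum>k=1..d. c t i * c t k * cov i k) =
      (\<Sum>i=1..d. \<Sum>k=1..d. c 0 i * c 0 k * cov i k) + (\<Sum>i=1..d. \<Sum>k=1..d. e i * e k * cov i k)"
    using x1 x2 by simp
  show "(CLINT \<omega>|N. iexp ((\<Sum>k\<in>{1..d}. a k * resid j \<omega> k) + t * Y \<omega> j)) =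
        (CLINT \<omega>|N. iexp (\<Sum>k\<in>{1..d}. a k * resid j \<omega> k)) * (CLINT \<omega>|N. iexp (t * Y \<omega> j))"
    unfolding 1 unfolding 0 unfolding 2 lincomb_char Q
    by (simp only: add_divide_distrib minus_add_distrib exp_add of_real_mult)
qed (use j comp_measurable in auto)

lemma resid_indep_prob:
  assumes j: "j \<in> {1..d}" and v: "cov j j > 0" and B: "B \<in> sets (borel_vec d)" and C: "C \<in> sets borel"
  shows "prob {\<omega>\<in>space N. resid j \<omega> \<in> B \<and> Y \<omega> j \<in> C} =
    prob {\<omega>\<in>space N. resid j \<omega> \<in> B} * prob {\<omega>\<in>space N. Y \<omega> j \<in> C}"
proof -
  note [measurable] = j B C comp_measurable[OF j]
  interpret V: prob_space "distr N (borel_vec d) (resid j)" by (rule prob_space_distr) simp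
  interpret U: prob_space "distr N borel (\<lambda>\<omega>. Y \<omega> j)" by (rule prob_space_distr) simp
  have "emeasure (distr N (borel_vec d) (resid j) \<Otimes>\<^sub>M distr N borel (\<lambda>\<omega>. Y \<omega> j)) (B \<times> C) =
      emeasure (distr N (borel_vec d) (resid j)) B * emeasure (distr N borel (\<lambda>\<omega>. Y \<omega> j)) C"
    by (rule U.emeasure_pair_measure_Times) simp_all
  then have "emeasure N {\<omega>\<in>space N. resid j \<omega> \<in> B \<and> Y \<omega> j \<in> C} =
      emeasure N {\<omega>\<in>space N. resid j \<omega> \<in> B} * emeasure N {\<omega>\<in>space N. Y \<omega> j \<in> C}"
    unfolding resid_indep[OF j v]
    by (simp add: emeasure_distr vimage_def Int_def conj_commute mem_Times_iff)
  then show ?thesis by (simp add: emeasure_eq_measure ennreal_mult[symmetric])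
qed

lemma distributed_coord:
  assumes "j \<in> {1..d}" "cov j j > 0"
  shows "distributed N lborel (\<lambda>\<omega>. Y \<omega> j) (normal_density 0 (sqrt (cov j j)))"
  using gaussian_var_char(4)[OF gaussian_coord mean] assms by (simp add: cov_def power2_eq_square)

end

section \<open>Anti-concentration of the Gaussian maximum norm\<close>

abbreviation std_normal_measure :: "real measure" where
  "std_normal_measure \<equiv> density lborel (\<lambda>x. ennreal (std_normal_density x))"

lemma std_normal_density_antimono: "\<bar>x\<bar> \<le> \<bar>y\<bar> \<Longrightarrow> std_normal_density y \<le> std_normal_density x"
  unfolding std_normal_density_def by (simp add: abs_le_square_iff divide_right_mono)

text \<open>Over the interval the density is at most its value at \<open>u\<close>, either because
  the interval lies to the right of \<open>u\<close> or because 0 is the mode; the second option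
  lets \<open>t\<close> be negative.\<close>

lemma std_normal_interval_le:
  assumes "e \<ge> 0" "u \<ge> 0" "t \<ge> u \<or> u = 0"
  shows "measure std_normal_measure {t<..t+e} \<le> e * std_normal_density u"
proof -
  have "emeasure std_normal_measure {t<..t+e} = (\<integral>\<^sup>+x. ennreal (std_normal_density x) * indicator {t<..t+e} x \<partial>lborel)"
    by (simp add: emeasure_density)
  also have "\<dots> \<le> (\<integral>\<^sup>+x. ennreal (std_normal_density u) * indicator {t<..t+e} x \<partial>lborel)"
    by (rule nn_integral_mono) (use assms in \<open>auto simp: indicator_def intro!: ennreal_leI std_normal_density_antimono\<close>)
  also have "\<dots> = ennreal (e * std_normal_density u)"
    using assms by (simp add: nn_integral_cmult_indicator ennreal_mult[symmetric] mult.commute)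
  finally show ?thesis
    unfolding measure_def by (intro enn2real_leI) (use assms in auto)
qed

lemma std_normal_interval_ge:
  assumes "e \<ge> 0" "s \<ge> 0"
  shows "e * std_normal_density (s + e) \<le> measure std_normal_measure {s<..}"
proof -
  interpret prob_space std_normal_measure by (rule prob_space_normal_density) simp
  have "ennreal (e * std_normal_density (s + e)) = (\<integral>\<^sup>+x. ennreal (std_normal_density (s+e)) * indicator {s<..s+e} x \<partial>lborel)"
    using assms by (simp add: nn_integral_cmult_indicator ennreal_mult[symmetric] mult.commute)
  also have "\<dots> \<le> (\<integral>\<^sup>+x. ennreal (std_normal_density x) * indicator {s<..s+e} x \<partial>lborel)"
    by (rule nn_integral_mono) (use assms in \<open>auto simp: indicator_def intro!: ennreal_leI std_normal_density_antimono\<close>)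
  also have "\<dots> = emeasure std_normal_measure {s<..s+e}"
    by (simp add: emeasure_density)
  also have "\<dots> = ennreal (prob {s<..s+e})" by (simp add: emeasure_eq_measure)
  finally have "e * std_normal_density (s + e) \<le> prob {s<..s+e}" by (simp add: )
  also have "\<dots> \<le> prob {s<..}" by (rule finite_measure_mono) auto
  finally show ?thesis .
qed

text \<open>The hazard rate of the normal law grows only linearly. The tail is bounded below by the
  mass of a window of length \<open>h\<close> next to \<open>s\<close>; the loss in the exponent
  from \<open>u\<close> to \<open>s + h\<close> is
  \<open>u * e + u * h + (e + h)^2 / 2 \<le> 1 + 1 + 2\<close>, whence \<open>exp 4\<close>, and
  \<open>1 / h = 1 + s \<le> T + 2\<close>.\<close>

lemma std_normal_hazard:
  fixes t e T :: real
  assumes e: "0 \<le> e" "e \<le> 1" and T: "t \<le> T" "0 \<le> T" "e * T \<le> 1"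
  shows "measure std_normal_measure {t<..t+e} \<le> exp 4 * e * (T + 2) * measure std_normal_measure {t+e<..}"
proof -
  interpret prob_space std_normal_measure by (rule prob_space_normal_density) simp
  \<comment> \<open>For negative \<open>t\<close> the mode bounds the density, and the tail beyond
    \<open>u + e\<close> is only smaller than the one beyond \<open>t + e\<close>, so
    \<open>t\<close> may be raised to 0.\<close>
  define u where "u = max t 0"
  define s where "s = u + e"
  define h where "h = 1 / (1 + s)"
  have u: "u \<ge> 0" "u \<le> T" "t \<le> u" using T by (auto simp: u_def)
  have s: "s \<ge> 0" "u \<le> s" "s \<le> T + 1" using u e by (auto simp: s_def)
  have h: "h \<ge> 0" "h \<le> 1" using s by (auto simp: h_def)
  have uh: "u * h \<le> 1" using s u by (simp add: h_def divide_le_eq)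
  have ue: "u * e \<le> 1" using mult_right_mono[OF u(2) e(1)] T by (simp add: mult.commute)
  have "(e + h)\<^sup>2 \<le> 2\<^sup>2" using e h by (intro power_mono) auto
  then have "(s + h)\<^sup>2 / 2 - u\<^sup>2 / 2 \<le> 4"
    using uh ue by (simp add: s_def power2_eq_square algebra_simps)
  then have "exp (- u\<^sup>2 / 2) \<le> exp (4 + - (s + h)\<^sup>2 / 2)" by simp
  then have den: "std_normal_density u \<le> exp 4 * std_normal_density (s + h)"
    unfolding exp_add std_normal_density_def by (simp add: field_simps)
  have "h * std_normal_density (s + h) \<le> prob {s<..}"
    by (rule std_normal_interval_ge) (use h s in auto)
  also have "\<dots> \<le> prob {t+e<..}" by (rule finite_measure_mono) (use u in \<open>auto simp: s_def\<close>)
  finally have "std_normal_density (s + h) \<le> (1 + s) * prob {t+e<..}"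
    using s by (simp add: h_def divide_simps mult.commute)
  also have "\<dots> \<le> (T + 2) * prob {t+e<..}" by (rule mult_right_mono) (use s in auto)
  finally have "std_normal_density u \<le> exp 4 * ((T + 2) * prob {t+e<..})"
    using den by (meson exp_ge_zero mult_left_mono order_trans)
  moreover have "prob {t<..t+e} \<le> e * std_normal_density u"
    by (rule std_normal_interval_le) (use e u in \<open>auto simp: u_def\<close>)
  ultimately have "prob {t<..t+e} \<le> e * (exp 4 * ((T + 2) * prob {t+e<..}))"
    using e by (meson mult_left_mono order_trans)
  then show ?thesis by (simp add: mult.assoc mult.left_commute)
qed


lemma normal_coord_measure:
  assumes "prob_space M" "distributed M lborel Z (normal_density 0 1)" "C \<in> sets borel"
  shows "measure M {\<omega>\<in>space M. Z \<omega> \<in> C} = measure std_normal_measure C"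
proof -
  have [measurable]: "Z \<in> borel_measurable M" using distributed_measurable[OF assms(2)] by simp
  have "distr M lborel Z = std_normal_measure"
    using distributed_distr_eq_density[OF assms(2)] by simp
  then have "measure std_normal_measure C = measure (distr M lborel Z) C" by simp
  also have "\<dots> = measure M {\<omega>\<in>space M. Z \<omega> \<in> C}"
    using assms(3) by (subst measure_distr) (auto simp: vimage_def Int_def conj_commute)
  finally show ?thesis ..
qed

context gaussian_centered
begin

text \<open>
  The event that \<open>Y j - t j\<close> is the largest excess is, for a fixed residual, an upward closed set of
  values of \<open>Y j\<close>; hence the hazard rate of the standard normal law controls the chance that
  \<open>Y j\<close> lies just above its threshold.
\<close>

lemma argmax_hazard:
  fixes t :: "nat \<Rightarrow> real"
  assumes j: "j \<in> {1..d}" and var: "\<And>k. k \<in> {1..d} \<Longrightarrow> cov k k = 1" and K: "K \<ge> 0"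
    and hz: "measure std_normal_measure {t j<..t j + e} \<le> K * measure std_normal_measure {t j + e<..}"
  defines "A \<equiv> {\<omega>\<in>space N. \<forall>k\<in>{1..d}. if k < j then Y \<omega> k - t k < Y \<omega> j - t j else Y \<omega> k - t k \<le> Y \<omega> j - t j}"
  shows "prob {\<omega>\<in>A. t j < Y \<omega> j \<and> Y \<omega> j \<le> t j + e} \<le> K * prob A"
proof -
  note [measurable] = comp_measurable[OF j] resid_measurable[OF j]
  have v: "cov j j > 0" using var[OF j] by simp
  have dist: "distributed N lborel (\<lambda>\<omega>. Y \<omega> j) (normal_density 0 1)"
    using distributed_coord[OF j v] var[OF j] by simp
  have C: "{t j<..t j + e} \<in> sets borel" "{t j + e<..} \<in> sets borel" by simp_all
  have ps: "prob_space N" by (rule prob_space_axioms)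
  \<comment> \<open>Unit variances bound the correlation by 1, so \<open>1 - cov j k\<close> is
    nonnegative and the constraint that coordinate \<open>j\<close> beats \<open>k\<close> gets
    weaker as \<open>Y \<omega> j\<close> grows.\<close>
  have rho: "cov j k \<le> 1" if k: "k \<in> {1..d}" for k
  proof -
    have "0 \<le> expectation (\<lambda>\<omega>. (Y \<omega> j - Y \<omega> k)\<^sup>2)" by (rule Bochner_Integration.integral_nonneg) simp
    also have "(\<lambda>\<omega>. (Y \<omega> j - Y \<omega> k)\<^sup>2) = (\<lambda>\<omega>. Y \<omega> j * Y \<omega> j + Y \<omega> k * Y \<omega> k - 2 * (Y \<omega> j * Y \<omega> k))"
      by (simp add: power2_eq_square algebra_simps)
    also have "expectation \<dots> = cov j j + cov k k - 2 * cov j k"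
      using integrable_coord_mult j k by (simp add: cov_def)
    finally show ?thesis using var j k by simp
  qed
  \<comment> \<open>The winning condition, solved for the residual, with \<open>Y \<omega> j\<close>
    frozen at \<open>t j + e\<close>. Values up to this point impose a stronger constraint
    (\<open>sub1\<close>), values above it a weaker one (\<open>sub2\<close>), so one residual event
    \<open>B\<close> serves both inclusions; independence then exchanges the interval for the
    tail.\<close>
  define c where "c = (\<lambda>k. t k - t j + (1 - cov j k) * (t j + e))"
  define B where "B = {x \<in> space (borel_vec d). \<forall>k\<in>{1..d}-{j}. x k \<in> (if k < j then {..<c k} else {..c k})}"
  have B[measurable]: "B \<in> sets (borel_vec d)"
    unfolding B_def by (rule sets_rectangle) auto
  have res: "resid j \<omega> k = Y \<omega> k - cov j k * Y \<omega> j" if "k \<in> {1..d}" for \<omega> k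
    using that var[OF j] by (simp add: resid_def)
  have spB: "resid j \<omega> \<in> space (borel_vec d)" if "\<omega> \<in> space N" for \<omega>
    using measurable_space[OF resid_measurable[OF j] that] .
  have sub1: "{\<omega>\<in>A. t j < Y \<omega> j \<and> Y \<omega> j \<le> t j + e} \<subseteq>
      {\<omega>\<in>space N. resid j \<omega> \<in> B \<and> Y \<omega> j \<in> {t j<..t j + e}}"
  proof (intro subsetI CollectI conjI)
    fix \<omega> assume w: "\<omega> \<in> {\<omega>\<in>A. t j < Y \<omega> j \<and> Y \<omega> j \<le> t j + e}"
    show "\<omega> \<in> space N" using w by (simp add: A_def)
    have "resid j \<omega> k \<in> (if k < j then {..<c k} else {..c k})" if k: "k \<in> {1..d}-{j}" for k
    proof -
      have "(1 - cov j k) * Y \<omega> j \<le> (1 - cov j k) * (t j + e)"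
        using rho[of k] k w by (intro mult_left_mono) auto
      moreover have "if k < j then Y \<omega> k - t k < Y \<omega> j - t j else Y \<omega> k - t k \<le> Y \<omega> j - t j"
        using w k by (simp add: A_def)
      ultimately show ?thesis using k by (simp add: res c_def left_diff_distrib split: if_splits)
    qed
    then show "resid j \<omega> \<in> B" using spB w by (simp add: B_def A_def)
    show "Y \<omega> j \<in> {t j<..t j + e}" using w by simp
  qed
  have sub2: "{\<omega>\<in>space N. resid j \<omega> \<in> B \<and> Y \<omega> j \<in> {t j + e<..}} \<subseteq> A"
  proof
    fix \<omega> assume w: "\<omega> \<in> {\<omega>\<in>space N. resid j \<omega> \<in> B \<and> Y \<omega> j \<in> {t j + e<..}}"
    have "if k < j then Y \<omega> k - t k < Y \<omega> j - t j else Y \<omega> k - t k \<le> Y \<omega> j - t j" if k: "k \<in> {1..d}" for k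
    proof (cases "k = j")
      case False
      have "(1 - cov j k) * (t j + e) \<le> (1 - cov j k) * Y \<omega> j"
        using rho[of k] k w by (intro mult_left_mono) auto
      moreover have "resid j \<omega> k \<in> (if k < j then {..<c k} else {..c k})"
        using w k False by (simp add: B_def)
      ultimately show ?thesis using k by (simp add: res c_def left_diff_distrib split: if_splits)
    qed simp
    then show "\<omega> \<in> A" using w by (simp add: A_def)
  qed
  have A[measurable]: "A \<in> sets N"
    unfolding A_def
  proof (rule sets.sets_Collect_finite_All)
    fix k assume "k \<in> {1..d}"
    note [measurable] = comp_measurable[OF this]
    show "{\<omega> \<in> space N. if k < j then Y \<omega> k - t k < Y \<omega> j - t j else Y \<omega> k - t k \<le> Y \<omega> j - t j} \<in> sets N"
      by measurable
  qed simp
  have "prob {\<omega>\<in>A. t j < Y \<omega> j \<and> Y \<omega> j \<le> t j + e} \<le>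
      prob {\<omega>\<in>space N. resid j \<omega> \<in> B \<and> Y \<omega> j \<in> {t j<..t j + e}}"
    by (rule finite_measure_mono[OF sub1]) measurable
  also have "\<dots> = prob {\<omega>\<in>space N. resid j \<omega> \<in> B} * measure std_normal_measure {t j<..t j + e}"
    unfolding resid_indep_prob[OF j v B C(1)] normal_coord_measure[OF ps dist C(1)] ..
  also have "\<dots> \<le> prob {\<omega>\<in>space N. resid j \<omega> \<in> B} * (K * measure std_normal_measure {t j + e<..})"
    using hz by (intro mult_left_mono) auto
  also have "\<dots> = K * prob {\<omega>\<in>space N. resid j \<omega> \<in> B \<and> Y \<omega> j \<in> {t j + e<..}}"
    unfolding resid_indep_prob[OF j v B C(2)] normal_coord_measure[OF ps dist C(2)] by (rule mult.left_commute)
  also have "\<dots> \<le> K * prob A"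
    by (intro mult_left_mono finite_measure_mono[OF sub2] K) measurable
  finally show ?thesis .
qed

text \<open>The sample points are separated by the index \<open>j\<close> of the largest excess.
  Where \<open>t j \<le> T\<close> the hazard bound is summed against the disjoint events
  \<open>A j\<close>, of total mass at most 1; where \<open>t j > T\<close> the density is at most
  \<open>1 / d\<close>, so at most \<open>d\<close> such terms cost \<open>e\<close> in all.
  \<open>T\<close> solves \<open>exp (- T^2 / 2) = 1 / d\<close>.\<close>

theorem anti_concentration:
  fixes t :: "nat \<Rightarrow> real"
  assumes d: "d \<ge> 1" and var: "\<And>k. k \<in> {1..d} \<Longrightarrow> cov k k = 1" and e: "e \<ge> 0"
  shows "prob {\<omega>\<in>space N. (\<exists>k\<in>{1..d}. t k < Y \<omega> k) \<and> (\<forall>k\<in>{1..d}. Y \<omega> k \<le> t k + e)}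
    \<le> exp 4 * e * (sqrt (2 * ln (real d)) + 3)"
proof -
  define T where "T = sqrt (2 * ln (real d))"
  have T0: "T \<ge> 0" using d by (simp add: T_def)
  have e4: "exp 4 \<ge> (1::real)" by simp
  show ?thesis unfolding T_def[symmetric]
  \<comment> \<open>Outside this range the claimed bound is at least 1; inside it the smallness
    hypotheses of \<open>std_normal_hazard\<close> hold.\<close>
  proof (cases "e \<le> 1 \<and> e * T \<le> 1")
    case False
    have "1 \<le> e * (T + 3)"
    proof (cases "e \<le> 1")
      case True
      then show ?thesis using False e by (simp add: distrib_left)
    next
      case f: False
      have "e * 1 \<le> e * (T + 3)" using e T0 by (intro mult_left_mono) auto
      then show ?thesis using f by linarith
    qed
    also have "\<dots> \<le> exp 4 * (e * (T + 3))" using e T0 e4 mult_right_mono[of 1 "exp 4" "e * (T+3)"] by simp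
    finally have "1 \<le> exp 4 * e * (T + 3)" by (simp add: mult.assoc)
    then show "prob {\<omega>\<in>space N. (\<exists>k\<in>{1..d}. t k < Y \<omega> k) \<and> (\<forall>k\<in>{1..d}. Y \<omega> k \<le> t k + e)} \<le> exp 4 * e * (T + 3)"
      using prob_le_1 order_trans by blast
  next
    case True
    define A where "A = (\<lambda>j. {\<omega>\<in>space N. \<forall>k\<in>{1..d}. if k < j then Y \<omega> k - t k < Y \<omega> j - t j else Y \<omega> k - t k \<le> Y \<omega> j - t j})"
    define D where "D = (\<lambda>j. {\<omega>\<in>A j. t j < Y \<omega> j \<and> Y \<omega> j \<le> t j + e})"
    have A[measurable]: "A j \<in> sets N" if j: "j \<in> {1..d}" for j
      unfolding A_def
    proof (rule sets.sets_Collect_finite_All)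
      fix k assume "k \<in> {1..d}"
      note [measurable] = comp_measurable[OF this] comp_measurable[OF j]
      show "{\<omega> \<in> space N. if k < j then Y \<omega> k - t k < Y \<omega> j - t j else Y \<omega> k - t k \<le> Y \<omega> j - t j} \<in> sets N"
        by measurable
    qed simp
    have D: "D j \<in> sets N" if j: "j \<in> {1..d}" for j
    proof -
      note [measurable] = comp_measurable[OF j] A[OF j]
      have "D j = A j \<inter> {\<omega>\<in>space N. t j < Y \<omega> j \<and> Y \<omega> j \<le> t j + e}"
        unfolding D_def A_def by auto
      also have "\<dots> \<in> sets N" by measurable
      finally show ?thesis .
    qed
    have disj: "disjoint_family_on A {1..d}"
      unfolding disjoint_family_on_def
    proof (intro ballI impI)
      have *: "A i \<inter> A j = {}" if ij: "i \<in> {1..d}" "j \<in> {1..d}" "i < j" for i j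
      proof (rule equals0I)
        fix \<omega> assume w: "\<omega> \<in> A i \<inter> A j"
        then have "Y \<omega> i - t i < Y \<omega> j - t j" using ij unfolding A_def by fastforce
        moreover have "Y \<omega> j - t j \<le> Y \<omega> i - t i" using w ij unfolding A_def by fastforce
        ultimately show False by simp
      qed
      fix i j assume "i \<in> {1..d}" "j \<in> {1..d}" "i \<noteq> j"
      then show "A i \<inter> A j = {}" using *[of i j] *[of j i] by (cases "i < j") (auto simp: Int_commute)
    qed
    have sub: "{\<omega>\<in>space N. (\<exists>k\<in>{1..d}. t k < Y \<omega> k) \<and> (\<forall>k\<in>{1..d}. Y \<omega> k \<le> t k + e)} \<subseteq> (\<Union>j\<in>{1..d}. D j)"
    proof
      fix \<omega> assume w: "\<omega> \<in> {\<omega>\<in>space N. (\<exists>k\<in>{1..d}. t k < Y \<omega> k) \<and> (\<forall>k\<in>{1..d}. Y \<omega> k \<le> t k + e)}"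
      define m where "m = Max ((\<lambda>k. Y \<omega> k - t k) ` {1..d})"
      have m: "k \<in> {1..d} \<Longrightarrow> Y \<omega> k - t k \<le> m" for k unfolding m_def by (rule Max_ge) auto
      have "m \<in> (\<lambda>k. Y \<omega> k - t k) ` {1..d}" unfolding m_def by (rule Max_in) (use d in auto)
      then obtain j0 where j0: "j0 \<in> {1..d} \<and> Y \<omega> j0 - t j0 = m" by auto
      \<comment> \<open>Ties go to the smallest index, matching the strict inequality for
        \<open>k < j\<close> in \<open>A\<close>, which makes the events disjoint.\<close>
      define j where "j = (LEAST j. j \<in> {1..d} \<and> Y \<omega> j - t j = m)"
      have j: "j \<in> {1..d} \<and> Y \<omega> j - t j = m" unfolding j_def by (rule LeastI[of _ j0]) (rule j0)
      have lt: "Y \<omega> k - t k < m" if "k \<in> {1..d}" "k < j" for k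
        using not_less_Least[of k "\<lambda>j. j \<in> {1..d} \<and> Y \<omega> j - t j = m"] that m[of k]
        unfolding j_def by fastforce
      obtain k where k: "k \<in> {1..d}" "t k < Y \<omega> k" using w by auto
      have "m > 0" using k m[of k] by simp
      then have "\<omega> \<in> D j" using w j m lt unfolding D_def A_def by auto
      then show "\<omega> \<in> (\<Union>j\<in>{1..d}. D j)" using j by blast
    qed
    have bound: "prob (D j) \<le> e / real d + exp 4 * e * (T + 2) * prob (A j)" if j: "j \<in> {1..d}" for j
    proof (cases "t j \<le> T")
      case tT: True
      have "prob (D j) \<le> exp 4 * e * (T + 2) * prob (A j)"
        unfolding D_def A_def
        by (rule argmax_hazard[OF j var _ std_normal_hazard]) (use e T0 True tT in auto)
      then show ?thesis using e by (simp add: add_increasing)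
    next
      case False
      note [measurable] = comp_measurable[OF j]
      have v: "cov j j > 0" using var[OF j] by simp
      have dist: "distributed N lborel (\<lambda>\<omega>. Y \<omega> j) (normal_density 0 1)"
        using distributed_coord[OF j v] var[OF j] by simp
      have "prob (D j) \<le> prob {\<omega>\<in>space N. Y \<omega> j \<in> {t j<..t j + e}}"
        by (rule finite_measure_mono) (auto simp: D_def A_def)
      also have "\<dots> = measure std_normal_measure {t j<..t j + e}"
        by (rule normal_coord_measure[OF _ dist]) (simp_all add: prob_space_axioms)
      also have "\<dots> \<le> e * std_normal_density T"
        by (rule std_normal_interval_le) (use e T0 False in auto)
      also have "\<dots> \<le> e * (1 / real d)"
      proof (rule mult_left_mono[OF _ e])
        have "exp (- T\<^sup>2 / 2) = 1 / real d"
          using d by (simp add: T_def exp_minus field_simps)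
        moreover have "1 / sqrt (2 * pi) \<le> 1" using pi_ge_two by (simp add: real_le_rsqrt)
        ultimately show "std_normal_density T \<le> 1 / real d"
          using mult_right_mono[of "1 / sqrt (2 * pi)" 1 "1 / real d"] by (simp add: std_normal_density_def)
      qed
      finally have "prob (D j) \<le> e / real d" by simp
      moreover have "0 \<le> exp 4 * e * (T + 2) * prob (A j)" using e T0 by simp
      ultimately show ?thesis by linarith
    qed
    have "prob {\<omega>\<in>space N. (\<exists>k\<in>{1..d}. t k < Y \<omega> k) \<and> (\<forall>k\<in>{1..d}. Y \<omega> k \<le> t k + e)} \<le> prob (\<Union>j\<in>{1..d}. D j)"
      by (rule finite_measure_mono[OF sub]) (use D in auto)
    also have "\<dots> \<le> (\<Sum>j\<in>{1..d}. prob (D j))"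
      by (rule finite_measure_subadditive_finite) (use D in auto)
    also have "\<dots> \<le> (\<Sum>j\<in>{1..d}. e / real d + exp 4 * e * (T + 2) * prob (A j))"
      by (rule sum_mono) (rule bound)
    also have "\<dots> = e + exp 4 * e * (T + 2) * (\<Sum>j\<in>{1..d}. prob (A j))"
      using d by (simp add: sum.distrib sum_distrib_left)
    also have "(\<Sum>j\<in>{1..d}. prob (A j)) = prob (\<Union>j\<in>{1..d}. A j)"
      by (rule finite_measure_finite_Union[symmetric]) (use A disj in auto)
    also have "e + exp 4 * e * (T + 2) * prob (\<Union>j\<in>{1..d}. A j) \<le> e + exp 4 * e * (T + 2)"
      using mult_left_mono[OF prob_le_1, of "exp 4 * e * (T + 2)"] e T0 by simp
    also have "\<dots> \<le> exp 4 * e + exp 4 * e * (T + 2)"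
      using mult_right_mono[OF e4 e] by simp
    also have "\<dots> = exp 4 * e * (T + 3)" by (simp add: algebra_simps)
    finally show "prob {\<omega>\<in>space N. (\<exists>k\<in>{1..d}. t k < Y \<omega> k) \<and> (\<forall>k\<in>{1..d}. Y \<omega> k \<le> t k + e)} \<le> exp 4 * e * (T + 3)" .
  qed
qed

end

lemma linf_norm_le_iff: "p \<ge> 1 \<Longrightarrow> linf_norm p x \<le> t \<longleftrightarrow> (\<forall>j\<in>{1..p}. \<bar>x j\<bar> \<le> t)"
  unfolding linf_norm_def by (subst Max_le_iff) auto

text \<open>The vector of all \<open>Y \<omega> j / sd j\<close> and their negatives has unit
  variances and a one-sided maximum in place of the norm. A common level \<open>t\<close> becomes
  \<open>t / sd j\<close>, different for each coordinate, which is why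
  \<open>anti_concentration\<close> takes a vector of thresholds. The doubled vector has a singular
  covariance matrix, which \<open>gaussian_vector\<close> permits.\<close>

theorem (in gaussian_centered) linf_anti_concentration:
  assumes d: "d \<ge> 1" and b: "b > 0" and var: "\<And>j. j \<in> {1..d} \<Longrightarrow> cov j j \<ge> b" and e: "e \<ge> 0"
  shows "prob {\<omega>\<in>space N. t < linf_norm d (Y \<omega>) \<and> linf_norm d (Y \<omega>) \<le> t + e}
    \<le> exp 4 * (e / sqrt b) * (sqrt (2 * ln (2 * real d)) + 3)"
proof -
  define sd where "sd = (\<lambda>j. sqrt (cov j j))"
  \<comment> \<open>An index \<open>i\<close> above \<open>d\<close> stands for the negative of
    coordinate \<open>i - d\<close>.\<close>
  define c where "c = (\<lambda>i. if i \<le> d then 1 / sd i else - 1 / sd (i - d))"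
  define ix where "ix = (\<lambda>i. if i \<le> d then i else i - d)"
  define Z where "Z = (\<lambda>\<omega>. \<lambda>i\<in>{1..2*d}. c i * Y \<omega> (ix i))"
  have ix: "ix i \<in> {1..d}" if "i \<in> {1..2*d}" for i using that by (auto simp: ix_def)
  have sd: "sd j \<ge> sqrt b" "sd j > 0" "sd j * sd j = cov j j" if "j \<in> {1..d}" for j
    using var[OF that] b by (auto simp: sd_def)
  have cc: "c i * c i * cov (ix i) (ix i) = 1" if "i \<in> {1..2*d}" for i
    using sd[OF ix[OF that]] by (auto simp: c_def ix_def field_simps)
  have sum: "(\<Sum>i=1..2*d. a i * Z \<omega> i) = (\<Sum>j=1..d. (a j * c j + a (j + d) * c (j + d)) * Y \<omega> j)" for a \<omega>
  proof -
    have S: "{1..2*d} = {1..d} \<union> (\<lambda>j. j + d) ` {1..d}"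
    proof (intro set_eqI iffI)
      fix x assume "x \<in> {1..2*d}"
      then show "x \<in> {1..d} \<union> (\<lambda>j. j + d) ` {1..d}"
        by (cases "x \<le> d") (auto simp: image_iff intro!: bexI[of _ "x - d"])
    qed auto
    have "(\<Sum>i=1..2*d. a i * Z \<omega> i) = (\<Sum>i=1..2*d. a i * c i * Y \<omega> (ix i))"
      by (rule sum.cong) (auto simp: Z_def)
    also have "\<dots> =
        (\<Sum>i=1..d. a i * c i * Y \<omega> (ix i)) + (\<Sum>i\<in>(\<lambda>j. j + d) ` {1..d}. a i * c i * Y \<omega> (ix i))"
      unfolding S by (rule sum.union_disjoint) auto
    also have "(\<Sum>i\<in>(\<lambda>j. j + d) ` {1..d}. a i * c i * Y \<omega> (ix i)) = (\<Sum>j=1..d. a (j + d) * c (j + d) * Y \<omega> j)"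
      by (subst sum.reindex) (auto simp: inj_on_def ix_def intro!: sum.cong)
    also have "(\<Sum>i=1..d. a i * c i * Y \<omega> (ix i)) = (\<Sum>i=1..d. a i * c i * Y \<omega> i)"
      by (rule sum.cong) (auto simp: ix_def)
    finally show ?thesis by (simp add: sum.distrib distrib_right)
  qed
  interpret G: gaussian_centered N "2 * d" Z
  proof
    show "gaussian_vector N (2 * d) Z"
      unfolding gaussian_vector_def
    proof (intro conjI allI)
      show "Z \<in> measurable N (borel_vec (2 * d))"
        unfolding Z_def by (rule measurable_restrict) (use comp_measurable ix in auto)
      show "gaussian_var N (\<lambda>\<omega>. \<Sum>j=1..2*d. a j * Z \<omega> j)" for a :: "nat \<Rightarrow> real"
        unfolding sum by (rule lincomb(1))
    qed
    show "expectation (\<lambda>\<omega>. Z \<omega> j) = 0" if "j \<in> {1..2 * d}" for j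
      using that mean[OF ix[OF that]] by (simp add: Z_def)
  qed
  have covZ: "G.cov i i = 1" if i: "i \<in> {1..2*d}" for i
  proof -
    have "G.cov i i = expectation (\<lambda>\<omega>. Z \<omega> i * Z \<omega> i)" by (rule G.cov_def)
    also have "(\<lambda>\<omega>. Z \<omega> i * Z \<omega> i) = (\<lambda>\<omega>. c i * c i * (Y \<omega> (ix i) * Y \<omega> (ix i)))"
      using i by (simp add: Z_def ac_simps)
    also have "expectation \<dots> = c i * c i * cov (ix i) (ix i)" by (simp add: cov_def)
    finally show ?thesis using cc[OF i] by simp
  qed
  have Zs: "Z \<omega> k = (if k \<le> d then Y \<omega> (ix k) else - Y \<omega> (ix k)) / sd (ix k)" if "k \<in> {1..2*d}" for \<omega> k
    using that by (simp add: Z_def c_def ix_def)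
  let ?t = "\<lambda>i. t / sd (ix i)"
  have "{\<omega>\<in>space N. t < linf_norm d (Y \<omega>) \<and> linf_norm d (Y \<omega>) \<le> t + e} \<subseteq>
    {\<omega>\<in>space N. (\<exists>k\<in>{1..2*d}. ?t k < Z \<omega> k) \<and> (\<forall>k\<in>{1..2*d}. Z \<omega> k \<le> ?t k + e / sqrt b)}"
  proof (intro subsetI CollectI conjI ballI)
    fix \<omega> assume w: "\<omega> \<in> {\<omega>\<in>space N. t < linf_norm d (Y \<omega>) \<and> linf_norm d (Y \<omega>) \<le> t + e}"
    show "\<omega> \<in> space N" using w by simp
    have "\<not> linf_norm d (Y \<omega>) \<le> t" using w by simp
    then obtain j where j: "j \<in> {1..d}" "t < \<bar>Y \<omega> j\<bar>" unfolding linf_norm_le_iff[OF d] by auto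
    define i where "i = (if Y \<omega> j \<ge> 0 then j else j + d)"
    have i: "i \<in> {1..2*d}" "ix i = j" using j by (auto simp: i_def ix_def)
    have "Z \<omega> i = \<bar>Y \<omega> j\<bar> / sd j" using j i by (auto simp: Zs i_def)
    then show "\<exists>k\<in>{1..2*d}. ?t k < Z \<omega> k"
      using i j sd[OF j(1)] by (intro bexI[of _ i]) (auto simp: divide_strict_right_mono)
    fix k assume k: "k \<in> {1..2*d}"
    note s = sd[OF ix[OF k]]
    have "\<bar>Y \<omega> (ix k)\<bar> \<le> t + e" using w ix[OF k] unfolding linf_norm_le_iff[OF d] by auto
    then have "\<bar>Y \<omega> (ix k)\<bar> / sd (ix k) \<le> (t + e) / sd (ix k)" using s by (intro divide_right_mono) auto
    moreover have "e / sd (ix k) \<le> e / sqrt b" using s b e by (intro divide_left_mono) auto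
    moreover have "Z \<omega> k \<le> \<bar>Y \<omega> (ix k)\<bar> / sd (ix k)"
      unfolding Zs[OF k] using s by (intro divide_right_mono) auto
    ultimately show "Z \<omega> k \<le> ?t k + e / sqrt b" by (simp add: add_divide_distrib)
  qed
  then have "prob {\<omega>\<in>space N. t < linf_norm d (Y \<omega>) \<and> linf_norm d (Y \<omega>) \<le> t + e} \<le>
    prob {\<omega>\<in>space N. (\<exists>k\<in>{1..2*d}. ?t k < Z \<omega> k) \<and> (\<forall>k\<in>{1..2*d}. Z \<omega> k \<le> ?t k + e / sqrt b)}"
  proof (rule finite_measure_mono)
    have "{\<omega>\<in>space N. ?t k < Z \<omega> k} \<in> sets N" "{\<omega>\<in>space N. Z \<omega> k \<le> ?t k + e / sqrt b} \<in> sets N"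
      if "k \<in> {1..2*d}" for k
      using G.comp_measurable[OF that] by measurable
    then show "{\<omega>\<in>space N. (\<exists>k\<in>{1..2*d}. ?t k < Z \<omega> k) \<and> (\<forall>k\<in>{1..2*d}. Z \<omega> k \<le> ?t k + e / sqrt b)} \<in> sets N"
      by (intro sets.sets_Collect_conj sets.sets_Collect_finite_All sets.sets_Collect_finite_Ex) auto
  qed
  also have "\<dots> \<le> exp 4 * (e / sqrt b) * (sqrt (2 * ln (real (2 * d))) + 3)"
    by (rule G.anti_concentration) (use d covZ e b in auto)
  finally show ?thesis unfolding of_nat_mult of_nat_numeral .
qed

section \<open>Stein's identity\<close>

lemma normal_density_has_derivative:
  assumes "\<sigma> > 0"
  shows "(normal_density 0 \<sigma> has_real_derivative (- z / \<sigma>\<^sup>2 * normal_density 0 \<sigma> z)) (at z)"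
proof -
  have "((\<lambda>z. - (z\<^sup>2 / (2 * \<sigma>\<^sup>2))) has_real_derivative - (z / \<sigma>\<^sup>2)) (at z)"
    using DERIV_minus[OF DERIV_cdivide[OF DERIV_power[OF DERIV_ident, of 2], of "2 * \<sigma>\<^sup>2"]]
    by (simp add: One_nat_def)
  from DERIV_cmult[OF DERIV_fun_exp[OF this], of "1 / sqrt (2 * pi * \<sigma>\<^sup>2)"]
  show ?thesis unfolding normal_density_def[abs_def] by (simp add: mult_ac)
qed

lemma normal_density_tendsto_0:
  assumes s: "\<sigma> > 0"
  shows "(normal_density 0 \<sigma> \<longlongrightarrow> 0) at_top" "(normal_density 0 \<sigma> \<longlongrightarrow> 0) at_bot"
proof -
  have c: "((\<lambda>x::real. 1 / (2 * \<sigma>\<^sup>2)) \<longlongrightarrow> 1 / (2 * \<sigma>\<^sup>2)) F" "1 / (2 * \<sigma>\<^sup>2) > 0" for F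
    using s by auto
  have 1: "filterlim (\<lambda>x::real. x\<^sup>2 / (2 * \<sigma>\<^sup>2)) at_top at_top"
    using filterlim_tendsto_pos_mult_at_top[OF c filterlim_pow_at_top[OF _ filterlim_ident, of 2]] by simp
  have 2: "filterlim (\<lambda>x::real. x\<^sup>2 / (2 * \<sigma>\<^sup>2)) at_top at_bot"
    using filterlim_tendsto_pos_mult_at_top[OF c filterlim_pow_at_bot_even[OF _ filterlim_ident, of 2]] by simp
  have "((\<lambda>x. 1 / sqrt (2 * pi * \<sigma>\<^sup>2) * exp (- (x\<^sup>2 / (2 * \<sigma>\<^sup>2)))) \<longlongrightarrow> 1 / sqrt (2 * pi * \<sigma>\<^sup>2) * 0) at_top"
    by (intro tendsto_intros filterlim_compose[OF exp_at_bot] filterlim_compose[OF filterlim_uminus_at_bot_at_top] 1)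
  then show "(normal_density 0 \<sigma> \<longlongrightarrow> 0) at_top" by (simp add: normal_density_def[abs_def])
  have "((\<lambda>x. 1 / sqrt (2 * pi * \<sigma>\<^sup>2) * exp (- (x\<^sup>2 / (2 * \<sigma>\<^sup>2)))) \<longlongrightarrow> 1 / sqrt (2 * pi * \<sigma>\<^sup>2) * 0) at_bot"
    by (intro tendsto_intros filterlim_compose[OF exp_at_bot] filterlim_compose[OF filterlim_uminus_at_bot_at_top] 2)
  then show "(normal_density 0 \<sigma> \<longlongrightarrow> 0) at_bot" by (simp add: normal_density_def[abs_def])
qed

text \<open>Integration by parts: the difference of the two integrands, weighted by the density
  \<open>?n\<close>, is the derivative of \<open>- \<sigma>\<^sup>2 * (h z * ?n z)\<close>, which
  tends to 0 at both infinities because \<open>h\<close> is bounded.\<close>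

lemma stein_univariate:
  fixes h h' :: "real \<Rightarrow> real"
  assumes s: "\<sigma> > 0" and der: "\<And>z. (h has_real_derivative h' z) (at z)"
    and cont: "continuous_on UNIV h'" and bd: "\<And>z. \<bar>h z\<bar> \<le> K" "\<And>z. \<bar>h' z\<bar> \<le> K'"
  shows "(LINT z|density lborel (normal_density 0 \<sigma>). z * h z) =
    \<sigma>\<^sup>2 * (LINT z|density lborel (normal_density 0 \<sigma>). h' z)"
proof -
  have ch: "continuous_on UNIV h" using der by (intro DERIV_continuous_on) (rule has_field_derivative_at_within)
  have [measurable]: "h \<in> borel_measurable borel" "h' \<in> borel_measurable borel"
    using ch cont by (auto intro: borel_measurable_continuous_onI)
  let ?n = "normal_density 0 \<sigma>"
  have cn: "isCont ?n z" for z
    using normal_density_has_derivative[OF s] DERIV_isCont by blast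
  have i1: "integrable lborel (\<lambda>z. ?n z * (z * h z))"
  proof (rule Bochner_Integration.integrable_bound)
    show "integrable lborel (\<lambda>z. K * (?n z * \<bar>z - 0\<bar> ^ 1))"
      by (intro integrable_mult_right integrable_normal_moment_abs s)
    have "\<bar>z\<bar> * \<bar>h z\<bar> * ?n z \<le> \<bar>z\<bar> * \<bar>K\<bar> * ?n z" for z
      using bd(1)[of z] by (intro mult_right_mono mult_left_mono) auto
    then show "AE z in lborel. norm (?n z * (z * h z)) \<le> norm (K * (?n z * \<bar>z - 0\<bar> ^ 1))"
      by (intro AE_I2) (simp add: abs_mult mult.commute mult.left_commute)
  qed simp
  have i2: "integrable lborel (\<lambda>z. ?n z * h' z)"
  proof (rule Bochner_Integration.integrable_bound)
    show "integrable lborel (\<lambda>z. K' * ?n z)" using s by simp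
    have "?n z * \<bar>h' z\<bar> \<le> ?n z * \<bar>K'\<bar>" for z
      using bd(2)[of z] by (intro mult_left_mono) auto
    then show "AE z in lborel. norm (?n z * h' z) \<le> norm (K' * ?n z)"
      by (intro AE_I2) (simp add: abs_mult mult.commute)
  qed simp
  have lim: "((\<lambda>z. - \<sigma>\<^sup>2 * (h z * ?n z)) \<longlongrightarrow> 0) F" if "(?n \<longlongrightarrow> 0) F" for F
  proof (rule Lim_null_comparison)
    show "\<forall>\<^sub>F z in F. norm (- \<sigma>\<^sup>2 * (h z * ?n z)) \<le> \<sigma>\<^sup>2 * (K * ?n z)"
    proof (rule always_eventually, rule allI)
      fix z show "norm (- \<sigma>\<^sup>2 * (h z * ?n z)) \<le> \<sigma>\<^sup>2 * (K * ?n z)"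
        using mult_left_mono[OF mult_right_mono[OF bd(1)[of z]], of "?n z" "\<sigma>\<^sup>2"] by (simp add: abs_mult)
    qed
    have "((\<lambda>z. \<sigma>\<^sup>2 * (K * ?n z)) \<longlongrightarrow> \<sigma>\<^sup>2 * (K * 0)) F" by (intro tendsto_intros that)
    then show "((\<lambda>z. \<sigma>\<^sup>2 * (K * ?n z)) \<longlongrightarrow> 0) F" by simp
  qed
  let ?f = "\<lambda>z. ?n z * (z * h z) - \<sigma>\<^sup>2 * (?n z * h' z)"
  have "(LBINT z=-\<infinity>..\<infinity>. ?f z) = 0 - 0"
  proof (rule interval_integral_FTC_integrable[where F="\<lambda>z. - \<sigma>\<^sup>2 * (h z * ?n z)"])
    show "((\<lambda>z. - \<sigma>\<^sup>2 * (h z * ?n z)) has_vector_derivative ?f z) (at z)" for z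
      unfolding has_real_derivative_iff_has_vector_derivative[symmetric]
      by (rule DERIV_cong[OF DERIV_cmult[OF DERIV_mult[OF der normal_density_has_derivative[OF s]]]])
        (use s in \<open>simp add: field_simps\<close>)
    show "isCont ?f z" for z
      using ch cont cn by (intro continuous_intros) (auto simp: continuous_on_eq_continuous_at)
    show "set_integrable lborel (einterval (-\<infinity>) \<infinity>) ?f"
      unfolding set_integrable_def using i1 i2 by simp
    show "(((\<lambda>z. - \<sigma>\<^sup>2 * (h z * ?n z)) \<circ> real_of_ereal) \<longlongrightarrow> 0) (at_right (-\<infinity>))"
      unfolding ereal_tendsto_simps by (rule lim[OF normal_density_tendsto_0(2)[OF s]])
    show "(((\<lambda>z. - \<sigma>\<^sup>2 * (h z * ?n z)) \<circ> real_of_ereal) \<longlongrightarrow> 0) (at_left \<infinity>)"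
      unfolding ereal_tendsto_simps by (rule lim[OF normal_density_tendsto_0(1)[OF s]])
  qed simp
  then have "(LINT z|lborel. ?f z) = 0"
    by (simp add: interval_lebesgue_integral_def set_lebesgue_integral_def)
  then show ?thesis using i1 i2 by (simp add: integral_density)
qed

text \<open>
  Functions on \<open>{1..d} \<rightarrow> \<real>\<close> are represented by functions of \<open>nat \<Rightarrow> real\<close> insensitive to the other
  coordinates; this is what the congruence hypotheses express.
\<close>

lemma (in gaussian_centered) stein_identity:
  fixes g :: "(nat \<Rightarrow> real) \<Rightarrow> real" and dg :: "(nat \<Rightarrow> real) \<Rightarrow> nat \<Rightarrow> real"
  assumes j: "j \<in> {1..d}" and v: "cov j j > 0"
    and g[measurable]: "g \<in> borel_measurable (borel_vec d)"
    and dg: "\<And>k. k \<in> {1..d} \<Longrightarrow> (\<lambda>x. dg x k) \<in> borel_measurable (borel_vec d)"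
    and bd: "\<And>x. \<bar>g x\<bar> \<le> K" "\<And>x k. k \<in> {1..d} \<Longrightarrow> \<bar>dg x k\<bar> \<le> K"
    and cong: "\<And>x y. (\<And>k. k \<in> {1..d} \<Longrightarrow> x k = y k) \<Longrightarrow> g x = g y"
      "\<And>x y k. (\<And>k. k \<in> {1..d} \<Longrightarrow> x k = y k) \<Longrightarrow> k \<in> {1..d} \<Longrightarrow> dg x k = dg y k"
    and der: "\<And>x r s. ((\<lambda>s. g (\<lambda>k. x k + s * r k)) has_real_derivative
        (\<Sum>k=1..d. dg (\<lambda>k. x k + s * r k) k * r k)) (at s)"
    and cont: "\<And>x r k. k \<in> {1..d} \<Longrightarrow> continuous_on UNIV (\<lambda>s. dg (\<lambda>k. x k + s * r k) k)"
  shows "expectation (\<lambda>\<omega>. Y \<omega> j * g (Y \<omega>)) = (\<Sum>k=1..d. cov j k * expectation (\<lambda>\<omega>. dg (Y \<omega>) k))"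
proof -
  note [measurable] = comp_measurable[OF j] resid_measurable[OF j]
  let ?s = "sqrt (cov j j)"
  have s: "?s > 0" "?s\<^sup>2 = cov j j" using v by auto
  \<comment> \<open>The direction in which \<open>Y\<close> moves with \<open>Y \<omega> j\<close>
    for a fixed residual. At the end \<open>cov j j * r k = cov j k\<close> turns the directional
    derivative into the covariance-weighted sum.\<close>
  define r where "r = (\<lambda>k. cov j k / cov j j)"
  let ?V = "distr N (borel_vec d) (resid j)"
  let ?U = "distr N borel (\<lambda>\<omega>. Y \<omega> j)"
  have U: "?U = density lborel (normal_density 0 ?s)"
    using distributed_distr_eq_density[OF distributed_coord[OF j v]] by (metis distr_cong sets_lborel)
  interpret V: prob_space ?V by (rule prob_space_distr) simp
  interpret U: prob_space ?U by (rule prob_space_distr) simp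
  interpret VU: pair_prob_space ?V ?U ..
  have K: "K \<ge> 0" using bd(1)[of undefined] abs_ge_zero order_trans by blast
  \<comment> \<open>Rebuilds \<open>Y\<close> from the residual and the value of coordinate
    \<open>j\<close>. Under the product law of \<open>resid_indep\<close> the univariate identity
    applies in \<open>z\<close> for each fixed residual.\<close>
  define L where "L = (\<lambda>(x, z). \<lambda>k\<in>{1..d}. x k + z * r k :: real)"
  have L[measurable]: "L \<in> measurable (borel_vec d \<Otimes>\<^sub>M borel) (borel_vec d)"
    unfolding L_def case_prod_beta by (rule measurable_restrict) measurable
  have Leq: "L (resid j \<omega>, Y \<omega> j) k = Y \<omega> k" if "k \<in> {1..d}" for \<omega> k
    using that v by (simp add: L_def resid_def r_def)
  have gL: "g (L (x, z)) = g (\<lambda>k. x k + z * r k)" for x z by (rule cong) (simp add: L_def)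
  have dgL: "dg (L (x, z)) k = dg (\<lambda>k. x k + z * r k) k" if "k \<in> {1..d}" for x z k
    by (rule cong(2)[OF _ that]) (simp add: L_def)
  have gY: "g (L (resid j \<omega>, Y \<omega> j)) = g (Y \<omega>)" for \<omega> by (rule cong) (simp add: Leq)
  have dgY: "dg (L (resid j \<omega>, Y \<omega> j)) k = dg (Y \<omega>) k" if "k \<in> {1..d}" for \<omega> k
    by (rule cong(2)[OF _ that]) (simp add: Leq)
  have iU: "integrable ?U (\<lambda>z. z)"
    by (subst integrable_distr_eq) (use integrable_coord[OF j] in auto)
  have int1: "integrable (?V \<Otimes>\<^sub>M ?U) (\<lambda>y. snd y * g (L y))"
  proof (rule Bochner_Integration.integrable_bound)
    show "integrable (?V \<Otimes>\<^sub>M ?U) (\<lambda>y. K * snd y)"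
      unfolding resid_indep[OF j v]
      by (subst integrable_distr_eq) (use integrable_coord[OF j] in auto)
    show "AE y in ?V \<Otimes>\<^sub>M ?U. norm (snd y * g (L y)) \<le> norm (K * snd y)"
    proof (rule AE_I2)
      fix y
      have "\<bar>snd y\<bar> * \<bar>g (L y)\<bar> \<le> \<bar>snd y\<bar> * K" using bd(1) by (rule mult_left_mono) simp
      then show "norm (snd y * g (L y)) \<le> norm (K * snd y)" using K by (simp add: abs_mult mult.commute)
    qed
  qed measurable
  have m2: "(\<lambda>y. \<Sum>k=1..d. dg (L y) k * r k) \<in> borel_measurable (borel_vec d \<Otimes>\<^sub>M borel)"
    by (intro borel_measurable_sum borel_measurable_times borel_measurable_const)
      (rule measurable_compose[OF L dg])
  have bd2: "\<bar>\<Sum>k=1..d. dg x k * r k\<bar> \<le> (\<Sum>k=1..d. K * \<bar>r k\<bar>)" for x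
    using bd(2) by (intro order_trans[OF sum_abs] sum_mono) (simp add: abs_mult mult_right_mono)
  have int2: "integrable (?V \<Otimes>\<^sub>M ?U) (\<lambda>y. \<Sum>k=1..d. dg (L y) k * r k)"
    by (rule VU.integrable_const_bound[where B="\<Sum>k=1..d. K * \<bar>r k\<bar>"]) (use m2 bd2 in auto)
  have "expectation (\<lambda>\<omega>. Y \<omega> j * g (Y \<omega>)) = (LINT y|(?V \<Otimes>\<^sub>M ?U). snd y * g (L y))"
    unfolding resid_indep[OF j v] by (subst integral_distr) (auto simp: gY)
  also have "\<dots> = (LINT x|?V. LINT z|?U. z * g (L (x, z)))"
    using VU.integral_fst'[OF int1] by simp
  also have "\<dots> = (LINT x|?V. cov j j * (LINT z|?U. (\<Sum>k=1..d. dg (L (x, z)) k * r k)))"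
  proof (rule Bochner_Integration.integral_cong[OF refl])
    fix x
    have "(LINT z|?U. z * g (L (x, z))) = ?s\<^sup>2 * (LINT z|?U. (\<Sum>k=1..d. dg (\<lambda>k. x k + z * r k) k * r k))"
      unfolding U gL
      by (rule stein_univariate[OF s(1) der]) (use cont bd(1) bd2 in \<open>auto intro!: continuous_intros\<close>)
    then show "(LINT z|?U. z * g (L (x, z))) = cov j j * (LINT z|?U. (\<Sum>k=1..d. dg (L (x, z)) k * r k))"
      using s(2) by (simp add: dgL)
  qed
  also have "\<dots> = cov j j * (LINT x|?V. LINT z|?U. (\<Sum>k=1..d. dg (L (x, z)) k * r k))"
    by simp
  also have "\<dots> = cov j j * (LINT y|(?V \<Otimes>\<^sub>M ?U). (\<Sum>k=1..d. dg (L y) k * r k))"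
    using VU.integral_fst'[OF int2] by simp
  also have "\<dots> = cov j j * expectation (\<lambda>\<omega>. \<Sum>k=1..d. dg (Y \<omega>) k * r k)"
    unfolding resid_indep[OF j v] by (subst integral_distr) (use m2 in \<open>auto simp: dgY\<close>)
  also have "expectation (\<lambda>\<omega>. \<Sum>k=1..d. dg (Y \<omega>) k * r k) = (\<Sum>k=1..d. expectation (\<lambda>\<omega>. dg (Y \<omega>) k) * r k)"
  proof (subst Bochner_Integration.integral_sum)
    fix k assume k: "k \<in> {1..d}"
    have "(\<lambda>\<omega>. dg (Y \<omega>) k) \<in> borel_measurable N" by (rule measurable_compose[OF Y_measurable dg[OF k]])
    then show "integrable N (\<lambda>\<omega>. dg (Y \<omega>) k * r k)"
      by (intro integrable_mult_left integrable_const_bound[where B=K]) (use bd(2) k in auto)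
  qed simp
  also have "cov j j * (\<Sum>k=1..d. expectation (\<lambda>\<omega>. dg (Y \<omega>) k) * r k) = (\<Sum>k=1..d. cov j k * expectation (\<lambda>\<omega>. dg (Y \<omega>) k))"
    unfolding sum_distrib_left r_def using v by (intro sum.cong) (auto simp: field_simps)
  finally show ?thesis .
qed

section \<open>The smoothed maximum\<close>

text \<open>\<open>\<beta>\<close> is the inverse temperature of the soft maximum,
  \<open>\<alpha>\<close> the steepness of the logistic step and \<open>\<tau>\<close> its position
  on the scale of \<open>ln Phi\<close>. With \<open>\<alpha> \<le> 1\<close>, the powers of
  \<open>\<alpha>\<close> in higher derivatives are at most \<open>\<alpha>\<close>.\<close>

locale softmax =
  fixes p :: nat and \<beta> \<alpha> \<tau> :: real
  assumes p: "p \<ge> 1" and \<beta>: "\<beta> > 0" and \<alpha>: "\<alpha> > 0" "\<alpha> \<le> 1"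
begin

text \<open>Both signs are summed, so \<open>ln (Phi x)\<close> lies between
  \<open>\<beta> * linf_norm p x\<close> and \<open>ln (2 * p) + \<beta> * linf_norm p x\<close>:
  absolute values are handled without doubling the coordinates.\<close>

definition Phi :: "(nat \<Rightarrow> real) \<Rightarrow> real" where
  "Phi x = (\<Sum>j=1..p. exp (\<beta> * x j) + exp (- (\<beta> * x j)))"

definition pr :: "(nat \<Rightarrow> real) \<Rightarrow> nat \<Rightarrow> real" where
  "pr x j = (exp (\<beta> * x j) + exp (- (\<beta> * x j))) / Phi x"

text \<open>\<open>\<beta> * rh x j\<close> is the partial derivative of \<open>ln Phi\<close>.
  These signed weights are dominated by the probability weights \<open>pr\<close>, and
  differentiating either family brings in the other.\<close>

definition rh :: "(nat \<Rightarrow> real) \<Rightarrow> nat \<Rightarrow> real" where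
  "rh x j = (exp (\<beta> * x j) - exp (- (\<beta> * x j))) / Phi x"

definition f :: "(nat \<Rightarrow> real) \<Rightarrow> real" where
  "f x = 1 / (1 + exp (\<alpha> * (ln (Phi x) - \<tau>)))"

text \<open>\<open>l1\<close>, \<open>l2\<close>, \<open>l3\<close> are the derivatives of \<open>f\<close> as a function of \<open>ln Phi\<close>.\<close>

definition "l1 x = - \<alpha> * (f x * (1 - f x))"
definition "l2 x = \<alpha>\<^sup>2 * (f x * (1 - f x) * (1 - 2 * f x))"
definition "l3 x = - (\<alpha> ^ 3 * (f x * (1 - f x) * (1 - 6 * f x + 6 * (f x)\<^sup>2)))"

definition grad :: "(nat \<Rightarrow> real) \<Rightarrow> nat \<Rightarrow> real" where
  "grad x j = l1 x * \<beta> * rh x j"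

definition hess :: "(nat \<Rightarrow> real) \<Rightarrow> nat \<Rightarrow> nat \<Rightarrow> real" where
  "hess x j k = \<beta>\<^sup>2 * ((l2 x - l1 x) * rh x j * rh x k + (if j = k then l1 x * pr x j else 0))"

definition avg :: "(nat \<Rightarrow> real) \<Rightarrow> (nat \<Rightarrow> real) \<Rightarrow> real" where
  "avg x v = (\<Sum>j=1..p. pr x j * \<bar>v j\<bar>)"

text \<open>\<open>6 \<alpha> \<beta>\<^sup>3 U x j k v\<close> dominates the derivative of \<open>hess x j k\<close> in the direction \<open>v\<close>.\<close>

definition U :: "(nat \<Rightarrow> real) \<Rightarrow> nat \<Rightarrow> nat \<Rightarrow> (nat \<Rightarrow> real) \<Rightarrow> real" where
  "U x j k v = pr x j * pr x k * (avg x v + \<bar>v j\<bar> + \<bar>v k\<bar>) + (if j = k then pr x j * (avg x v + \<bar>v j\<bar>) else 0)"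

lemma Phi_pos: "Phi x > 0"
  unfolding Phi_def using p by (intro sum_pos) (auto intro: add_pos_pos)

lemma Phi_ge: "j \<in> {1..p} \<Longrightarrow> exp (\<beta> * x j) + exp (- (\<beta> * x j)) \<le> Phi x"
  unfolding Phi_def by (rule member_le_sum) (auto intro: add_nonneg_nonneg)

lemma pr_nonneg: "pr x j \<ge> 0"
  unfolding pr_def using Phi_pos[of x] by (intro divide_nonneg_nonneg add_nonneg_nonneg) auto

lemma pr_sum: "(\<Sum>j=1..p. pr x j) = 1"
  unfolding pr_def sum_divide_distrib[symmetric] Phi_def[symmetric] using Phi_pos[of x] by simp

lemma pr_le_1: "j \<in> {1..p} \<Longrightarrow> pr x j \<le> 1"
  using Phi_ge[of j x] Phi_pos[of x] by (simp add: pr_def)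

lemma rh_le_pr: "\<bar>rh x j\<bar> \<le> pr x j"
  unfolding rh_def pr_def abs_divide using Phi_pos[of x]
  by (intro divide_mono) (auto simp: abs_le_iff)

lemma f_bounds: "0 < f x" "f x < 1"
  unfolding f_def by (auto simp: divide_less_eq add_pos_pos)

lemma avg_nonneg: "avg x v \<ge> 0"
  unfolding avg_def by (intro sum_nonneg mult_nonneg_nonneg pr_nonneg) auto

lemma U_nonneg: "U x j k v \<ge> 0"
  unfolding U_def using pr_nonneg avg_nonneg by (auto intro!: add_nonneg_nonneg mult_nonneg_nonneg)

lemma abs_rh_sum_le: "\<bar>\<Sum>j=1..p. rh x j * v j\<bar> \<le> avg x v"
  unfolding avg_def
  by (intro order_trans[OF sum_abs] sum_mono) (simp add: abs_mult mult_right_mono rh_le_pr)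

text \<open>With \<open>u = f x\<close> in the unit interval, each derivative is a power of
  \<open>\<alpha>\<close> times a polynomial in \<open>u\<close> bounded by 1; for the third,
  \<open>1 - 6 * u + 6 * u\<^sup>2 = 1 - 6 * (u * (1 - u))\<close> and
  \<open>u * (1 - u) \<le> 1 / 4\<close>.\<close>

lemma l_bounds: "\<bar>l1 x\<bar> \<le> \<alpha>" "\<bar>l2 x\<bar> \<le> \<alpha>" "\<bar>l3 x\<bar> \<le> \<alpha>"
proof -
  define u where "u = f x"
  have u: "0 \<le> u" "u \<le> 1" using f_bounds[of x] by (simp_all add: u_def)
  have w: "0 \<le> u * (1 - u)" "u * (1 - u) \<le> 1" using u by (auto intro: mult_nonneg_nonneg mult_le_one)
  have a2: "\<alpha>\<^sup>2 \<le> \<alpha>" "\<alpha> ^ 3 \<le> \<alpha>" "0 \<le> \<alpha>\<^sup>2" "0 \<le> \<alpha> ^ 3"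
    using \<alpha> power_decreasing[of 1 2 \<alpha>] power_decreasing[of 1 3 \<alpha>] by auto
  have c1: "\<bar>1 - 2 * u\<bar> \<le> 1" using u by (simp add: abs_le_iff)
  have "1 - 6 * u + 6 * u\<^sup>2 = 1 - 6 * (u * (1 - u))" by (simp add: power2_eq_square algebra_simps)
  moreover have "u * (1 - u) \<le> 1 / 4"
    using zero_le_power2[of "u - 1/2"] by (simp add: power2_eq_square algebra_simps)
  ultimately have c2: "\<bar>1 - 6 * u + 6 * u\<^sup>2\<bar> \<le> 1" using w(1) by (simp add: abs_le_iff)
  show "\<bar>l1 x\<bar> \<le> \<alpha>"
    unfolding l1_def u_def[symmetric] using w \<alpha> mult_left_mono[OF w(2), of \<alpha>] by (simp add: abs_mult)
  have "\<bar>u * (1 - u)\<bar> * \<bar>1 - 2 * u\<bar> \<le> 1" using w c1 by (intro mult_le_one) auto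
  then have "\<alpha>\<^sup>2 * (\<bar>u * (1 - u)\<bar> * \<bar>1 - 2 * u\<bar>) \<le> \<alpha> * 1"
    using a2 \<alpha> by (intro mult_mono) auto
  then show "\<bar>l2 x\<bar> \<le> \<alpha>" unfolding l2_def u_def[symmetric] using a2 by (simp add: abs_mult)
  have "\<bar>u * (1 - u)\<bar> * \<bar>1 - 6 * u + 6 * u\<^sup>2\<bar> \<le> 1" using w c2 by (intro mult_le_one) auto
  then have "\<alpha> ^ 3 * (\<bar>u * (1 - u)\<bar> * \<bar>1 - 6 * u + 6 * u\<^sup>2\<bar>) \<le> \<alpha> * 1"
    using a2 \<alpha> by (intro mult_mono) auto
  then show "\<bar>l3 x\<bar> \<le> \<alpha>" unfolding l3_def u_def[symmetric] using a2 by (simp add: abs_mult power_abs)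
qed

lemma abs_grad_le: "\<bar>grad x j\<bar> \<le> \<alpha> * \<beta> * pr x j"
proof -
  have "\<bar>l1 x\<bar> * \<bar>rh x j\<bar> \<le> \<alpha> * pr x j"
    using l_bounds(1) rh_le_pr \<alpha> by (intro mult_mono) auto
  from mult_right_mono[OF this, of \<beta>] show ?thesis using \<beta> by (simp add: grad_def abs_mult mult_ac)
qed

lemma abs_hess_le: "\<bar>hess x j k\<bar> \<le> \<alpha> * \<beta>\<^sup>2 * (2 * (pr x j * pr x k) + (if j = k then pr x j else 0))"
proof -
  have "\<bar>l2 x - l1 x\<bar> \<le> 2 * \<alpha>" using l_bounds[of x] by linarith
  moreover have "\<bar>rh x j\<bar> * \<bar>rh x k\<bar> \<le> pr x j * pr x k"
    using rh_le_pr pr_nonneg by (intro mult_mono) auto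
  ultimately have 1: "\<bar>l2 x - l1 x\<bar> * (\<bar>rh x j\<bar> * \<bar>rh x k\<bar>) \<le> (2 * \<alpha>) * (pr x j * pr x k)"
    using \<alpha> pr_nonneg by (intro mult_mono) (auto simp: rh_le_pr pr_nonneg)
  have 2: "\<bar>l1 x * pr x j\<bar> \<le> \<alpha> * pr x j"
    using l_bounds(1)[of x] pr_nonneg[of x j] by (simp add: abs_mult mult_right_mono)
  have "\<bar>(l2 x - l1 x) * rh x j * rh x k + (if j = k then l1 x * pr x j else 0)\<bar> \<le>
      \<bar>(l2 x - l1 x) * rh x j * rh x k\<bar> + \<bar>if j = k then l1 x * pr x j else 0\<bar>" by (rule abs_triangle_ineq)
  also have "\<dots> \<le> (2 * \<alpha>) * (pr x j * pr x k) + (if j = k then \<alpha> * pr x j else 0)"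
    using 1 2 by (intro add_mono) (auto simp: abs_mult mult.assoc)
  also have "\<dots> = \<alpha> * (2 * (pr x j * pr x k) + (if j = k then pr x j else 0))" by (simp add: algebra_simps)
  finally show ?thesis unfolding hess_def abs_mult
    by (simp add: mult_left_mono mult.left_commute[of \<alpha>] mult.assoc)
qed

lemma sum_delta: "j \<in> {1..p} \<Longrightarrow> (\<Sum>k=1..p. if j = k then g k else 0) = g j" for g :: "nat \<Rightarrow> real"
  by (simp add: sum.delta')

text \<open>The weights in \<open>abs_hess_le\<close> add up to 2 + 1 whatever the dimension:
  \<open>pr\<close> has total mass 1 both over pairs, counted twice, and over the diagonal.\<close>

lemma sum_hess_le:
  assumes a: "\<And>j k. j \<in> {1..p} \<Longrightarrow> k \<in> {1..p} \<Longrightarrow> \<bar>a j k\<bar> \<le> A"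
  shows "\<bar>\<Sum>j=1..p. \<Sum>k=1..p. a j k * hess x j k\<bar> \<le> 3 * \<alpha> * \<beta>\<^sup>2 * A"
proof -
  have "\<bar>\<Sum>j=1..p. \<Sum>k=1..p. a j k * hess x j k\<bar> \<le> (\<Sum>j=1..p. \<Sum>k=1..p. \<bar>a j k * hess x j k\<bar>)"
    by (rule order_trans[OF sum_abs], rule sum_mono, rule sum_abs)
  also have "\<dots> \<le> (\<Sum>j=1..p. \<Sum>k=1..p. A * (\<alpha> * \<beta>\<^sup>2 * (2 * (pr x j * pr x k) + (if j = k then pr x j else 0))))"
    unfolding abs_mult using a abs_hess_le
    by (intro sum_mono mult_mono) (auto intro: order_trans[OF abs_ge_zero])
  also have "\<dots> = A * (\<alpha> * \<beta>\<^sup>2) * (\<Sum>j=1..p. \<Sum>k=1..p. 2 * (pr x j * pr x k) + (if j = k then pr x j else 0))"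
    by (simp add: sum_distrib_left mult.assoc)
  also have "(\<Sum>j=1..p. \<Sum>k=1..p. 2 * (pr x j * pr x k) + (if j = k then pr x j else 0)) = 3"
  proof -
    have "(\<Sum>k=1..p. 2 * (pr x j * pr x k) + (if j = k then pr x j else 0)) = 3 * pr x j" if "j \<in> {1..p}" for j
      using that by (simp add: sum.distrib sum_distrib_left[symmetric] pr_sum)
    then have "(\<Sum>j=1..p. \<Sum>k=1..p. 2 * (pr x j * pr x k) + (if j = k then pr x j else 0)) = (\<Sum>j=1..p. 3 * pr x j)"
      by (intro sum.cong) auto
    then show ?thesis by (simp add: sum_distrib_left[symmetric] pr_sum)
  qed
  finally show ?thesis by (simp add: mult_ac)
qed

text \<open>Derivatives are taken along an arbitrary curve with velocity \<open>v\<close> at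
  \<open>s\<close>: straight segments occur in the Taylor expansion and in Stein's identity, the
  trigonometric path in the interpolation.\<close>

context
  fixes x :: "real \<Rightarrow> nat \<Rightarrow> real" and v :: "nat \<Rightarrow> real" and s :: real
  assumes der: "\<And>j. j \<in> {1..p} \<Longrightarrow> ((\<lambda>s. x s j) has_real_derivative v j) (at s)"
begin

definition "rv = (\<Sum>j=1..p. rh (x s) j * v j)"

lemma der_exp:
  assumes "j \<in> {1..p}"
  shows "((\<lambda>s. exp (\<beta> * x s j)) has_real_derivative exp (\<beta> * x s j) * (\<beta> * v j)) (at s)"
    "((\<lambda>s. exp (- (\<beta> * x s j))) has_real_derivative exp (- (\<beta> * x s j)) * - (\<beta> * v j)) (at s)"
  by (intro DERIV_fun_exp DERIV_minus DERIV_cmult der assms)+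

lemma der_Phi: "((\<lambda>s. Phi (x s)) has_real_derivative \<beta> * Phi (x s) * rv) (at s)"
proof -
  have "((\<lambda>s. Phi (x s)) has_real_derivative
      (\<Sum>j=1..p. exp (\<beta> * x s j) * (\<beta> * v j) + exp (- (\<beta> * x s j)) * - (\<beta> * v j))) (at s)"
    unfolding Phi_def by (intro DERIV_sum DERIV_add der_exp)
  also have "(\<Sum>j=1..p. exp (\<beta> * x s j) * (\<beta> * v j) + exp (- (\<beta> * x s j)) * - (\<beta> * v j)) = \<beta> * Phi (x s) * rv"
    unfolding rv_def rh_def sum_distrib_left using Phi_pos[of "x s"]
    by (intro sum.cong) (auto simp: field_simps)
  finally show ?thesis .
qed

lemma der_rh: "j \<in> {1..p} \<Longrightarrow> ((\<lambda>s. rh (x s) j) has_real_derivative \<beta> * (pr (x s) j * v j - rh (x s) j * rv)) (at s)"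
  unfolding rh_def
  by (rule DERIV_cong[OF DERIV_divide[OF DERIV_diff[OF der_exp] der_Phi]])
    (use Phi_pos[of "x s"] in \<open>auto simp: pr_def field_simps\<close>)

lemma der_pr: "j \<in> {1..p} \<Longrightarrow> ((\<lambda>s. pr (x s) j) has_real_derivative \<beta> * (rh (x s) j * v j - pr (x s) j * rv)) (at s)"
  unfolding pr_def
  by (rule DERIV_cong[OF DERIV_divide[OF DERIV_add[OF der_exp] der_Phi]])
    (use Phi_pos[of "x s"] in \<open>auto simp: rh_def field_simps\<close>)

lemma der_f': "((\<lambda>s. f (x s)) has_real_derivative l1 (x s) * (\<beta> * rv)) (at s)"
proof -
  let ?e = "exp (\<alpha> * (ln (Phi (x s)) - \<tau>))"
  have 1: "((\<lambda>s. ln (Phi (x s))) has_real_derivative \<beta> * rv) (at s)"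
    by (rule DERIV_cong[OF DERIV_chain2[OF DERIV_ln_divide[OF Phi_pos] der_Phi]])
      (use Phi_pos[of "x s"] in simp)
  have "((\<lambda>s. 1 + exp (\<alpha> * (ln (Phi (x s)) - \<tau>))) has_real_derivative
      0 + ?e * (\<alpha> * (\<beta> * rv - 0))) (at s)"
    by (intro DERIV_add DERIV_const DERIV_fun_exp DERIV_cmult DERIV_diff 1)
  moreover have "1 + ?e \<noteq> 0" using exp_gt_zero[of "\<alpha> * (ln (Phi (x s)) - \<tau>)"] by linarith
  ultimately have "((\<lambda>s. f (x s)) has_real_derivative - (\<alpha> * (\<beta> * rv) * ?e) / ((1 + ?e) * (1 + ?e))) (at s)"
    unfolding f_def by (rule DERIV_cong[OF DERIV_divide[OF DERIV_const]]) (simp add: mult_ac)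
  also have "- (\<alpha> * (\<beta> * rv) * ?e) / ((1 + ?e) * (1 + ?e)) = l1 (x s) * (\<beta> * rv)"
  proof -
    define e where "e = ?e"
    have "1 + e > 0" by (simp add: e_def add_pos_pos)
    then show ?thesis unfolding l1_def f_def e_def[symmetric] by (simp add: divide_simps)
  qed
  finally show ?thesis .
qed

lemma der_f: "((\<lambda>s. f (x s)) has_real_derivative (\<Sum>j=1..p. grad (x s) j * v j)) (at s)"
  using der_f' by (simp add: grad_def rv_def sum_distrib_left mult.assoc)

lemma der_l1: "((\<lambda>s. l1 (x s)) has_real_derivative l2 (x s) * (\<beta> * rv)) (at s)"
  unfolding l1_def
  by (rule DERIV_cong[OF DERIV_cmult[OF DERIV_mult[OF der_f' DERIV_diff[OF DERIV_const der_f']]]])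
    (simp add: l1_def l2_def power2_eq_square algebra_simps)

lemma der_l2: "((\<lambda>s. l2 (x s)) has_real_derivative l3 (x s) * (\<beta> * rv)) (at s)"
  unfolding l2_def
  by (rule DERIV_cong[OF DERIV_cmult[OF DERIV_mult[OF DERIV_mult[OF der_f' DERIV_diff[OF DERIV_const der_f']]
      DERIV_diff[OF DERIV_const DERIV_cmult[OF der_f']]]]])
    (simp add: l1_def l3_def power2_eq_square power3_eq_cube algebra_simps)

lemma der_grad: "j \<in> {1..p} \<Longrightarrow>
  ((\<lambda>s. grad (x s) j) has_real_derivative (\<Sum>k=1..p. hess (x s) j k * v k)) (at s)"
proof -
  assume j: "j \<in> {1..p}"
  have "(\<Sum>k=1..p. hess (x s) j k * v k) =
    (\<Sum>k=1..p. \<beta>\<^sup>2 * (l2 (x s) - l1 (x s)) * rh (x s) j * (rh (x s) k * v k) + (if j = k then \<beta>\<^sup>2 * l1 (x s) * pr (x s) k * v k else 0))"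
    unfolding hess_def by (intro sum.cong refl) (simp add: algebra_simps)
  also have "\<dots> = \<beta>\<^sup>2 * (l2 (x s) - l1 (x s)) * rh (x s) j * rv + \<beta>\<^sup>2 * l1 (x s) * pr (x s) j * v j"
    unfolding sum.distrib sum_distrib_left[symmetric] rv_def sum_delta[OF j] ..
  finally have e: "(\<Sum>k=1..p. hess (x s) j k * v k) = \<dots>" .
  show ?thesis unfolding e grad_def
    by (rule DERIV_cong[OF DERIV_mult[OF DERIV_mult[OF der_l1 DERIV_const] der_rh[OF j]]])
      (simp add: power2_eq_square algebra_simps)
qed

definition "third j k = \<beta> ^ 3 * ((l3 (x s) - l2 (x s)) * rv * rh (x s) j * rh (x s) k +
    (l2 (x s) - l1 (x s)) * ((pr (x s) j * v j - rh (x s) j * rv) * rh (x s) k + rh (x s) j * (pr (x s) k * v k - rh (x s) k * rv)) +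
    (if j = k then l2 (x s) * rv * pr (x s) j + l1 (x s) * (rh (x s) j * v j - pr (x s) j * rv) else 0))"

lemma der_hess: 
  assumes j: "j \<in> {1..p}" and k: "k \<in> {1..p}"
  shows "((\<lambda>s. hess (x s) j k) has_real_derivative third j k) (at s)"
proof -
  have 1: "((\<lambda>s. (l2 (x s) - l1 (x s)) * rh (x s) j * rh (x s) k) has_real_derivative
      \<beta> * ((l3 (x s) - l2 (x s)) * rv * rh (x s) j * rh (x s) k +
    (l2 (x s) - l1 (x s)) * ((pr (x s) j * v j - rh (x s) j * rv) * rh (x s) k + rh (x s) j * (pr (x s) k * v k - rh (x s) k * rv)))) (at s)"
    by (rule DERIV_cong[OF DERIV_mult[OF DERIV_mult[OF DERIV_diff[OF der_l2 der_l1] der_rh[OF j]] der_rh[OF k]]])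
      (simp add: algebra_simps)
  have 2: "((\<lambda>s. if j = k then l1 (x s) * pr (x s) j else 0) has_real_derivative
      \<beta> * (if j = k then l2 (x s) * rv * pr (x s) j + l1 (x s) * (rh (x s) j * v j - pr (x s) j * rv) else 0)) (at s)"
  proof (cases "j = k")
    case True
    then show ?thesis
      by simp (rule DERIV_cong[OF DERIV_mult[OF der_l1 der_pr[OF k]]], simp add: algebra_simps)
  qed simp
  show ?thesis unfolding hess_def third_def
    by (rule DERIV_cong[OF DERIV_cmult[OF DERIV_add[OF 1 2]]])
      (simp add: power3_eq_cube power2_eq_square distrib_left mult.assoc)
qed

text \<open>Every \<open>rh\<close> is replaced by \<open>pr\<close>, \<open>rv\<close> by
  \<open>avg\<close>, and each difference of consecutive \<open>l\<close> by
  \<open>2 * \<alpha>\<close>. In the term with \<open>pr x j * pr x k\<close> the average occurs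
  three times with factor \<open>2 * \<alpha>\<close>, which gives the 6; all other coefficients are
  smaller.\<close>

lemma abs_third_le: "\<bar>third j k\<bar> \<le> 6 * \<alpha> * \<beta> ^ 3 * U (x s) j k v"
proof -
  define P where "P = pr (x s)"
  define R where "R = rh (x s)"
  define a where "a = avg (x s) v"
  have P: "0 \<le> P i" "\<bar>R i\<bar> \<le> P i" for i using pr_nonneg rh_le_pr by (simp_all add: P_def R_def)
  have a: "0 \<le> a" "\<bar>rv\<bar> \<le> a" using avg_nonneg abs_rh_sum_le by (simp_all add: a_def rv_def)
  have l: "\<bar>l3 (x s) - l2 (x s)\<bar> \<le> 2 * \<alpha>" "\<bar>l2 (x s) - l1 (x s)\<bar> \<le> 2 * \<alpha>"
    using l_bounds[of "x s"] by linarith+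
  have d: "\<bar>P i * v i - R i * rv\<bar> \<le> P i * (\<bar>v i\<bar> + a)" for i
  proof -
    have "\<bar>P i * v i - R i * rv\<bar> \<le> \<bar>P i * v i\<bar> + \<bar>R i * rv\<bar>" by (rule abs_triangle_ineq4)
    also have "\<dots> \<le> P i * \<bar>v i\<bar> + P i * a"
      unfolding abs_mult using P a by (intro add_mono mult_mono) auto
    finally show ?thesis by (simp add: distrib_left)
  qed
  have d': "\<bar>R i * v i - P i * rv\<bar> \<le> P i * (\<bar>v i\<bar> + a)" for i
  proof -
    have "\<bar>R i * v i - P i * rv\<bar> \<le> \<bar>R i * v i\<bar> + \<bar>P i * rv\<bar>" by (rule abs_triangle_ineq4)
    also have "\<dots> \<le> P i * \<bar>v i\<bar> + P i * a"
      unfolding abs_mult using P a by (intro add_mono mult_mono) auto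
    finally show ?thesis by (simp add: distrib_left)
  qed
  have 1: "\<bar>(l3 (x s) - l2 (x s)) * rv * R j * R k\<bar> \<le> (2 * \<alpha>) * a * P j * P k"
    unfolding abs_mult using l a P \<alpha> by (intro mult_mono mult_nonneg_nonneg) auto
  have 2: "\<bar>(P j * v j - R j * rv) * R k + R j * (P k * v k - R k * rv)\<bar> \<le>
      P j * (\<bar>v j\<bar> + a) * P k + P j * (P k * (\<bar>v k\<bar> + a))"
  proof (rule order_trans[OF abs_triangle_ineq], rule add_mono)
    show "\<bar>(P j * v j - R j * rv) * R k\<bar> \<le> P j * (\<bar>v j\<bar> + a) * P k"
      unfolding abs_mult[of _ "R k"] using d[of j] P a by (intro mult_mono mult_nonneg_nonneg) auto
    show "\<bar>R j * (P k * v k - R k * rv)\<bar> \<le> P j * (P k * (\<bar>v k\<bar> + a))"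
      unfolding abs_mult[of "R j"] using d[of k] P a by (intro mult_mono mult_nonneg_nonneg) auto
  qed
  have 3: "\<bar>(l2 (x s) - l1 (x s)) * ((P j * v j - R j * rv) * R k + R j * (P k * v k - R k * rv))\<bar> \<le>
      (2 * \<alpha>) * (P j * (\<bar>v j\<bar> + a) * P k + P j * (P k * (\<bar>v k\<bar> + a)))"
    unfolding abs_mult[of "l2 (x s) - l1 (x s)"] using l 2 \<alpha> by (intro mult_mono) auto
  have 4: "\<bar>l2 (x s) * rv * P j + l1 (x s) * (R j * v j - P j * rv)\<bar> \<le> \<alpha> * a * P j + \<alpha> * (P j * (\<bar>v j\<bar> + a))"
  proof (rule order_trans[OF abs_triangle_ineq], rule add_mono)
    show "\<bar>l2 (x s) * rv * P j\<bar> \<le> \<alpha> * a * P j"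
      unfolding abs_mult using l_bounds[of "x s"] P a \<alpha> by (intro mult_mono mult_nonneg_nonneg) auto
    show "\<bar>l1 (x s) * (R j * v j - P j * rv)\<bar> \<le> \<alpha> * (P j * (\<bar>v j\<bar> + a))"
      unfolding abs_mult[of "l1 (x s)"] using l_bounds[of "x s"] d'[of j] P a \<alpha> by (intro mult_mono) auto
  qed
  have nn: "0 \<le> \<alpha> * (P j * P k * \<bar>v j\<bar>)" "0 \<le> \<alpha> * (P j * P k * \<bar>v k\<bar>)" "0 \<le> \<alpha> * (P j * a)" "0 \<le> \<alpha> * (P j * \<bar>v j\<bar>)"
    using \<alpha> P a by auto
  have "\<bar>(l3 (x s) - l2 (x s)) * rv * R j * R k +
    (l2 (x s) - l1 (x s)) * ((P j * v j - R j * rv) * R k + R j * (P k * v k - R k * rv)) +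
    (if j = k then l2 (x s) * rv * P j + l1 (x s) * (R j * v j - P j * rv) else 0)\<bar> \<le>
    (2 * \<alpha>) * a * P j * P k + (2 * \<alpha>) * (P j * (\<bar>v j\<bar> + a) * P k + P j * (P k * (\<bar>v k\<bar> + a))) +
    (if j = k then \<alpha> * a * P j + \<alpha> * (P j * (\<bar>v j\<bar> + a)) else 0)"
    using 1 3 4 by (intro order_trans[OF abs_triangle_ineq] add_mono) auto
  also have "\<dots> \<le> 6 * \<alpha> * (P j * P k * (a + \<bar>v j\<bar> + \<bar>v k\<bar>) + (if j = k then P j * (a + \<bar>v j\<bar>) else 0))"
    using nn by (cases "j = k") (simp_all add: algebra_simps)
  finally have "\<bar>third j k\<bar> \<le> \<beta> ^ 3 * \<dots>"
    unfolding third_def P_def[symmetric] R_def[symmetric] abs_mult[of "\<beta> ^ 3"] using \<beta>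
    by (simp add: mult_left_mono)
  moreover have "\<beta> ^ 3 * (6 * \<alpha> * W) = 6 * \<alpha> * \<beta> ^ 3 * W" for W by simp
  ultimately show ?thesis unfolding U_def P_def[symmetric] a_def[symmetric] by (simp only:)
qed

end

lemma exp_shift_bounds:
  assumes "\<beta> * \<bar>w\<bar> \<le> 1"
  shows "exp (\<beta> * (y + w)) + exp (- (\<beta> * (y + w))) \<le> exp 1 * (exp (\<beta> * y) + exp (- (\<beta> * y)))"
    "exp (\<beta> * y) + exp (- (\<beta> * y)) \<le> exp 1 * (exp (\<beta> * (y + w)) + exp (- (\<beta> * (y + w))))"
proof -
  have w: "\<beta> * w \<le> 1" "- (\<beta> * w) \<le> 1" using assms \<beta> abs_mult[of \<beta> w] by (auto simp: abs_le_iff)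
  have "exp (\<beta> * (y + w)) \<le> exp (1 + \<beta> * y)" "exp (- (\<beta> * (y + w))) \<le> exp (1 + - (\<beta> * y))"
    "exp (\<beta> * y) \<le> exp (1 + \<beta> * (y + w))" "exp (- (\<beta> * y)) \<le> exp (1 + - (\<beta> * (y + w)))"
    using w by (simp_all add: distrib_left)
  then show "exp (\<beta> * (y + w)) + exp (- (\<beta> * (y + w))) \<le> exp 1 * (exp (\<beta> * y) + exp (- (\<beta> * y)))"
    "exp (\<beta> * y) + exp (- (\<beta> * y)) \<le> exp 1 * (exp (\<beta> * (y + w)) + exp (- (\<beta> * (y + w))))"
    unfolding exp_add distrib_left[of "exp 1"] by linarith+
qed

text \<open>Such a shift changes each exponential by at most a factor \<open>exp 1\<close>, hence
  numerator and denominator together by \<open>exp 2\<close>. This multiplicative stability allows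
  weights to be moved to a base point that does not involve the shift.\<close>

lemma pr_shift:
  assumes w: "\<And>j. j \<in> {1..p} \<Longrightarrow> \<beta> * \<bar>w j\<bar> \<le> 1" and j: "j \<in> {1..p}"
  shows "pr (\<lambda>k. x k + w k) j \<le> exp 2 * pr x j"
proof -
  have "Phi x \<le> exp 1 * Phi (\<lambda>k. x k + w k)"
    unfolding Phi_def sum_distrib_left by (intro sum_mono exp_shift_bounds(2) w)
  then have "(exp (\<beta> * (x j + w j)) + exp (- (\<beta> * (x j + w j)))) * Phi x \<le>
      exp 1 * (exp (\<beta> * x j) + exp (- (\<beta> * x j))) * (exp 1 * Phi (\<lambda>k. x k + w k))"
    using exp_shift_bounds(1)[OF w[OF j]] Phi_pos[of x] by (intro mult_mono) (auto intro!: add_nonneg_nonneg)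
  moreover have "exp 1 * B * (exp 1 * Q) = exp 2 * B * Q" for B Q :: real
  proof -
    have "exp 1 * B * (exp 1 * Q) = (exp 1 * exp 1) * B * Q" by (simp only: mult_ac)
    then show ?thesis by (simp flip: exp_add)
  qed
  ultimately have "(exp (\<beta> * (x j + w j)) + exp (- (\<beta> * (x j + w j)))) * Phi x \<le>
      exp 2 * (exp (\<beta> * x j) + exp (- (\<beta> * x j))) * Phi (\<lambda>k. x k + w k)"
    by (simp only:)
  moreover have "a / c \<le> e * (b / d)" if "a * d \<le> e * b * c" "c > 0" "d > 0" for a b c d e :: real
    using that by (simp add: pos_divide_le_eq pos_le_divide_eq mult_ac)
  ultimately show ?thesis unfolding pr_def using Phi_pos by blast
qed

text \<open>\<open>U\<close> has degree at most three in the weights, counting \<open>avg\<close>,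
  so the shift costs \<open>exp 2 * exp 2 * exp 2\<close>. Terms of lower degree are padded with
  factors \<open>exp 2 \<ge> 1\<close>.\<close>

lemma U_shift:
  assumes w: "\<And>j. j \<in> {1..p} \<Longrightarrow> \<beta> * \<bar>w j\<bar> \<le> 1" and j: "j \<in> {1..p}" and k: "k \<in> {1..p}"
  shows "U (\<lambda>k. x k + w k) j k v \<le> exp 6 * U x j k v"
proof -
  let ?y = "\<lambda>k. x k + w k"
  have P1: "pr ?y i \<le> exp 2 * pr x i" if "i \<in> {1..p}" for i by (rule pr_shift[OF w that])
  note P = pr_nonneg[of x] pr_nonneg[of ?y]
  have e: "exp 2 * exp 2 * exp 2 = exp (6::real)" by (simp flip: exp_add)
  have e1: "exp 2 \<ge> (1::real)" by simp
  have av: "avg ?y v \<le> exp 2 * avg x v"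
    unfolding avg_def sum_distrib_left mult.assoc[symmetric]
    by (intro sum_mono mult_right_mono P1) auto
  have vv: "\<bar>v i\<bar> \<le> exp 2 * \<bar>v i\<bar>" for i using mult_right_mono[OF e1, of "\<bar>v i\<bar>"] by simp
  have 1: "pr ?y j * pr ?y k * (avg ?y v + \<bar>v j\<bar> + \<bar>v k\<bar>) \<le>
      (exp 2 * pr x j) * (exp 2 * pr x k) * (exp 2 * avg x v + exp 2 * \<bar>v j\<bar> + exp 2 * \<bar>v k\<bar>)"
    using P1[OF j] P1[OF k] P av vv avg_nonneg[of ?y v]
    by (intro mult_mono add_mono) (auto intro!: mult_nonneg_nonneg add_nonneg_nonneg)
  have "1 * pr ?y j * (avg ?y v + \<bar>v j\<bar>) \<le> exp 2 * (exp 2 * pr x j) * (exp 2 * avg x v + exp 2 * \<bar>v j\<bar>)"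
    using P1[OF j] P av vv avg_nonneg[of ?y v] e1
    by (intro mult_mono add_mono) (auto intro!: mult_nonneg_nonneg add_nonneg_nonneg)
  then have "U ?y j k v \<le> (exp 2 * pr x j) * (exp 2 * pr x k) * (exp 2 * avg x v + exp 2 * \<bar>v j\<bar> + exp 2 * \<bar>v k\<bar>) +
    (if j = k then exp 2 * (exp 2 * pr x j) * (exp 2 * avg x v + exp 2 * \<bar>v j\<bar>) else 0)"
    unfolding U_def using 1 by (intro add_mono) auto
  also have "\<dots> = exp 2 * exp 2 * exp 2 * U x j k v"
    unfolding U_def by (simp add: algebra_simps)
  finally show ?thesis unfolding e .
qed

text \<open>The mean value theorem gives the third derivative at an unknown point of the segment;
  \<open>U_shift\<close> brings its bound back to the base point \<open>x\<close>. In the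
  application \<open>x\<close> omits a summand, \<open>v\<close> is that summand and
  \<open>c\<close> the interpolation weight.\<close>

lemma hess_diff_le:
  assumes c: "0 \<le> c" "c \<le> 1" and v: "\<And>j. j \<in> {1..p} \<Longrightarrow> \<beta> * \<bar>v j\<bar> \<le> 1"
    and j: "j \<in> {1..p}" and k: "k \<in> {1..p}"
  shows "\<bar>hess (\<lambda>i. x i + c * v i) j k - hess x j k\<bar> \<le> 6 * exp 6 * \<alpha> * \<beta> ^ 3 * U x j k v"
proof (cases "c = 0")
  case True
  then show ?thesis using U_nonneg \<alpha> \<beta> by simp
next
  case False
  let ?y = "\<lambda>s i. x i + s * v i"
  have d: "((\<lambda>s. ?y s i) has_real_derivative v i) (at s)" for s i
    using DERIV_add[OF DERIV_const DERIV_cmult_right[OF DERIV_ident]] by simp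
  have "\<exists>z>0. z < c \<and> hess (?y c) j k - hess (?y 0) j k = (c - 0) * third ?y v z j k"
    by (rule MVT2) (use False c in \<open>auto intro: der_hess d j k\<close>)
  then obtain z where z: "0 < z" "z < c" "hess (?y c) j k - hess (?y 0) j k = c * third ?y v z j k"
    by auto
  have "\<bar>third ?y v z j k\<bar> \<le> 6 * \<alpha> * \<beta> ^ 3 * U (?y z) j k v" by (rule abs_third_le) (rule d)
  also have "\<dots> \<le> 6 * \<alpha> * \<beta> ^ 3 * (exp 6 * U x j k v)"
  proof (intro mult_left_mono U_shift j k)
    fix i assume "i \<in> {1..p}"
    from v[OF this] have "z * (\<beta> * \<bar>v i\<bar>) \<le> 1 * 1" using z c \<beta> by (intro mult_mono) auto
    then show "\<beta> * \<bar>z * v i\<bar> \<le> 1" using z by (simp add: abs_mult mult.left_commute)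
  qed (use \<alpha> \<beta> in auto)
  finally have "\<bar>third ?y v z j k\<bar> \<le> 6 * exp 6 * \<alpha> * \<beta> ^ 3 * U x j k v" by (simp add: mult_ac)
  moreover have "\<bar>c * third ?y v z j k\<bar> \<le> 1 * \<bar>third ?y v z j k\<bar>"
    unfolding abs_mult using c by (intro mult_right_mono) auto
  ultimately show ?thesis using z(3) by simp
qed

text \<open>The inequality of arithmetic and geometric means for three factors, from the
  factorisation of \<open>x ^ 3 + y ^ 3 + z ^ 3 - 3 * (x * y * z)\<close>.\<close>

lemma abs_mult3_le: "\<bar>a * b * c\<bar> \<le> (\<bar>a\<bar> ^ 3 + \<bar>b\<bar> ^ 3 + \<bar>c\<bar> ^ 3) / 3" for a b c :: real
proof -
  define x where "x = \<bar>a\<bar>" define y where "y = \<bar>b\<bar>" define z where "z = \<bar>c\<bar>"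
  have "0 \<le> (x + y + z) * ((x - y)\<^sup>2 + (y - z)\<^sup>2 + (z - x)\<^sup>2)"
    unfolding x_def y_def z_def by (intro mult_nonneg_nonneg add_nonneg_nonneg) auto
  also have "\<dots> = 2 * (x ^ 3 + y ^ 3 + z ^ 3 - 3 * (x * y * z))"
    by (simp add: power2_eq_square power3_eq_cube algebra_simps)
  finally show ?thesis unfolding abs_mult x_def y_def z_def by simp
qed

definition avg3 :: "(nat \<Rightarrow> real) \<Rightarrow> (nat \<Rightarrow> real) \<Rightarrow> real" where
  "avg3 x v = (\<Sum>j=1..p. pr x j * \<bar>v j\<bar> ^ 3)"

text \<open>Expanding \<open>U\<close> gives five averages, under products of the weights, of cubic
  monomials in \<open>\<bar>v\<bar>\<close>: three from pairs of indices and two from the diagonal.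
  By the mean inequality each is at most \<open>avg3 x v\<close>, since the weights sum to
  1.\<close>

lemma sum_U_weighted:
  "(\<Sum>j=1..p. \<Sum>k=1..p. \<bar>v j * v k\<bar> * U x j k v) \<le> 5 * avg3 x v"
proof -
  have m3: "x * y * z \<le> (x ^ 3 + y ^ 3 + z ^ 3) / 3" if "0 \<le> x" "0 \<le> y" "0 \<le> z" for x y z :: real
    using abs_mult3_le[of x y z] that by (simp add: abs_of_nonneg)
  let ?S = "\<lambda>g. \<Sum>j=1..p. pr x j * g j"
  have c: "?S (\<lambda>j. C) = C" for C unfolding sum_distrib_right[symmetric] pr_sum by simp
  have a: "?S (\<lambda>j. g j + h j) = ?S g + ?S h" for g h by (simp add: distrib_left sum.distrib)
  have m: "?S g \<le> ?S h" if "\<And>j. j \<in> {1..p} \<Longrightarrow> g j \<le> h j" for g h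
    by (intro sum_mono mult_left_mono that pr_nonneg)
  have d: "?S (\<lambda>j. g j / 3) = ?S g / 3" for g by (simp add: sum_divide_distrib)
  have T: "?S (\<lambda>j. ?S (\<lambda>k. ?S (\<lambda>l. \<bar>v j\<bar> * \<bar>v k\<bar> * \<bar>v l\<bar>))) \<le> avg3 x v"
  proof -
    have "?S (\<lambda>j. ?S (\<lambda>k. ?S (\<lambda>l. \<bar>v j\<bar> * \<bar>v k\<bar> * \<bar>v l\<bar>))) \<le>
      ?S (\<lambda>j. ?S (\<lambda>k. ?S (\<lambda>l. (\<bar>v j\<bar> ^ 3 + \<bar>v k\<bar> ^ 3 + \<bar>v l\<bar> ^ 3) / 3)))"
      by (intro m m3) auto
    also have "\<dots> = avg3 x v" unfolding d a c avg3_def by simp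
    finally show ?thesis .
  qed
  have T1: "?S (\<lambda>j. ?S (\<lambda>k. \<bar>v j\<bar> * \<bar>v k\<bar> * \<bar>v j\<bar>)) \<le> avg3 x v"
  proof -
    have "?S (\<lambda>j. ?S (\<lambda>k. \<bar>v j\<bar> * \<bar>v k\<bar> * \<bar>v j\<bar>)) \<le> ?S (\<lambda>j. ?S (\<lambda>k. (\<bar>v j\<bar> ^ 3 + \<bar>v k\<bar> ^ 3 + \<bar>v j\<bar> ^ 3) / 3))"
      by (intro m m3) auto
    also have "\<dots> = avg3 x v" unfolding d a c avg3_def by simp
    finally show ?thesis .
  qed
  have T2: "?S (\<lambda>j. ?S (\<lambda>k. \<bar>v j\<bar> * \<bar>v k\<bar> * \<bar>v k\<bar>)) \<le> avg3 x v"
  proof -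
    have "?S (\<lambda>j. ?S (\<lambda>k. \<bar>v j\<bar> * \<bar>v k\<bar> * \<bar>v k\<bar>)) \<le> ?S (\<lambda>j. ?S (\<lambda>k. (\<bar>v j\<bar> ^ 3 + \<bar>v k\<bar> ^ 3 + \<bar>v k\<bar> ^ 3) / 3))"
      by (intro m m3) auto
    also have "\<dots> = avg3 x v" unfolding d a c avg3_def by simp
    finally show ?thesis .
  qed
  have T3: "?S (\<lambda>j. ?S (\<lambda>l. \<bar>v j\<bar> * \<bar>v j\<bar> * \<bar>v l\<bar>)) \<le> avg3 x v"
  proof -
    have "?S (\<lambda>j. ?S (\<lambda>l. \<bar>v j\<bar> * \<bar>v j\<bar> * \<bar>v l\<bar>)) \<le> ?S (\<lambda>j. ?S (\<lambda>k. (\<bar>v j\<bar> ^ 3 + \<bar>v j\<bar> ^ 3 + \<bar>v k\<bar> ^ 3) / 3))"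
      by (intro m m3) auto
    also have "\<dots> = avg3 x v" unfolding d a c avg3_def by simp
    finally show ?thesis .
  qed
  have "(\<Sum>j=1..p. \<Sum>k=1..p. \<bar>v j * v k\<bar> * U x j k v) =
    (\<Sum>j=1..p. \<Sum>k=1..p. pr x j * (pr x k * (\<Sum>l=1..p. pr x l * (\<bar>v j\<bar> * \<bar>v k\<bar> * \<bar>v l\<bar>))) + pr x j * (pr x k * (\<bar>v j\<bar> * \<bar>v k\<bar> * \<bar>v j\<bar>))
      + pr x j * (pr x k * (\<bar>v j\<bar> * \<bar>v k\<bar> * \<bar>v k\<bar>)) + (if j = k then pr x j * (\<Sum>l=1..p. pr x l * (\<bar>v j\<bar> * \<bar>v k\<bar> * \<bar>v l\<bar>)) + pr x j * \<bar>v k\<bar> ^ 3 else 0))"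
    by (intro sum.cong refl) (simp add: U_def avg_def abs_mult distrib_left sum_distrib_left power3_eq_cube mult_ac
        del: abs_mult_self_eq)
  also have "\<dots> = ?S (\<lambda>j. ?S (\<lambda>k. ?S (\<lambda>l. \<bar>v j\<bar> * \<bar>v k\<bar> * \<bar>v l\<bar>))) + ?S (\<lambda>j. ?S (\<lambda>k. \<bar>v j\<bar> * \<bar>v k\<bar> * \<bar>v j\<bar>)) +
    ?S (\<lambda>j. ?S (\<lambda>k. \<bar>v j\<bar> * \<bar>v k\<bar> * \<bar>v k\<bar>)) + (?S (\<lambda>j. ?S (\<lambda>l. \<bar>v j\<bar> * \<bar>v j\<bar> * \<bar>v l\<bar>)) + avg3 x v)"
    unfolding sum.distrib sum_distrib_left[symmetric] avg3_def
    by (intro arg_cong2[where f="(+)"] refl) (simp add: sum.delta' sum.distrib cong: if_cong)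
  also have "\<dots> \<le> 5 * avg3 x v" using T T1 T2 T3 by linarith
  finally show ?thesis .
qed

text \<open>Counterpart for coefficients that do not involve \<open>v\<close>, used when a product
  of two entries has been replaced by its expectation. Summed over all pairs, \<open>U\<close> is
  exactly \<open>5 * avg x v\<close>.\<close>

lemma sum_U_le:
  assumes a: "\<And>j k. j \<in> {1..p} \<Longrightarrow> k \<in> {1..p} \<Longrightarrow> \<bar>a j k\<bar> \<le> A" 
  shows "(\<Sum>j=1..p. \<Sum>k=1..p. \<bar>a j k\<bar> * U x j k v) \<le> 5 * A * avg x v"
proof -
  have "(\<Sum>j=1..p. \<Sum>k=1..p. \<bar>a j k\<bar> * U x j k v) \<le> (\<Sum>j=1..p. \<Sum>k=1..p. A * U x j k v)"
    by (intro sum_mono mult_right_mono a U_nonneg)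
  also have "\<dots> = A * (\<Sum>j=1..p. \<Sum>k=1..p. U x j k v)" by (simp add: sum_distrib_left)
  also have "(\<Sum>j=1..p. \<Sum>k=1..p. U x j k v) = 5 * avg x v"
  proof -
    have "(\<Sum>k=1..p. U x j k v) = 2 * (pr x j * avg x v) + 2 * (pr x j * \<bar>v j\<bar>) + pr x j * avg x v" if j: "j \<in> {1..p}" for j
    proof -
      have "(\<Sum>k=1..p. U x j k v) = (\<Sum>k=1..p. pr x j * (avg x v + \<bar>v j\<bar>) * pr x k + pr x j * (pr x k * \<bar>v k\<bar>) +
          (if j = k then pr x j * (avg x v + \<bar>v j\<bar>) else 0))"
        unfolding U_def by (intro sum.cong refl) (simp add: algebra_simps)
      also have "\<dots> = pr x j * (avg x v + \<bar>v j\<bar>) + pr x j * avg x v + pr x j * (avg x v + \<bar>v j\<bar>)"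
        unfolding sum.distrib sum_distrib_left[symmetric] pr_sum using j
        by (simp add: sum.delta' avg_def)
      finally show ?thesis by (simp add: algebra_simps)
    qed
    then have "(\<Sum>j=1..p. \<Sum>k=1..p. U x j k v) = (\<Sum>j=1..p. 2 * (pr x j * avg x v) + 2 * (pr x j * \<bar>v j\<bar>) + pr x j * avg x v)"
      by (intro sum.cong) auto
    also have "\<dots> = 5 * avg x v"
      unfolding sum.distrib sum_distrib_left[symmetric] sum_distrib_right[symmetric] pr_sum avg_def[symmetric] by simp
    finally show ?thesis .
  qed
  finally show ?thesis by (simp add: mult_ac)
qed

text \<open>The mean value theorem leaves \<open>hess\<close> at an intermediate point of the
  segment; replacing it by \<open>hess x\<close> costs \<open>hess_diff_le\<close> with constant 6,
  and \<open>sum_U_weighted\<close> contributes the 5 that makes 30.\<close>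

lemma grad_taylor:
  assumes c: "0 \<le> c" "c \<le> 1" and v: "\<And>j. j \<in> {1..p} \<Longrightarrow> \<beta> * \<bar>v j\<bar> \<le> 1"
  shows "\<bar>(\<Sum>j=1..p. v j * grad (\<lambda>i. x i + c * v i) j) - (\<Sum>j=1..p. v j * grad x j) -
      c * (\<Sum>j=1..p. \<Sum>k=1..p. v j * v k * hess x j k)\<bar> \<le> 30 * exp 6 * \<alpha> * \<beta> ^ 3 * avg3 x v"
proof (cases "c = 0")
  case True
  then show ?thesis using \<alpha> \<beta> pr_nonneg by (auto simp: avg3_def intro!: mult_nonneg_nonneg sum_nonneg)
next
  case False
  let ?y = "\<lambda>s i. x i + s * v i"
  have d: "((\<lambda>s. ?y s i) has_real_derivative v i) (at s)" for s i
    using DERIV_add[OF DERIV_const DERIV_cmult_right[OF DERIV_ident]] by simp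
  let ?G = "\<lambda>s. \<Sum>j=1..p. v j * grad (?y s) j"
  let ?H = "\<lambda>s. \<Sum>j=1..p. v j * (\<Sum>k=1..p. hess (?y s) j k * v k)"
  have "(?G has_real_derivative ?H s) (at s)" for s
    by (intro DERIV_sum DERIV_cmult der_grad d)
  then have "\<exists>z>0. z < c \<and> ?G c - ?G 0 = (c - 0) * ?H z"
    by (intro MVT2) (use False c in auto)
  then obtain z where z: "0 < z" "z < c" "?G c - ?G 0 = c * ?H z" by auto
  have E: "?H z - (\<Sum>j=1..p. \<Sum>k=1..p. v j * v k * hess x j k) =
      (\<Sum>j=1..p. \<Sum>k=1..p. v j * v k * (hess (?y z) j k - hess x j k))"
    by (simp add: sum_distrib_left sum_subtractf right_diff_distrib mult_ac)
  have "\<bar>?H z - (\<Sum>j=1..p. \<Sum>k=1..p. v j * v k * hess x j k)\<bar> \<le> (\<Sum>j=1..p. \<Sum>k=1..p. \<bar>v j * v k * (hess (?y z) j k - hess x j k)\<bar>)"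
    unfolding E by (rule order_trans[OF sum_abs], rule sum_mono, rule sum_abs)
  also have "\<dots> = (\<Sum>j=1..p. \<Sum>k=1..p. \<bar>v j * v k\<bar> * \<bar>hess (?y z) j k - hess x j k\<bar>)"
    by (simp only: abs_mult)
  also have "\<dots> \<le> (\<Sum>j=1..p. \<Sum>k=1..p. \<bar>v j * v k\<bar> * (6 * exp 6 * \<alpha> * \<beta> ^ 3 * U x j k v))"
  proof (intro sum_mono mult_left_mono)
    fix j k assume jk: "j \<in> {1..p}" "k \<in> {1..p}"
    show "\<bar>hess (?y z) j k - hess x j k\<bar> \<le> 6 * exp 6 * \<alpha> * \<beta> ^ 3 * U x j k v"
      by (rule hess_diff_le[of z v, OF _ _ v jk]) (use z c in auto)
  qed simp
  also have "\<dots> = 6 * exp 6 * \<alpha> * \<beta> ^ 3 * (\<Sum>j=1..p. \<Sum>k=1..p. \<bar>v j * v k\<bar> * U x j k v)"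
    by (simp add: sum_distrib_left mult_ac)
  also have "\<dots> \<le> 6 * exp 6 * \<alpha> * \<beta> ^ 3 * (5 * avg3 x v)"
    by (intro mult_left_mono sum_U_weighted) (use \<alpha> \<beta> in auto)
  finally have "\<bar>?H z - (\<Sum>j=1..p. \<Sum>k=1..p. v j * v k * hess x j k)\<bar> \<le> 30 * exp 6 * \<alpha> * \<beta> ^ 3 * avg3 x v" by simp
  moreover have "\<bar>c * (?H z - (\<Sum>j=1..p. \<Sum>k=1..p. v j * v k * hess x j k))\<bar> \<le>
      1 * \<bar>?H z - (\<Sum>j=1..p. \<Sum>k=1..p. v j * v k * hess x j k)\<bar>"
    unfolding abs_mult using c by (intro mult_right_mono) auto
  moreover have "?G c - ?G 0 - c * (\<Sum>j=1..p. \<Sum>k=1..p. v j * v k * hess x j k) =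
      c * (?H z - (\<Sum>j=1..p. \<Sum>k=1..p. v j * v k * hess x j k))"
    unfolding z(3) by (simp add: right_diff_distrib)
  ultimately show ?thesis by simp
qed

text \<open>Inside the ball \<open>ln (Phi x) \<le> ln (2 * p) + \<beta> * t\<close>, outside it
  \<open>\<beta> * t \<le> ln (Phi x)\<close>. Together with \<open>f_le\<close> this locates the
  logistic step; the slack \<open>ln (2 * p)\<close> of the soft maximum appears on one side
  only.\<close>

lemma f_ge:
  assumes "linf_norm p x \<le> t" and K: "\<alpha> * (ln (2 * real p) + \<beta> * t - \<tau>) \<le> - K"
  shows "f x \<ge> 1 - exp (- K)"
proof -
  have "exp (\<beta> * x j) + exp (- (\<beta> * x j)) \<le> 2 * exp (\<beta> * t)" if "j \<in> {1..p}" for j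
  proof -
    have "\<bar>x j\<bar> \<le> t" using assms(1) that unfolding linf_norm_le_iff[OF p] by blast
    then have "\<beta> * x j \<le> \<beta> * t" "\<beta> * (- x j) \<le> \<beta> * t" using \<beta> by (intro mult_left_mono; simp)+
    then have "exp (\<beta> * x j) \<le> exp (\<beta> * t)" "exp (- (\<beta> * x j)) \<le> exp (\<beta> * t)" by simp_all
    then show ?thesis by linarith
  qed
  then have "Phi x \<le> (\<Sum>j=1..p. 2 * exp (\<beta> * t))" unfolding Phi_def by (rule sum_mono)
  also have "\<dots> = (2 * real p) * exp (\<beta> * t)" by simp
  finally have "ln (Phi x) \<le> ln ((2 * real p) * exp (\<beta> * t))" using Phi_pos by (subst ln_le_cancel_iff) (use p in auto)
  also have "\<dots> = ln (2 * real p) + \<beta> * t" using p by (subst ln_mult) auto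
  finally have "\<alpha> * (ln (Phi x) - \<tau>) \<le> \<alpha> * (ln (2 * real p) + \<beta> * t - \<tau>)" using \<alpha> by (intro mult_left_mono) auto
  then have e: "exp (\<alpha> * (ln (Phi x) - \<tau>)) \<le> exp (- K)" using K by simp
  define e where "e = exp (\<alpha> * (ln (Phi x) - \<tau>))"
  have e0: "e > 0" "e \<le> exp (- K)" using e by (simp_all add: e_def)
  have "(1 - exp (- K)) * (1 + e) \<le> (1 - e) * (1 + e)" using e0 by (intro mult_right_mono) auto
  also have "\<dots> \<le> 1" by (simp add: algebra_simps)
  finally show ?thesis unfolding f_def e_def[symmetric] using e0 by (simp add: pos_le_divide_eq)
qed

lemma f_le:
  assumes "linf_norm p x > t" and K: "\<alpha> * (\<beta> * t - \<tau>) \<ge> K"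
  shows "f x \<le> exp (- K)"
proof -
  have "\<not> linf_norm p x \<le> t" using assms by simp
  then obtain j where j: "j \<in> {1..p}" "\<bar>x j\<bar> > t" unfolding linf_norm_le_iff[OF p] by auto
  have "\<beta> * t \<le> \<beta> * \<bar>x j\<bar>" using j \<beta> by (intro mult_left_mono) auto
  then have "exp (\<beta> * t) \<le> exp (\<beta> * \<bar>x j\<bar>)" by simp
  also have "\<dots> \<le> exp (\<beta> * x j) + exp (- (\<beta> * x j))" by (cases "x j \<ge> 0") (auto intro: add_increasing add_increasing2)
  also have "\<dots> \<le> Phi x" by (rule Phi_ge[OF j(1)])
  finally have "\<beta> * t \<le> ln (Phi x)" using Phi_pos by (simp add: ln_ge_iff)
  then have "\<alpha> * (\<beta> * t - \<tau>) \<le> \<alpha> * (ln (Phi x) - \<tau>)" using \<alpha> by (intro mult_left_mono) auto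
  then have e: "exp K \<le> exp (\<alpha> * (ln (Phi x) - \<tau>))" using K by simp
  have "exp K \<le> 1 + exp (\<alpha> * (ln (Phi x) - \<tau>))" using e by linarith
  then have "f x \<le> 1 / exp K" unfolding f_def by (intro divide_left_mono) (auto intro!: mult_pos_pos add_pos_pos)
  then show ?thesis by (simp add: exp_minus inverse_eq_divide)
qed

lemma Phi_cong: "(\<And>k. k \<in> {1..p} \<Longrightarrow> x k = y k) \<Longrightarrow> Phi x = Phi y"
  unfolding Phi_def by (rule sum.cong) auto

lemma f_cong: "(\<And>k. k \<in> {1..p} \<Longrightarrow> x k = y k) \<Longrightarrow> f x = f y"
  unfolding f_def using Phi_cong[of x y] by simp

lemma grad_cong: "(\<And>k. k \<in> {1..p} \<Longrightarrow> x k = y k) \<Longrightarrow> j \<in> {1..p} \<Longrightarrow> grad x j = grad y j"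
  unfolding grad_def rh_def l1_def using Phi_cong[of x y] f_cong[of x y] by simp

lemma hess_cong: "(\<And>k. k \<in> {1..p} \<Longrightarrow> x k = y k) \<Longrightarrow> j \<in> {1..p} \<Longrightarrow> k \<in> {1..p} \<Longrightarrow> hess x j k = hess y j k"
  unfolding hess_def rh_def pr_def l1_def l2_def using Phi_cong[of x y] f_cong[of x y] by simp

context
  fixes N :: "'b measure" and X :: "'b \<Rightarrow> nat \<Rightarrow> real"
  assumes X: "\<And>j. j \<in> {1..p} \<Longrightarrow> (\<lambda>\<omega>. X \<omega> j) \<in> borel_measurable N"
begin

lemma measurable_Phi: "(\<lambda>\<omega>. Phi (X \<omega>)) \<in> borel_measurable N"
proof -
  have "(\<lambda>\<omega>. exp (\<beta> * X \<omega> j) + exp (- (\<beta> * X \<omega> j))) \<in> borel_measurable N" if "j \<in> {1..p}" for j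
    using X[OF that] by measurable
  then show ?thesis unfolding Phi_def by (rule borel_measurable_sum)
qed

lemma measurable_f: "(\<lambda>\<omega>. f (X \<omega>)) \<in> borel_measurable N"
  using measurable_Phi unfolding f_def by measurable

lemma measurable_pr: "j \<in> {1..p} \<Longrightarrow> (\<lambda>\<omega>. pr (X \<omega>) j) \<in> borel_measurable N"
  using measurable_Phi X[of j] unfolding pr_def by measurable

lemma measurable_rh: "j \<in> {1..p} \<Longrightarrow> (\<lambda>\<omega>. rh (X \<omega>) j) \<in> borel_measurable N"
  using measurable_Phi X[of j] unfolding rh_def by measurable

lemma measurable_grad: "j \<in> {1..p} \<Longrightarrow> (\<lambda>\<omega>. grad (X \<omega>) j) \<in> borel_measurable N"
  using measurable_f measurable_rh[of j] unfolding grad_def l1_def by measurable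

lemma measurable_hess: "j \<in> {1..p} \<Longrightarrow> k \<in> {1..p} \<Longrightarrow> (\<lambda>\<omega>. hess (X \<omega>) j k) \<in> borel_measurable N"
  using measurable_f measurable_rh[of j] measurable_rh[of k] measurable_pr[of j] unfolding hess_def l1_def l2_def
  by (cases "j = k") simp_all

end

end

section \<open>Leaving out one summand\<close>

lemma integral_sum2:
  fixes f :: "'i \<Rightarrow> 'j \<Rightarrow> 'a \<Rightarrow> real"
  assumes "\<And>j k. j \<in> A \<Longrightarrow> k \<in> B \<Longrightarrow> integrable M (f j k)"
  shows "(LINT \<omega>|M. (\<Sum>j\<in>A. \<Sum>k\<in>B. f j k \<omega>)) = (\<Sum>j\<in>A. \<Sum>k\<in>B. (LINT \<omega>|M. f j k \<omega>))"
proof -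
  have "(LINT \<omega>|M. (\<Sum>j\<in>A. \<Sum>k\<in>B. f j k \<omega>)) = (\<Sum>j\<in>A. LINT \<omega>|M. (\<Sum>k\<in>B. f j k \<omega>))"
    by (rule Bochner_Integration.integral_sum) (intro Bochner_Integration.integrable_sum assms)
  also have "\<dots> = (\<Sum>j\<in>A. \<Sum>k\<in>B. (LINT \<omega>|M. f j k \<omega>))"
    by (intro sum.cong refl Bochner_Integration.integral_sum assms)
  finally show ?thesis .
qed

lemma (in prob_space) abs_expectation_le:
  fixes h g :: "'a \<Rightarrow> real"
  assumes "integrable M h" "integrable M g" "\<And>\<omega>. \<omega> \<in> space M \<Longrightarrow> \<bar>h \<omega>\<bar> \<le> g \<omega>"
  shows "\<bar>expectation h\<bar> \<le> expectation g"
proof -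
  have "\<bar>expectation h\<bar> \<le> expectation (\<lambda>\<omega>. \<bar>h \<omega>\<bar>)" by (rule integral_abs_bound)
  also have "\<dots> \<le> expectation g" by (rule integral_mono) (use assms in auto)
  finally show ?thesis .
qed

lemma (in prob_space) abs_expectation_le_const:
  fixes h :: "'a \<Rightarrow> real"
  assumes "integrable M h" "\<And>\<omega>. \<omega> \<in> space M \<Longrightarrow> \<bar>h \<omega>\<bar> \<le> C"
  shows "\<bar>expectation h\<bar> \<le> C"
  using abs_expectation_le[OF assms(1), of "\<lambda>_. C"] assms(2) by (simp add: prob_space)

text \<open>The summands are meant to be already scaled by \<open>1 / sqrt n\<close> and may be
  biased: \<open>\<mu>\<close> bounds the bias left by truncation and \<open>\<Delta>\<close> the
  defect of the covariance. The third moment bound is written \<open>l ^ 3\<close> so that first and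
  second moments are bounded by \<open>l\<close> and \<open>l\<^sup>2\<close>.\<close>

locale bounded_sum = softmax p \<beta> \<alpha> \<tau> + prob_space M
  for p :: nat and \<beta> \<alpha> \<tau> :: real and M :: "'a measure" +
  fixes n :: nat and \<xi> :: "nat \<Rightarrow> 'a \<Rightarrow> nat \<Rightarrow> real" and Sig :: "nat \<Rightarrow> nat \<Rightarrow> real" and l \<mu> \<Delta> :: real
  assumes n: "n \<ge> 1" and indep: "indep_vars (\<lambda>_. borel_vec p) \<xi> {1..n}"
    and bd: "\<And>i j \<omega>. i \<in> {1..n} \<Longrightarrow> j \<in> {1..p} \<Longrightarrow> \<omega> \<in> space M \<Longrightarrow> \<beta> * \<bar>\<xi> i \<omega> j\<bar> \<le> 1"
    and l: "l > 0"
    and m1: "\<And>i j. i \<in> {1..n} \<Longrightarrow> j \<in> {1..p} \<Longrightarrow> \<bar>expectation (\<lambda>\<omega>. \<xi> i \<omega> j)\<bar> \<le> \<mu>"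
    and m2: "\<And>i j k. i \<in> {1..n} \<Longrightarrow> j \<in> {1..p} \<Longrightarrow> k \<in> {1..p} \<Longrightarrow>
      \<bar>expectation (\<lambda>\<omega>. \<xi> i \<omega> j * \<xi> i \<omega> k) - Sig j k / real n\<bar> \<le> \<Delta> / real n"
    and m3: "\<And>i j. i \<in> {1..n} \<Longrightarrow> j \<in> {1..p} \<Longrightarrow> expectation (\<lambda>\<omega>. \<bar>\<xi> i \<omega> j\<bar> ^ 3) \<le> l ^ 3"
begin

definition S :: "'a \<Rightarrow> nat \<Rightarrow> real" where "S \<omega> j = (\<Sum>i=1..n. \<xi> i \<omega> j)"

lemma xi_measurable: "i \<in> {1..n} \<Longrightarrow> \<xi> i \<in> measurable M (borel_vec p)"
  using indep unfolding indep_vars_def by auto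

lemma xi_comp_measurable: "i \<in> {1..n} \<Longrightarrow> j \<in> {1..p} \<Longrightarrow> (\<lambda>\<omega>. \<xi> i \<omega> j) \<in> borel_measurable M"
  using measurable_compose[OF xi_measurable measurable_component_singleton] by blast

lemma xi_bd: "i \<in> {1..n} \<Longrightarrow> j \<in> {1..p} \<Longrightarrow> \<omega> \<in> space M \<Longrightarrow> \<bar>\<xi> i \<omega> j\<bar> \<le> 1 / \<beta>"
  using bd[of i j \<omega>] \<beta> by (simp add: pos_le_divide_eq mult.commute)

lemma integrable_bdI:
  assumes "h \<in> borel_measurable M" "\<And>\<omega>. \<omega> \<in> space M \<Longrightarrow> \<bar>h \<omega>\<bar> \<le> C"
  shows "integrable M (h :: 'a \<Rightarrow> real)"
  by (rule integrable_const_bound[where B=C]) (use assms in auto)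

lemma S_measurable: "j \<in> {1..p} \<Longrightarrow> (\<lambda>\<omega>. S \<omega> j) \<in> borel_measurable M"
  unfolding S_def by (rule borel_measurable_sum) (rule xi_comp_measurable)

lemma S_bd: "j \<in> {1..p} \<Longrightarrow> \<omega> \<in> space M \<Longrightarrow> \<bar>S \<omega> j\<bar> \<le> real n / \<beta>"
  unfolding S_def using sum_mono[OF xi_bd, of "{1..n}" "\<lambda>i. i" "\<lambda>_. j" "\<lambda>_. \<omega>"]
  by (intro order_trans[OF sum_abs]) auto

lemma comp_vec_measurable: "j \<in> {1..p} \<Longrightarrow> (\<lambda>x. x j) \<in> borel_measurable (borel_vec p)"
  by (rule measurable_component_singleton)

lemma grad_bd: "j \<in> {1..p} \<Longrightarrow> \<bar>grad x j\<bar> \<le> \<alpha> * \<beta>"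
  using mult_left_mono[OF pr_le_1[of j x], of "\<alpha> * \<beta>"] \<alpha> \<beta> by (intro order_trans[OF abs_grad_le[of x j]]) auto

lemma hess_bd: "j \<in> {1..p} \<Longrightarrow> k \<in> {1..p} \<Longrightarrow> \<bar>hess x j k\<bar> \<le> 3 * (\<alpha> * \<beta>\<^sup>2)"
proof -
  assume jk: "j \<in> {1..p}" "k \<in> {1..p}"
  have "pr x j * pr x k \<le> 1 * 1" using jk pr_le_1 pr_nonneg by (intro mult_mono) auto
  then have "2 * (pr x j * pr x k) + (if j = k then pr x j else 0) \<le> 3" using pr_le_1[OF jk(1), of x] by auto
  then have "\<alpha> * \<beta>\<^sup>2 * (2 * (pr x j * pr x k) + (if j = k then pr x j else 0)) \<le> \<alpha> * \<beta>\<^sup>2 * 3"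
    using \<alpha> by (intro mult_left_mono) auto
  then show ?thesis using abs_hess_le[of x j k] by linarith
qed

text \<open>Here \<open>c\<close> is the sine weight of the interpolation and \<open>y\<close> the
  Gaussian part, held fixed. Expectations in this context are over the summands alone.\<close>

context
  fixes c :: real and y :: "nat \<Rightarrow> real"
  assumes c: "0 \<le> c" "c \<le> 1"
begin

definition R :: "nat \<Rightarrow> 'a \<Rightarrow> nat \<Rightarrow> real" where
  "R i \<omega> = (\<lambda>j. c * (\<Sum>k\<in>{1..n} - {i}. \<xi> k \<omega> j) + y j)"

definition Z :: "'a \<Rightarrow> nat \<Rightarrow> real" where "Z \<omega> = (\<lambda>j. c * S \<omega> j + y j)"

lemma Z_eq: "i \<in> {1..n} \<Longrightarrow> Z \<omega> = (\<lambda>j. R i \<omega> j + c * \<xi> i \<omega> j)"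
  unfolding Z_def R_def S_def
  by (rule ext) (simp add: sum.remove[of "{1..n}" i] distrib_left)

lemma R_measurable: "i \<in> {1..n} \<Longrightarrow> j \<in> {1..p} \<Longrightarrow> (\<lambda>\<omega>. R i \<omega> j) \<in> borel_measurable M"
  unfolding R_def
  by (intro borel_measurable_add borel_measurable_times borel_measurable_const borel_measurable_sum xi_comp_measurable) auto

lemma Z_measurable: "j \<in> {1..p} \<Longrightarrow> (\<lambda>\<omega>. Z \<omega> j) \<in> borel_measurable M"
  unfolding Z_def by (intro borel_measurable_add borel_measurable_times borel_measurable_const S_measurable)

text \<open>\<open>R i\<close> is a function of the summands other than \<open>i\<close>, hence
  independent of \<open>\<xi> i\<close>. Measurability of \<open>\<psi>\<close> is assumed for the
  composition, because \<open>R i \<omega>\<close> is not extensional outside \<open>{1..p}\<close>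
  and so not a point of \<open>borel_vec p\<close>.\<close>

lemma leave_one_out_expectation:
  fixes \<phi> \<psi> :: "(nat \<Rightarrow> real) \<Rightarrow> real"
  assumes i: "i \<in> {1..n}" and \<phi>: "\<phi> \<in> borel_measurable (borel_vec p)"
    and \<psi>: "(\<lambda>x. \<psi> (\<lambda>j. c * (\<Sum>k\<in>{1..n} - {i}. x k j) + y j)) \<in> borel_measurable (PiM ({1..n} - {i}) (\<lambda>_. borel_vec p))"
    and bnd: "\<And>\<omega>. \<omega> \<in> space M \<Longrightarrow> \<bar>\<phi> (\<xi> i \<omega>)\<bar> \<le> A" "\<And>x. \<bar>\<psi> x\<bar> \<le> B"
  shows "expectation (\<lambda>\<omega>. \<phi> (\<xi> i \<omega>) * \<psi> (R i \<omega>)) = expectation (\<lambda>\<omega>. \<phi> (\<xi> i \<omega>)) * expectation (\<lambda>\<omega>. \<psi> (R i \<omega>))"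
proof -
  let ?Y1 = "\<lambda>x. \<phi> (x i)" and ?Y2 = "\<lambda>x. \<psi> (\<lambda>j. c * (\<Sum>k\<in>{1..n} - {i}. x k j) + y j)"
  let ?X1 = "\<lambda>\<omega>. restrict (\<lambda>i. \<xi> i \<omega>) {i}" and ?X2 = "\<lambda>\<omega>. restrict (\<lambda>i. \<xi> i \<omega>) ({1..n} - {i})"
  have ind: "indep_var (PiM {i} (\<lambda>_. borel_vec p)) ?X1 (PiM ({1..n} - {i}) (\<lambda>_. borel_vec p)) ?X2"
    by (rule indep_var_restrict[OF indep]) (use i in auto)
  have "?Y1 \<in> borel_measurable (PiM {i} (\<lambda>_. borel_vec p))"
    by (rule measurable_compose[where f="\<lambda>x. x i", OF _ \<phi>]) (rule measurable_component_singleton, simp)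
  then have "indep_var borel (?Y1 \<circ> ?X1) borel (?Y2 \<circ> ?X2)"
    by (rule indep_var_compose[OF ind _ \<psi>])
  also have "?Y1 \<circ> ?X1 = (\<lambda>\<omega>. \<phi> (\<xi> i \<omega>))" by (simp add: comp_def)
  also have "?Y2 \<circ> ?X2 = (\<lambda>\<omega>. \<psi> (R i \<omega>))"
  proof
    fix \<omega>
    have "(\<Sum>k\<in>{1..n} - {i}. ?X2 \<omega> k j) = (\<Sum>k\<in>{1..n} - {i}. \<xi> k \<omega> j)" for j
      by (rule sum.cong) auto
    then show "(?Y2 \<circ> ?X2) \<omega> = \<psi> (R i \<omega>)" by (simp only: comp_def R_def)
  qed
  finally have iv: "indep_var borel (\<lambda>\<omega>. \<phi> (\<xi> i \<omega>)) borel (\<lambda>\<omega>. \<psi> (R i \<omega>))" .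
  show ?thesis
    by (rule indep_var_lebesgue_integral[OF iv])
      (use indep_var_rv1[OF iv] indep_var_rv2[OF iv] bnd in \<open>auto intro: integrable_bdI\<close>)
qed

lemma loo_comp_measurable:
  "j \<in> {1..p} \<Longrightarrow> (\<lambda>x. c * (\<Sum>k\<in>{1..n} - {i}. x k j) + y j) \<in> borel_measurable (PiM ({1..n} - {i}) (\<lambda>_. borel_vec p))"
  by (intro borel_measurable_add borel_measurable_times borel_measurable_const borel_measurable_sum
      measurable_compose[where f="\<lambda>x. x k" and g="\<lambda>x. x j" and N="borel_vec p" for k]
      measurable_component_singleton) auto

context
  fixes i :: nat assumes i: "i \<in> {1..n}"
begin

lemma E_xi_grad: "j \<in> {1..p} \<Longrightarrow> expectation (\<lambda>\<omega>. \<xi> i \<omega> j * grad (R i \<omega>) j) =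
    expectation (\<lambda>\<omega>. \<xi> i \<omega> j) * expectation (\<lambda>\<omega>. grad (R i \<omega>) j)"
  by (rule leave_one_out_expectation[OF i comp_vec_measurable measurable_grad[OF loo_comp_measurable] xi_bd[OF i] grad_bd])

lemma E_xi_hess: "j \<in> {1..p} \<Longrightarrow> k \<in> {1..p} \<Longrightarrow> expectation (\<lambda>\<omega>. \<xi> i \<omega> j * \<xi> i \<omega> k * hess (R i \<omega>) j k) =
    expectation (\<lambda>\<omega>. \<xi> i \<omega> j * \<xi> i \<omega> k) * expectation (\<lambda>\<omega>. hess (R i \<omega>) j k)"
proof -
  assume jk: "j \<in> {1..p}" "k \<in> {1..p}"
  have "\<bar>\<xi> i \<omega> j * \<xi> i \<omega> k\<bar> \<le> 1 / \<beta> * (1 / \<beta>)" if "\<omega> \<in> space M" for \<omega>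
    unfolding abs_mult using xi_bd[OF i] jk that \<beta> by (intro mult_mono) auto
  then show ?thesis
    by (intro leave_one_out_expectation[OF i, where \<phi>="\<lambda>x. x j * x k" and \<psi>="\<lambda>x. hess x j k" and A="1 / \<beta> * (1 / \<beta>)" and B="3 * (\<alpha> * \<beta>\<^sup>2)"]
      borel_measurable_times comp_vec_measurable measurable_hess loo_comp_measurable hess_bd jk)
qed

lemma xi_abs_bd: "j \<in> {1..p} \<Longrightarrow> \<omega> \<in> space M \<Longrightarrow> \<bar>\<bar>\<xi> i \<omega> j\<bar> ^ q\<bar> \<le> (1 / \<beta>) ^ q"
  unfolding power_abs[symmetric] abs_idempotent using xi_bd[OF i] by (simp add: power_abs power_mono)

lemma pr_loo_measurable: "j \<in> {1..p} \<Longrightarrow>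
  (\<lambda>x. pr (\<lambda>j. c * (\<Sum>k\<in>{1..n} - {i}. x k j) + y j) j) \<in> borel_measurable (PiM ({1..n} - {i}) (\<lambda>_. borel_vec p))"
  by (rule measurable_pr[OF loo_comp_measurable])

lemma abs_pow_measurable: "j \<in> {1..p} \<Longrightarrow> (\<lambda>x. \<bar>x j\<bar> ^ q) \<in> borel_measurable (borel_vec p)"
  by (intro borel_measurable_power borel_measurable_abs comp_vec_measurable)

lemma E_avg: 
  "expectation (\<lambda>\<omega>. \<Sum>j=1..p. pr (R i \<omega>) j * \<bar>\<xi> i \<omega> j\<bar> ^ q) =
    (\<Sum>j=1..p. expectation (\<lambda>\<omega>. \<bar>\<xi> i \<omega> j\<bar> ^ q) * expectation (\<lambda>\<omega>. pr (R i \<omega>) j))"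
  "integrable M (\<lambda>\<omega>. \<Sum>j=1..p. pr (R i \<omega>) j * \<bar>\<xi> i \<omega> j\<bar> ^ q)"
proof -
  have pb: "\<bar>pr x j\<bar> \<le> 1" if "j \<in> {1..p}" for x j using pr_le_1[OF that, of x] pr_nonneg[of x j] by simp
  have int: "integrable M (\<lambda>\<omega>. pr (R i \<omega>) j * \<bar>\<xi> i \<omega> j\<bar> ^ q)" if j: "j \<in> {1..p}" for j
  proof (rule integrable_bdI[where C="1 * (1 / \<beta>) ^ q"])
    show "(\<lambda>\<omega>. pr (R i \<omega>) j * \<bar>\<xi> i \<omega> j\<bar> ^ q) \<in> borel_measurable M"
      by (intro borel_measurable_times borel_measurable_power borel_measurable_abs xi_comp_measurable i j
          measurable_pr R_measurable)
    show "\<bar>pr (R i \<omega>) j * \<bar>\<xi> i \<omega> j\<bar> ^ q\<bar> \<le> 1 * (1 / \<beta>) ^ q" if "\<omega> \<in> space M" for \<omega>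
      unfolding abs_mult[of "pr (R i \<omega>) j"] by (intro mult_mono pb j xi_abs_bd that) auto
  qed
  then show "integrable M (\<lambda>\<omega>. \<Sum>j=1..p. pr (R i \<omega>) j * \<bar>\<xi> i \<omega> j\<bar> ^ q)" by (rule Bochner_Integration.integrable_sum)
  have "expectation (\<lambda>\<omega>. \<Sum>j=1..p. pr (R i \<omega>) j * \<bar>\<xi> i \<omega> j\<bar> ^ q) =
      (\<Sum>j=1..p. expectation (\<lambda>\<omega>. \<bar>\<xi> i \<omega> j\<bar> ^ q * pr (R i \<omega>) j))"
    using int by (subst Bochner_Integration.integral_sum) (auto simp: mult.commute)
  also have "\<dots> = (\<Sum>j=1..p. expectation (\<lambda>\<omega>. \<bar>\<xi> i \<omega> j\<bar> ^ q) * expectation (\<lambda>\<omega>. pr (R i \<omega>) j))"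
  proof (rule sum.cong[OF refl])
    fix j assume j: "j \<in> {1..p}"
    show "expectation (\<lambda>\<omega>. \<bar>\<xi> i \<omega> j\<bar> ^ q * pr (R i \<omega>) j) =
      expectation (\<lambda>\<omega>. \<bar>\<xi> i \<omega> j\<bar> ^ q) * expectation (\<lambda>\<omega>. pr (R i \<omega>) j)"
      by (rule leave_one_out_expectation[OF i abs_pow_measurable[OF j] pr_loo_measurable[OF j] xi_abs_bd[OF j] pb[OF j]])
  qed
  finally show "expectation (\<lambda>\<omega>. \<Sum>j=1..p. pr (R i \<omega>) j * \<bar>\<xi> i \<omega> j\<bar> ^ q) =
    (\<Sum>j=1..p. expectation (\<lambda>\<omega>. \<bar>\<xi> i \<omega> j\<bar> ^ q) * expectation (\<lambda>\<omega>. pr (R i \<omega>) j))" .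
qed

lemma E_pr_sum: "(\<Sum>j=1..p. expectation (\<lambda>\<omega>. pr (R i \<omega>) j)) = 1" "j \<in> {1..p} \<Longrightarrow> expectation (\<lambda>\<omega>. pr (R i \<omega>) j) \<ge> 0"
proof -
  have pb: "\<bar>pr x j\<bar> \<le> 1" if "j \<in> {1..p}" for x j using pr_le_1[OF that, of x] pr_nonneg[of x j] by simp
  have int: "integrable M (\<lambda>\<omega>. pr (R i \<omega>) j)" if j: "j \<in> {1..p}" for j
    by (rule integrable_bdI[OF measurable_pr pb]) (use j R_measurable i in auto)
  have "(\<Sum>j=1..p. expectation (\<lambda>\<omega>. pr (R i \<omega>) j)) = expectation (\<lambda>\<omega>. \<Sum>j=1..p. pr (R i \<omega>) j)"
    using int by (subst Bochner_Integration.integral_sum) auto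
  then show "(\<Sum>j=1..p. expectation (\<lambda>\<omega>. pr (R i \<omega>) j)) = 1" by (simp add: pr_sum prob_space)
  show "expectation (\<lambda>\<omega>. pr (R i \<omega>) j) \<ge> 0" if "j \<in> {1..p}"
    by (rule Bochner_Integration.integral_nonneg) (rule pr_nonneg)
qed

text \<open>After factorisation by independence the expected weights still form a probability
  vector, so a uniform moment bound passes through the average at no cost in
  \<open>p\<close>.\<close>

lemma E_avg_le:
  assumes "\<And>j. j \<in> {1..p} \<Longrightarrow> expectation (\<lambda>\<omega>. \<bar>\<xi> i \<omega> j\<bar> ^ q) \<le> C"
  shows "expectation (\<lambda>\<omega>. \<Sum>j=1..p. pr (R i \<omega>) j * \<bar>\<xi> i \<omega> j\<bar> ^ q) \<le> C"
proof -
  have "expectation (\<lambda>\<omega>. \<Sum>j=1..p. pr (R i \<omega>) j * \<bar>\<xi> i \<omega> j\<bar> ^ q) \<le> (\<Sum>j=1..p. C * expectation (\<lambda>\<omega>. pr (R i \<omega>) j))"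
    unfolding E_avg by (intro sum_mono mult_right_mono assms E_pr_sum)
  also have "\<dots> = C" unfolding sum_distrib_left[symmetric] E_pr_sum by simp
  finally show ?thesis .
qed

lemma int_abs_pow: "j \<in> {1..p} \<Longrightarrow> integrable M (\<lambda>\<omega>. \<bar>\<xi> i \<omega> j\<bar> ^ q)"
  by (rule integrable_bdI[OF _ xi_abs_bd])
    (auto intro!: borel_measurable_power borel_measurable_abs xi_comp_measurable i)

lemma int_prod: "j \<in> {1..p} \<Longrightarrow> k \<in> {1..p} \<Longrightarrow> integrable M (\<lambda>\<omega>. \<xi> i \<omega> j * \<xi> i \<omega> k)"
proof (rule integrable_bdI[where C="1 / \<beta> * (1 / \<beta>)"])
  assume jk: "j \<in> {1..p}" "k \<in> {1..p}"
  show "(\<lambda>\<omega>. \<xi> i \<omega> j * \<xi> i \<omega> k) \<in> borel_measurable M"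
    by (intro borel_measurable_times xi_comp_measurable i jk)
  show "\<bar>\<xi> i \<omega> j * \<xi> i \<omega> k\<bar> \<le> 1 / \<beta> * (1 / \<beta>)" if "\<omega> \<in> space M" for \<omega>
    unfolding abs_mult using xi_bd[OF i] jk that \<beta> by (intro mult_mono) auto
qed

text \<open>Lyapunov's inequality through means: \<open>3 * l\<^sup>2 * \<bar>\<xi> i \<omega>
  j\<bar> \<le> \<bar>\<xi> i \<omega> j\<bar> ^ 3 + 2 * l ^ 3\<close>, with \<open>l\<close>
  filling the two missing factors. \<open>E_prod_le\<close> fills one factor in the same
  way.\<close>

lemma E_abs_le: assumes j: "j \<in> {1..p}" shows "expectation (\<lambda>\<omega>. \<bar>\<xi> i \<omega> j\<bar> ^ 1) \<le> l"
proof -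
  have "\<bar>\<xi> i \<omega> j\<bar> ^ 1 \<le> (\<bar>\<xi> i \<omega> j\<bar> ^ 3 + 2 * l ^ 3) / (3 * l\<^sup>2)" for \<omega>
    using abs_mult3_le[of "\<xi> i \<omega> j" l l] l by (simp add: abs_mult power2_eq_square pos_le_divide_eq mult_ac)
  then have "expectation (\<lambda>\<omega>. \<bar>\<xi> i \<omega> j\<bar> ^ 1) \<le> expectation (\<lambda>\<omega>. (\<bar>\<xi> i \<omega> j\<bar> ^ 3 + 2 * l ^ 3) / (3 * l\<^sup>2))"
    using int_abs_pow[OF j] by (intro integral_mono) (auto simp del: power_one_right)
  also have "\<dots> = (expectation (\<lambda>\<omega>. \<bar>\<xi> i \<omega> j\<bar> ^ 3) + 2 * l ^ 3) / (3 * l\<^sup>2)"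
    using int_abs_pow[OF j] by (simp add: prob_space)
  also have "\<dots> \<le> (l ^ 3 + 2 * l ^ 3) / (3 * l\<^sup>2)" using m3[OF i j] l by (intro divide_right_mono add_right_mono) auto
  also have "\<dots> = l" using l by (simp add: power2_eq_square power3_eq_cube)
  finally show ?thesis .
qed

lemma E_prod_le: assumes j: "j \<in> {1..p}" and k: "k \<in> {1..p}"
  shows "\<bar>expectation (\<lambda>\<omega>. \<xi> i \<omega> j * \<xi> i \<omega> k)\<bar> \<le> l\<^sup>2"
proof -
  have "\<bar>\<xi> i \<omega> j * \<xi> i \<omega> k\<bar> \<le> (\<bar>\<xi> i \<omega> j\<bar> ^ 3 + \<bar>\<xi> i \<omega> k\<bar> ^ 3 + l ^ 3) / (3 * l)" for \<omega>
    using abs_mult3_le[of "\<xi> i \<omega> j" "\<xi> i \<omega> k" l] l by (simp add: abs_mult pos_le_divide_eq mult_ac)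
  then have "\<bar>expectation (\<lambda>\<omega>. \<xi> i \<omega> j * \<xi> i \<omega> k)\<bar> \<le> expectation (\<lambda>\<omega>. (\<bar>\<xi> i \<omega> j\<bar> ^ 3 + \<bar>\<xi> i \<omega> k\<bar> ^ 3 + l ^ 3) / (3 * l))"
    using int_abs_pow j k by (intro abs_expectation_le int_prod) auto
  also have "\<dots> = (expectation (\<lambda>\<omega>. \<bar>\<xi> i \<omega> j\<bar> ^ 3) + expectation (\<lambda>\<omega>. \<bar>\<xi> i \<omega> k\<bar> ^ 3) + l ^ 3) / (3 * l)"
    using int_abs_pow j k by (simp add: prob_space)
  also have "\<dots> \<le> (l ^ 3 + l ^ 3 + l ^ 3) / (3 * l)" using m3[OF i j] m3[OF i k] l by (intro divide_right_mono add_mono) auto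
  also have "\<dots> = l\<^sup>2" using l by (simp add: power2_eq_square power3_eq_cube)
  finally show ?thesis .
qed

text \<open>A chain of comparisons. \<open>A - B - c * C\<close> is a Taylor remainder around
  \<open>R i\<close>; \<open>B\<close> has small expectation, as the nearly centred
  \<open>\<xi> i\<close> is independent of \<open>R i\<close>; \<open>C\<close> and \<open>D\<close>
  have the same expectation by independence; \<open>E\<close> moves the argument of
  \<open>hess\<close> from \<open>R i\<close> back to \<open>Z\<close>, and \<open>F\<close>
  replaces the moments by \<open>Sig / n\<close>, after which the main term is the same for every
  \<open>i\<close>. The two moves between \<open>R i\<close> and \<open>Z\<close> cost
  \<open>30 * exp 6\<close> each, whence 60.\<close>

lemma one_summand_bound:
  "\<bar>expectation (\<lambda>\<omega>. \<Sum>j=1..p. \<xi> i \<omega> j * grad (Z \<omega>) j) - c * expectation (\<lambda>\<omega>. \<Sum>j=1..p. \<Sum>k=1..p. Sig j k / real n * hess (Z \<omega>) j k)\<bar>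
    \<le> \<alpha> * \<beta> * \<mu> + 60 * exp 6 * \<alpha> * \<beta> ^ 3 * l ^ 3 + 3 * \<alpha> * \<beta>\<^sup>2 * (\<Delta> / real n)"
proof -
  define m where "m = (\<lambda>j k. expectation (\<lambda>\<omega>. \<xi> i \<omega> j * \<xi> i \<omega> k))"
  define A where "A = (\<lambda>\<omega>. \<Sum>j=1..p. \<xi> i \<omega> j * grad (Z \<omega>) j)"
  define B where "B = (\<lambda>\<omega>. \<Sum>j=1..p. \<xi> i \<omega> j * grad (R i \<omega>) j)"
  define C where "C = (\<lambda>\<omega>. \<Sum>j=1..p. \<Sum>k=1..p. \<xi> i \<omega> j * \<xi> i \<omega> k * hess (R i \<omega>) j k)"
  define D where "D = (\<lambda>\<omega>. \<Sum>j=1..p. \<Sum>k=1..p. m j k * hess (R i \<omega>) j k)"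
  define E where "E = (\<lambda>\<omega>. \<Sum>j=1..p. \<Sum>k=1..p. m j k * hess (Z \<omega>) j k)"
  define F where "F = (\<lambda>\<omega>. \<Sum>j=1..p. \<Sum>k=1..p. Sig j k / real n * hess (Z \<omega>) j k)"
  have mR: "(\<lambda>\<omega>. grad (R i \<omega>) j) \<in> borel_measurable M" "(\<lambda>\<omega>. hess (R i \<omega>) j k) \<in> borel_measurable M"
    "(\<lambda>\<omega>. grad (Z \<omega>) j) \<in> borel_measurable M" "(\<lambda>\<omega>. hess (Z \<omega>) j k) \<in> borel_measurable M"
    if "j \<in> {1..p}" "k \<in> {1..p}" for j k
    using that by (auto intro!: measurable_grad measurable_hess R_measurable Z_measurable i)
  have ih: "integrable M (\<lambda>\<omega>. hess (R i \<omega>) j k)" "integrable M (\<lambda>\<omega>. hess (Z \<omega>) j k)"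
    if "j \<in> {1..p}" "k \<in> {1..p}" for j k
    using mR[OF that] hess_bd[OF that] by (auto intro: integrable_bdI)
  have ig0: "integrable M (\<lambda>\<omega>. grad (R i \<omega>) j)" if "j \<in> {1..p}" for j
    using mR[OF that that] grad_bd[OF that] by (auto intro: integrable_bdI)
  have ig: "integrable M (\<lambda>\<omega>. \<xi> i \<omega> j * grad (R i \<omega>) j)" "integrable M (\<lambda>\<omega>. \<xi> i \<omega> j * grad (Z \<omega>) j)"
    if j: "j \<in> {1..p}" for j
  proof -
    have "\<bar>\<xi> i \<omega> j * grad x j\<bar> \<le> 1 / \<beta> * (\<alpha> * \<beta>)" if "\<omega> \<in> space M" for \<omega> x
      unfolding abs_mult using xi_bd[OF i j that] grad_bd[OF j] \<beta> by (intro mult_mono) auto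
    then show "integrable M (\<lambda>\<omega>. \<xi> i \<omega> j * grad (R i \<omega>) j)" "integrable M (\<lambda>\<omega>. \<xi> i \<omega> j * grad (Z \<omega>) j)"
      using mR[OF j j] xi_comp_measurable[OF i j] by (auto intro!: integrable_bdI borel_measurable_times)
  qed
  have ixh: "integrable M (\<lambda>\<omega>. \<xi> i \<omega> j * \<xi> i \<omega> k * hess (R i \<omega>) j k)" if jk: "j \<in> {1..p}" "k \<in> {1..p}" for j k
  proof -
    have "\<bar>\<xi> i \<omega> j * \<xi> i \<omega> k * hess x j k\<bar> \<le> 1 / \<beta> * (1 / \<beta>) * (3 * (\<alpha> * \<beta>\<^sup>2))" if "\<omega> \<in> space M" for \<omega> x
      unfolding abs_mult using xi_bd[OF i jk(1) that] xi_bd[OF i jk(2) that] hess_bd[OF jk, of x] \<beta>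
      by (intro mult_mono mult_nonneg_nonneg) auto
    then show ?thesis
      using mR[OF jk] xi_comp_measurable[OF i] jk by (auto intro!: integrable_bdI borel_measurable_times)
  qed
  have int: "integrable M A" "integrable M B" "integrable M C" "integrable M D" "integrable M E" "integrable M F"
    unfolding A_def B_def C_def D_def E_def F_def
    by (intro Bochner_Integration.integrable_sum integrable_mult_right ig ixh ih; assumption)+
  have s1: "\<bar>expectation (\<lambda>\<omega>. A \<omega> - B \<omega> - c * C \<omega>)\<bar> \<le> 30 * exp 6 * \<alpha> * \<beta> ^ 3 * l ^ 3"
  proof -
    have "\<bar>expectation (\<lambda>\<omega>. A \<omega> - B \<omega> - c * C \<omega>)\<bar> \<le>
        expectation (\<lambda>\<omega>. 30 * exp 6 * \<alpha> * \<beta> ^ 3 * (\<Sum>j=1..p. pr (R i \<omega>) j * \<bar>\<xi> i \<omega> j\<bar> ^ 3))"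
    proof (rule abs_expectation_le)
      show "\<bar>A \<omega> - B \<omega> - c * C \<omega>\<bar> \<le> 30 * exp 6 * \<alpha> * \<beta> ^ 3 * (\<Sum>j=1..p. pr (R i \<omega>) j * \<bar>\<xi> i \<omega> j\<bar> ^ 3)"
        if "\<omega> \<in> space M" for \<omega>
        unfolding A_def B_def C_def Z_eq[OF i] avg3_def[symmetric]
        by (rule grad_taylor[OF c]) (use bd[OF i _ that] in auto)
    qed (use int E_avg(2) in auto)
    also have "\<dots> = 30 * exp 6 * \<alpha> * \<beta> ^ 3 * expectation (\<lambda>\<omega>. \<Sum>j=1..p. pr (R i \<omega>) j * \<bar>\<xi> i \<omega> j\<bar> ^ 3)" by simp
    also have "\<dots> \<le> 30 * exp 6 * \<alpha> * \<beta> ^ 3 * l ^ 3"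
      by (intro mult_left_mono E_avg_le m3 i) (use \<alpha> \<beta> in auto)
    finally show ?thesis .
  qed
  have s2: "\<bar>expectation B\<bar> \<le> \<alpha> * \<beta> * \<mu>"
  proof -
    have "expectation B = (\<Sum>j=1..p. expectation (\<lambda>\<omega>. \<xi> i \<omega> j) * expectation (\<lambda>\<omega>. grad (R i \<omega>) j))"
      unfolding B_def using ig E_xi_grad by (subst Bochner_Integration.integral_sum) auto
    \<comment> \<open>Reassembled under one expectation, the gradient bounds carry the weights
      \<open>pr\<close>, which sum to 1; the bias is thus counted once and not \<open>p\<close>
      times.\<close>
    also have "\<dots> = expectation (\<lambda>\<omega>. \<Sum>j=1..p. expectation (\<lambda>\<omega>. \<xi> i \<omega> j) * grad (R i \<omega>) j)"
      using ig0 by (subst Bochner_Integration.integral_sum) auto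
    also have "\<bar>\<dots>\<bar> \<le> \<alpha> * \<beta> * \<mu>"
    proof (rule abs_expectation_le_const)
      show "integrable M (\<lambda>\<omega>. \<Sum>j=1..p. expectation (\<lambda>\<omega>. \<xi> i \<omega> j) * grad (R i \<omega>) j)"
        by (intro Bochner_Integration.integrable_sum integrable_mult_right ig0)
      fix \<omega>
      have "\<bar>\<Sum>j=1..p. expectation (\<lambda>\<omega>. \<xi> i \<omega> j) * grad (R i \<omega>) j\<bar> \<le>
          (\<Sum>j=1..p. \<bar>expectation (\<lambda>\<omega>. \<xi> i \<omega> j) * grad (R i \<omega>) j\<bar>)" by (rule sum_abs)
      also have "\<dots> \<le> (\<Sum>j=1..p. \<mu> * (\<alpha> * \<beta> * pr (R i \<omega>) j))"
        unfolding abs_mult using m1[OF i] abs_grad_le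
        by (intro sum_mono mult_mono) (auto intro: order_trans[OF abs_ge_zero])
      also have "\<dots> = \<alpha> * \<beta> * \<mu> * (\<Sum>j=1..p. pr (R i \<omega>) j)" by (simp only: sum_distrib_left mult_ac)
      finally show "\<bar>\<Sum>j=1..p. expectation (\<lambda>\<omega>. \<xi> i \<omega> j) * grad (R i \<omega>) j\<bar> \<le> \<alpha> * \<beta> * \<mu>" unfolding pr_sum by simp
    qed
    finally show ?thesis .
  qed
  have s3: "expectation C = expectation D"
  proof -
    have "expectation C = (\<Sum>j=1..p. \<Sum>k=1..p. expectation (\<lambda>\<omega>. \<xi> i \<omega> j * \<xi> i \<omega> k * hess (R i \<omega>) j k))"
      unfolding C_def by (rule integral_sum2) (rule ixh)
    also have "\<dots> = (\<Sum>j=1..p. \<Sum>k=1..p. m j k * expectation (\<lambda>\<omega>. hess (R i \<omega>) j k))"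
      unfolding m_def using E_xi_hess by (intro sum.cong refl) auto
    also have "\<dots> = expectation D"
      unfolding D_def using ih by (subst integral_sum2) auto
    finally show ?thesis .
  qed
  have s4: "\<bar>expectation (\<lambda>\<omega>. D \<omega> - E \<omega>)\<bar> \<le> 30 * exp 6 * \<alpha> * \<beta> ^ 3 * l ^ 3"
  proof -
    have "\<bar>expectation (\<lambda>\<omega>. D \<omega> - E \<omega>)\<bar> \<le>
        expectation (\<lambda>\<omega>. 30 * exp 6 * \<alpha> * \<beta> ^ 3 * l\<^sup>2 * (\<Sum>j=1..p. pr (R i \<omega>) j * \<bar>\<xi> i \<omega> j\<bar> ^ 1))"
    proof (rule abs_expectation_le)
      fix \<omega> assume w: "\<omega> \<in> space M"
      have "\<bar>D \<omega> - E \<omega>\<bar> = \<bar>\<Sum>j=1..p. \<Sum>k=1..p. m j k * (hess (Z \<omega>) j k - hess (R i \<omega>) j k)\<bar>"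
        unfolding D_def E_def abs_minus_commute[of "\<Sum>j=1..p. \<Sum>k=1..p. m j k * hess (R i \<omega>) j k"]
        by (simp only: sum_subtractf right_diff_distrib)
      also have "\<dots> \<le> (\<Sum>j=1..p. \<Sum>k=1..p. \<bar>m j k * (hess (Z \<omega>) j k - hess (R i \<omega>) j k)\<bar>)"
        by (rule order_trans[OF sum_abs], rule sum_mono, rule sum_abs)
      also have "\<dots> \<le> (\<Sum>j=1..p. \<Sum>k=1..p. \<bar>m j k\<bar> * (6 * exp 6 * \<alpha> * \<beta> ^ 3 * U (R i \<omega>) j k (\<xi> i \<omega>)))"
      proof (intro sum_mono)
        fix j k assume jk: "j \<in> {1..p}" "k \<in> {1..p}"
        have "\<bar>hess (Z \<omega>) j k - hess (R i \<omega>) j k\<bar> \<le> 6 * exp 6 * \<alpha> * \<beta> ^ 3 * U (R i \<omega>) j k (\<xi> i \<omega>)"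
          unfolding Z_eq[OF i] by (rule hess_diff_le[OF c _ jk]) (use bd[OF i _ w] in auto)
        then show "\<bar>m j k * (hess (Z \<omega>) j k - hess (R i \<omega>) j k)\<bar> \<le> \<bar>m j k\<bar> * (6 * exp 6 * \<alpha> * \<beta> ^ 3 * U (R i \<omega>) j k (\<xi> i \<omega>))"
          unfolding abs_mult[of "m j k"] by (rule mult_left_mono) simp
      qed
      also have "\<dots> = 6 * exp 6 * \<alpha> * \<beta> ^ 3 * (\<Sum>j=1..p. \<Sum>k=1..p. \<bar>m j k\<bar> * U (R i \<omega>) j k (\<xi> i \<omega>))"
        by (simp add: sum_distrib_left mult_ac)
      also have "\<dots> \<le> 6 * exp 6 * \<alpha> * \<beta> ^ 3 * (5 * l\<^sup>2 * avg (R i \<omega>) (\<xi> i \<omega>))"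
        unfolding m_def by (intro mult_left_mono sum_U_le E_prod_le) (use \<alpha> \<beta> in auto)
      finally show "\<bar>D \<omega> - E \<omega>\<bar> \<le> 30 * exp 6 * \<alpha> * \<beta> ^ 3 * l\<^sup>2 * (\<Sum>j=1..p. pr (R i \<omega>) j * \<bar>\<xi> i \<omega> j\<bar> ^ 1)"
        by (simp add: avg_def)
    qed (use int E_avg(2)[of 1] in auto)
    also have "\<dots> = 30 * exp 6 * \<alpha> * \<beta> ^ 3 * l\<^sup>2 * expectation (\<lambda>\<omega>. \<Sum>j=1..p. pr (R i \<omega>) j * \<bar>\<xi> i \<omega> j\<bar> ^ 1)"
      by (rule integral_mult_right_zero)
    also have "\<dots> \<le> 30 * exp 6 * \<alpha> * \<beta> ^ 3 * l\<^sup>2 * l"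
      by (intro mult_left_mono E_avg_le E_abs_le) (use \<alpha> \<beta> in auto)
    finally show ?thesis by (simp add: power2_eq_square power3_eq_cube mult_ac)
  qed
  have s5: "\<bar>expectation (\<lambda>\<omega>. E \<omega> - F \<omega>)\<bar> \<le> 3 * \<alpha> * \<beta>\<^sup>2 * (\<Delta> / real n)"
  proof (rule abs_expectation_le_const)
    show "integrable M (\<lambda>\<omega>. E \<omega> - F \<omega>)" using int by auto
    fix \<omega>
    have "E \<omega> - F \<omega> = (\<Sum>j=1..p. \<Sum>k=1..p. (m j k - Sig j k / real n) * hess (Z \<omega>) j k)"
      unfolding E_def F_def by (simp only: sum_subtractf left_diff_distrib)
    then show "\<bar>E \<omega> - F \<omega>\<bar> \<le> 3 * \<alpha> * \<beta>\<^sup>2 * (\<Delta> / real n)"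
      unfolding m_def using sum_hess_le[OF m2[OF i]] by simp
  qed
  have e1: "expectation (\<lambda>\<omega>. A \<omega> - B \<omega> - c * C \<omega>) = expectation A - expectation B - c * expectation C"
    using int by simp
  have e2: "expectation (\<lambda>\<omega>. D \<omega> - E \<omega>) = expectation D - expectation E"
    "expectation (\<lambda>\<omega>. E \<omega> - F \<omega>) = expectation E - expectation F" using int by simp_all
  have cc: "\<bar>c * X\<bar> \<le> \<bar>X\<bar>" for X unfolding abs_mult using c mult_right_mono[of c 1 "\<bar>X\<bar>"] by simp
  have "expectation A - c * expectation F = (expectation A - expectation B - c * expectation C) + expectation B +
     c * (expectation D - expectation E) + c * (expectation E - expectation F)"
    using s3 by (simp add: algebra_simps)
  then have "\<bar>expectation A - c * expectation F\<bar> \<le> 30 * exp 6 * \<alpha> * \<beta> ^ 3 * l ^ 3 + \<alpha> * \<beta> * \<mu> +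
      30 * exp 6 * \<alpha> * \<beta> ^ 3 * l ^ 3 + 3 * \<alpha> * \<beta>\<^sup>2 * (\<Delta> / real n)"
    using s1 s2 s4 s5 cc[of "expectation D - expectation E"] cc[of "expectation E - expectation F"]
    unfolding e1 e2 by linarith
  then show ?thesis unfolding A_def F_def by linarith
qed

end

theorem sum_grad_bound:
  "\<bar>expectation (\<lambda>\<omega>. \<Sum>j=1..p. S \<omega> j * grad (Z \<omega>) j) - c * expectation (\<lambda>\<omega>. \<Sum>j=1..p. \<Sum>k=1..p. Sig j k * hess (Z \<omega>) j k)\<bar>
    \<le> real n * (\<alpha> * \<beta> * \<mu>) + 60 * exp 6 * \<alpha> * \<beta> ^ 3 * (real n * l ^ 3) + 3 * \<alpha> * \<beta>\<^sup>2 * \<Delta>"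
proof -
  let ?T = "\<lambda>i. expectation (\<lambda>\<omega>. \<Sum>j=1..p. \<xi> i \<omega> j * grad (Z \<omega>) j)"
  let ?H = "expectation (\<lambda>\<omega>. \<Sum>j=1..p. \<Sum>k=1..p. Sig j k / real n * hess (Z \<omega>) j k)"
  let ?b = "\<alpha> * \<beta> * \<mu> + 60 * exp 6 * \<alpha> * \<beta> ^ 3 * l ^ 3 + 3 * \<alpha> * \<beta>\<^sup>2 * (\<Delta> / real n)"
  have int: "integrable M (\<lambda>\<omega>. \<Sum>j=1..p. \<xi> i \<omega> j * grad (Z \<omega>) j)" if i: "i \<in> {1..n}" for i
  proof (intro Bochner_Integration.integrable_sum integrable_bdI)
    fix j assume j: "j \<in> {1..p}"
    show "(\<lambda>\<omega>. \<xi> i \<omega> j * grad (Z \<omega>) j) \<in> borel_measurable M"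
      by (intro borel_measurable_times xi_comp_measurable measurable_grad Z_measurable i j)
    show "\<bar>\<xi> i \<omega> j * grad (Z \<omega>) j\<bar> \<le> 1 / \<beta> * (\<alpha> * \<beta>)" if "\<omega> \<in> space M" for \<omega>
      unfolding abs_mult using xi_bd[OF i j that] grad_bd[OF j] \<beta> by (intro mult_mono) auto
  qed
  have "(\<Sum>j=1..p. S \<omega> j * grad (Z \<omega>) j) = (\<Sum>i=1..n. \<Sum>j=1..p. \<xi> i \<omega> j * grad (Z \<omega>) j)" for \<omega>
    unfolding S_def sum_distrib_right by (rule sum.swap)
  then have 1: "expectation (\<lambda>\<omega>. \<Sum>j=1..p. S \<omega> j * grad (Z \<omega>) j) = (\<Sum>i=1..n. ?T i)"
    using int by (simp add: Bochner_Integration.integral_sum)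
  have "(\<Sum>j=1..p. \<Sum>k=1..p. Sig j k * hess (Z \<omega>) j k) = real n * (\<Sum>j=1..p. \<Sum>k=1..p. Sig j k / real n * hess (Z \<omega>) j k)" for \<omega>
    using n by (simp add: sum_distrib_left)
  then have 2: "expectation (\<lambda>\<omega>. \<Sum>j=1..p. \<Sum>k=1..p. Sig j k * hess (Z \<omega>) j k) = real n * ?H"
    by (simp only: integral_mult_right_zero)
  have "\<bar>(\<Sum>i=1..n. ?T i) - c * (real n * ?H)\<bar> = \<bar>\<Sum>i=1..n. (?T i - c * ?H)\<bar>"
    by (simp add: sum_subtractf mult_ac)
  also have "\<dots> \<le> (\<Sum>i=1..n. \<bar>?T i - c * ?H\<bar>)" by (rule sum_abs)
  also have "\<dots> \<le> (\<Sum>i=1..n. ?b)" by (intro sum_mono one_summand_bound)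
  also have "\<dots> = real n * ?b" by simp
  also have "\<dots> = real n * (\<alpha> * \<beta> * \<mu>) + 60 * exp 6 * \<alpha> * \<beta> ^ 3 * (real n * l ^ 3) + 3 * \<alpha> * \<beta>\<^sup>2 * \<Delta>"
    using n by (simp add: distrib_left mult_ac)
  finally show ?thesis unfolding 1 2 .
qed

end

end

section \<open>Interpolation\<close>

text \<open>Difference quotients are bounded by \<open>B\<close> through the mean value inequality,
  so dominated convergence applies along every sequence of increments tending to 0.\<close>

lemma has_real_derivative_integral:
  fixes g g' :: "real \<Rightarrow> 'a \<Rightarrow> real"
  assumes int: "\<And>s. integrable M (g s)" and B: "integrable M B" and m: "\<And>s. g' s \<in> borel_measurable M"
    and der: "\<And>s \<omega>. \<omega> \<in> space M \<Longrightarrow> ((\<lambda>s. g s \<omega>) has_real_derivative g' s \<omega>) (at s)"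
    and bd: "\<And>s \<omega>. \<omega> \<in> space M \<Longrightarrow> \<bar>g' s \<omega>\<bar> \<le> B \<omega>"
  shows "((\<lambda>s. LINT \<omega>|M. g s \<omega>) has_real_derivative (LINT \<omega>|M. g' s \<omega>)) (at s)"
  unfolding DERIV_def tendsto_at_iff_sequentially comp_def
proof (intro allI impI)
  fix h :: "nat \<Rightarrow> real" assume h0: "\<forall>i. h i \<in> UNIV - {0}" and h: "h \<longlonglongrightarrow> 0"
  have "(\<lambda>i. LINT \<omega>|M. (g (s + h i) \<omega> - g s \<omega>) / h i) \<longlonglongrightarrow> (LINT \<omega>|M. g' s \<omega>)"
  proof (rule integral_dominated_convergence[OF m _ B])
    show "(\<lambda>\<omega>. (g (s + h i) \<omega> - g s \<omega>) / h i) \<in> borel_measurable M" for i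
      using int[THEN borel_measurable_integrable] by measurable
    show "AE \<omega> in M. (\<lambda>i. (g (s + h i) \<omega> - g s \<omega>) / h i) \<longlonglongrightarrow> g' s \<omega>"
    proof (rule AE_I2)
      fix \<omega> assume "\<omega> \<in> space M"
      from der[OF this, of s] show "(\<lambda>i. (g (s + h i) \<omega> - g s \<omega>) / h i) \<longlonglongrightarrow> g' s \<omega>"
        unfolding DERIV_def tendsto_at_iff_sequentially comp_def using h0 h by blast
    qed
    show "AE \<omega> in M. norm ((g (s + h i) \<omega> - g s \<omega>) / h i) \<le> B \<omega>" for i
    proof (rule AE_I2)
      fix \<omega> assume w: "\<omega> \<in> space M"
      have "norm (g (s + h i) \<omega> - g s \<omega>) \<le> B \<omega> * norm (s + h i - s)"
        by (rule field_differentiable_bound[of UNIV]) (use der[OF w] bd[OF w] in auto)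
      then show "norm ((g (s + h i) \<omega> - g s \<omega>) / h i) \<le> B \<omega>"
        using h0 by (simp add: divide_le_eq)
    qed
  qed
  then show "(\<lambda>i. ((LINT \<omega>|M. g (s + h i) \<omega>) - (LINT \<omega>|M. g s \<omega>)) / h i) \<longlonglongrightarrow> (LINT \<omega>|M. g' s \<omega>)"
    using int by simp
qed

text \<open>\<open>Sig\<close> is both the target of the second moment condition and the covariance
  of \<open>Y\<close>, which is what makes the second-order terms cancel. Positive variances permit
  the regression on a coordinate behind Stein's identity.\<close>

locale gauss_approx = bounded_sum p \<beta> \<alpha> \<tau> M n \<xi> Sig l \<mu> \<Delta> + G: gaussian_centered N p Y
  for p :: nat and \<beta> \<alpha> \<tau> :: real and M :: "'a measure" and n :: nat and \<xi> :: "nat \<Rightarrow> 'a \<Rightarrow> nat \<Rightarrow> real"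
    and Sig :: "nat \<Rightarrow> nat \<Rightarrow> real" and l \<mu> \<Delta> :: real and N :: "'b measure" and Y :: "'b \<Rightarrow> nat \<Rightarrow> real" +
  assumes cov_eq: "\<And>j k. j \<in> {1..p} \<Longrightarrow> k \<in> {1..p} \<Longrightarrow> G.cov j k = Sig j k"
    and var_pos: "\<And>j. j \<in> {1..p} \<Longrightarrow> G.cov j j > 0"
begin

interpretation MN: pair_prob_space M N ..

definition "Err = real n * (\<alpha> * \<beta> * \<mu>) + 60 * exp 6 * \<alpha> * \<beta> ^ 3 * (real n * l ^ 3) + 3 * \<alpha> * \<beta>\<^sup>2 * \<Delta>"

text \<open>The path runs from \<open>Y\<close> at \<open>s = 0\<close> to \<open>S\<close> at
  \<open>s = pi / 2\<close>. With sine and cosine weights the second-order terms of both sides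
  appear with the same factor \<open>sin s * cos s\<close>, and the path derivative stays bounded up
  to the end points, unlike with square root weights.\<close>

definition W :: "real \<Rightarrow> 'a \<times> 'b \<Rightarrow> nat \<Rightarrow> real" where
  "W s x = (\<lambda>j. sin s * S (fst x) j + cos s * Y (snd x) j)"

lemma fst_S_measurable: "j \<in> {1..p} \<Longrightarrow> (\<lambda>x. S (fst x) j) \<in> borel_measurable (M \<Otimes>\<^sub>M N)"
  by (rule measurable_compose[OF measurable_fst S_measurable])

lemma snd_Y_measurable: "j \<in> {1..p} \<Longrightarrow> (\<lambda>x. Y (snd x) j) \<in> borel_measurable (M \<Otimes>\<^sub>M N)"
  by (rule measurable_compose[OF measurable_snd G.comp_measurable])

lemma W_measurable: "j \<in> {1..p} \<Longrightarrow> (\<lambda>x. W s x j) \<in> borel_measurable (M \<Otimes>\<^sub>M N)"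
  unfolding W_def
  by (intro borel_measurable_add borel_measurable_times borel_measurable_const fst_S_measurable snd_Y_measurable)

lemma int_Y: "j \<in> {1..p} \<Longrightarrow> integrable (M \<Otimes>\<^sub>M N) (\<lambda>x. \<bar>Y (snd x) j\<bar>)"
  by (rule MN.Fubini_integrable)
    (use G.integrable_coord snd_Y_measurable in \<open>auto intro!: borel_measurable_abs\<close>)

text \<open>\<open>S\<close> is bounded and \<open>Y\<close> integrable, so this is an integrable
  majorant of the path derivative, uniform in \<open>s\<close>; it justifies differentiation under
  the integral.\<close>

definition "bnd x = \<alpha> * \<beta> * (\<Sum>j=1..p. real n / \<beta> + \<bar>Y (snd x) j\<bar>)"

lemma int_bnd: "integrable (M \<Otimes>\<^sub>M N) bnd"
  unfolding bnd_def[abs_def]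
  by (intro integrable_mult_right Bochner_Integration.integrable_sum Bochner_Integration.integrable_add int_Y MN.integrable_const)

lemma grad_lincomb_bd:
  assumes "x \<in> space (M \<Otimes>\<^sub>M N)" "\<bar>a\<bar> \<le> 1" "\<bar>b\<bar> \<le> 1"
  shows "\<bar>\<Sum>j=1..p. (a * S (fst x) j + b * Y (snd x) j) * grad z j\<bar> \<le> bnd x"
proof -
  have "\<bar>(a * S (fst x) j + b * Y (snd x) j) * grad z j\<bar> \<le> (real n / \<beta> + \<bar>Y (snd x) j\<bar>) * (\<alpha> * \<beta>)"
    if j: "j \<in> {1..p}" for j
  proof -
    have "fst x \<in> space M" using assms(1) by (auto simp: space_pair_measure)
    then have "\<bar>a\<bar> * \<bar>S (fst x) j\<bar> \<le> 1 * (real n / \<beta>)" using S_bd[OF j] assms(2) by (intro mult_mono) auto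
    moreover have "\<bar>b\<bar> * \<bar>Y (snd x) j\<bar> \<le> 1 * \<bar>Y (snd x) j\<bar>" using assms(3) by (intro mult_right_mono) auto
    ultimately have "\<bar>a * S (fst x) j + b * Y (snd x) j\<bar> \<le> real n / \<beta> + \<bar>Y (snd x) j\<bar>"
      using abs_triangle_ineq[of "a * S (fst x) j" "b * Y (snd x) j"] unfolding abs_mult by linarith
    then show ?thesis unfolding abs_mult[of "_ + _"] using grad_bd[OF j] \<beta> by (intro mult_mono) auto
  qed
  then have "(\<Sum>j=1..p. \<bar>(a * S (fst x) j + b * Y (snd x) j) * grad z j\<bar>) \<le> (\<Sum>j=1..p. (real n / \<beta> + \<bar>Y (snd x) j\<bar>) * (\<alpha> * \<beta>))"
    by (rule sum_mono)
  also have "\<dots> = bnd x" unfolding bnd_def sum_distrib_right[symmetric] by simp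
  finally show ?thesis by (rule order_trans[OF sum_abs])
qed

lemma grad_lincomb_measurable:
  "(\<lambda>x. \<Sum>j=1..p. (a * S (fst x) j + b * Y (snd x) j) * grad (W s x) j) \<in> borel_measurable (M \<Otimes>\<^sub>M N)"
  by (intro borel_measurable_sum borel_measurable_times borel_measurable_add borel_measurable_const
      fst_S_measurable snd_Y_measurable measurable_grad W_measurable)

lemma int_grad_lincomb:
  assumes "\<bar>a\<bar> \<le> 1" "\<bar>b\<bar> \<le> 1"
  shows "integrable (M \<Otimes>\<^sub>M N) (\<lambda>x. \<Sum>j=1..p. (a * S (fst x) j + b * Y (snd x) j) * grad (W s x) j)"
  by (rule Bochner_Integration.integrable_bound[OF int_bnd grad_lincomb_measurable], rule AE_I2)
    (use grad_lincomb_bd assms in \<open>auto intro: order_trans[OF _ abs_ge_self]\<close>)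

definition "HH s x = (\<Sum>j=1..p. \<Sum>k=1..p. Sig j k * hess (W s x) j k)"

lemma int_hess: "j \<in> {1..p} \<Longrightarrow> k \<in> {1..p} \<Longrightarrow> integrable (M \<Otimes>\<^sub>M N) (\<lambda>x. hess (W s x) j k)"
  by (rule MN.integrable_const_bound[where B="3 * (\<alpha> * \<beta>\<^sup>2)"])
    (use hess_bd in \<open>auto intro!: measurable_hess W_measurable\<close>)

lemma int_HH: "integrable (M \<Otimes>\<^sub>M N) (HH s)"
  unfolding HH_def[abs_def] by (intro Bochner_Integration.integrable_sum integrable_mult_right int_hess)

text \<open>For each fixed Gaussian point this is \<open>sum_grad_bound\<close> with
  \<open>y\<close> equal to \<open>cos s * Y\<close>; the bound is uniform in that point and
  survives the outer integral.\<close>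

lemma S_part:
  assumes s: "0 \<le> s" "s \<le> pi / 2"
  shows "\<bar>(LINT x|(M \<Otimes>\<^sub>M N). (\<Sum>j=1..p. S (fst x) j * grad (W s x) j)) - sin s * (LINT x|(M \<Otimes>\<^sub>M N). HH s x)\<bar> \<le> Err"
proof -
  have sn: "0 \<le> sin s" "sin s \<le> 1" using s by (auto intro: sin_ge_zero)
  let ?g = "\<lambda>x. \<Sum>j=1..p. S (fst x) j * grad (W s x) j"
  have ig: "integrable (M \<Otimes>\<^sub>M N) ?g" using int_grad_lincomb[of 1 0 s] by simp
  let ?h = "\<lambda>\<omega> \<omega>'. ?g (\<omega>, \<omega>') - sin s * HH s (\<omega>, \<omega>')"
  have cp: "case_prod ?h = (\<lambda>x. ?g x - sin s * HH s x)" by auto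
  have ih: "integrable (M \<Otimes>\<^sub>M N) (case_prod ?h)"
    unfolding cp using ig int_HH by (intro Bochner_Integration.integrable_diff integrable_mult_right)
  have Zeq: "Z (sin s) (\<lambda>j. cos s * Y \<omega>' j) \<omega> = W s (\<omega>, \<omega>')" for \<omega> \<omega>'
    unfolding Z_def[OF sn] W_def by simp
  have inner: "\<bar>expectation (\<lambda>\<omega>. ?h \<omega> \<omega>')\<bar> \<le> Err" if w': "\<omega>' \<in> space N" for \<omega>'
  proof -
    have mw: "(\<lambda>\<omega>. W s (\<omega>, \<omega>') j) \<in> borel_measurable M" if "j \<in> {1..p}" for j
      unfolding Zeq[symmetric] by (rule Z_measurable[OF sn that])
    have i1: "integrable M (\<lambda>\<omega>. ?g (\<omega>, \<omega>'))"
    proof (intro Bochner_Integration.integrable_sum)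
      fix j assume j: "j \<in> {1..p}"
      have "\<bar>S \<omega> j * grad x j\<bar> \<le> real n / \<beta> * (\<alpha> * \<beta>)" if "\<omega> \<in> space M" for \<omega> x
        unfolding abs_mult using S_bd[OF j that] grad_bd[OF j] \<beta> by (intro mult_mono) auto
      then show "integrable M (\<lambda>\<omega>. S (fst (\<omega>, \<omega>')) j * grad (W s (\<omega>, \<omega>')) j)"
        using S_measurable[OF j] measurable_grad[OF mw j] by (auto intro!: integrable_bdI borel_measurable_times)
    qed
    have i2: "integrable M (\<lambda>\<omega>. HH s (\<omega>, \<omega>'))"
      unfolding HH_def
      by (intro Bochner_Integration.integrable_sum integrable_mult_right integrable_bdI[OF measurable_hess hess_bd] mw)
    have "expectation (\<lambda>\<omega>. ?h \<omega> \<omega>') = expectation (\<lambda>\<omega>. ?g (\<omega>, \<omega>')) - sin s * expectation (\<lambda>\<omega>. HH s (\<omega>, \<omega>'))"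
      using i1 i2 by simp
    then show ?thesis
      using sum_grad_bound[OF sn, of "\<lambda>j. cos s * Y \<omega>' j"] unfolding Zeq HH_def Err_def by simp
  qed
  have "(LINT x|(M \<Otimes>\<^sub>M N). ?g x) - sin s * (LINT x|(M \<Otimes>\<^sub>M N). HH s x) = (LINT x|(M \<Otimes>\<^sub>M N). case_prod ?h x)"
    unfolding cp using ig int_HH by simp
  also have "\<dots> = (LINT \<omega>'|N. LINT \<omega>|M. ?h \<omega> \<omega>')" by (rule MN.integral_snd[OF ih, symmetric])
  finally have eq: "(LINT x|(M \<Otimes>\<^sub>M N). ?g x) - sin s * (LINT x|(M \<Otimes>\<^sub>M N). HH s x) = (LINT \<omega>'|N. LINT \<omega>|M. ?h \<omega> \<omega>')" .
  show ?thesis unfolding eq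
    by (rule G.abs_expectation_le_const[OF MN.integrable_snd[OF ih] inner])
qed

text \<open>With the point of \<open>M\<close> fixed, Stein's identity applies to the gradient as a
  function of the Gaussian vector; the chain rule produces the factor \<open>cos s\<close>. On this
  side there is no error term.\<close>

lemma Y_part: "(LINT x|(M \<Otimes>\<^sub>M N). (\<Sum>j=1..p. Y (snd x) j * grad (W s x) j)) = cos s * (LINT x|(M \<Otimes>\<^sub>M N). HH s x)"
proof -
  let ?g = "\<lambda>x. \<Sum>j=1..p. Y (snd x) j * grad (W s x) j"
  have ig: "integrable (M \<Otimes>\<^sub>M N) ?g" using int_grad_lincomb[of 0 1 s] by simp
  have inner: "G.expectation (\<lambda>\<omega>'. ?g (\<omega>, \<omega>')) = cos s * G.expectation (\<lambda>\<omega>'. HH s (\<omega>, \<omega>'))"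
    if w: "\<omega> \<in> space M" for \<omega>
  proof -
    let ?w = "\<lambda>y k. sin s * S \<omega> k + cos s * y k"
    have mw: "(\<lambda>y. ?w y j) \<in> borel_measurable (borel_vec p)" if "j \<in> {1..p}" for j
      using comp_vec_measurable[OF that] by measurable
    have mN: "(\<lambda>\<omega>'. W s (\<omega>, \<omega>') j) \<in> borel_measurable N" if "j \<in> {1..p}" for j
      unfolding W_def fst_conv snd_conv using G.comp_measurable[OF that] by measurable
    have ih: "integrable N (\<lambda>\<omega>'. hess (W s (\<omega>, \<omega>')) j k)" if "j \<in> {1..p}" "k \<in> {1..p}" for j k
      by (rule G.integrable_const_bound[where B="3 * (\<alpha> * \<beta>\<^sup>2)"])
        (use hess_bd[OF that] measurable_hess[OF mN that] in auto)
    have K: "\<bar>grad x j\<bar> \<le> \<alpha> * \<beta> + 3 * (\<alpha> * \<beta>\<^sup>2)" "\<bar>cos s * hess x j k\<bar> \<le> \<alpha> * \<beta> + 3 * (\<alpha> * \<beta>\<^sup>2)"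
      if jk: "j \<in> {1..p}" "k \<in> {1..p}" for x j k
    proof -
      have "\<bar>cos s\<bar> * \<bar>hess x j k\<bar> \<le> 1 * (3 * (\<alpha> * \<beta>\<^sup>2))" using hess_bd[OF jk] by (intro mult_mono) auto
      moreover have "0 \<le> \<alpha> * \<beta>" "0 \<le> \<alpha> * \<beta>\<^sup>2" using \<alpha> \<beta> by auto
      ultimately show "\<bar>grad x j\<bar> \<le> \<alpha> * \<beta> + 3 * (\<alpha> * \<beta>\<^sup>2)" "\<bar>cos s * hess x j k\<bar> \<le> \<alpha> * \<beta> + 3 * (\<alpha> * \<beta>\<^sup>2)"
        using grad_bd[OF jk(1), of x] unfolding abs_mult by linarith+
    qed
    have st: "G.expectation (\<lambda>\<omega>'. Y \<omega>' j * grad (?w (Y \<omega>')) j) =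
        (\<Sum>k=1..p. G.cov j k * G.expectation (\<lambda>\<omega>'. cos s * hess (?w (Y \<omega>')) j k))" if j: "j \<in> {1..p}" for j
    proof (rule G.stein_identity[OF j var_pos[OF j], where K="\<alpha> * \<beta> + 3 * (\<alpha> * \<beta>\<^sup>2)"])
      show "(\<lambda>y. grad (?w y) j) \<in> borel_measurable (borel_vec p)" by (rule measurable_grad[OF mw j])
      show "(\<lambda>y. cos s * hess (?w y) j k) \<in> borel_measurable (borel_vec p)" if "k \<in> {1..p}" for k
        by (intro borel_measurable_times borel_measurable_const measurable_hess mw j that)
      show "\<bar>grad (?w y) j\<bar> \<le> \<alpha> * \<beta> + 3 * (\<alpha> * \<beta>\<^sup>2)" for y by (rule K(1)[OF j j])
      show "\<bar>cos s * hess (?w y) j k\<bar> \<le> \<alpha> * \<beta> + 3 * (\<alpha> * \<beta>\<^sup>2)" if "k \<in> {1..p}" for y k by (rule K(2)[OF j that])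
      show "grad (?w x) j = grad (?w y) j" if "\<And>k. k \<in> {1..p} \<Longrightarrow> x k = y k" for x y
        by (rule grad_cong[OF _ j]) (simp add: that)
      show "cos s * hess (?w x) j k = cos s * hess (?w y) j k" if "\<And>k. k \<in> {1..p} \<Longrightarrow> x k = y k" "k \<in> {1..p}" for x y k
        using hess_cong[OF _ j that(2), of "?w x" "?w y"] that(1) by simp
      have d: "((\<lambda>u. ?w (\<lambda>k. x k + u * r k) i) has_real_derivative cos s * r i) (at u)" for x r u i
        by (rule DERIV_cong, (rule derivative_intros)+) simp
      show "((\<lambda>u. grad (?w (\<lambda>k. x k + u * r k)) j) has_real_derivative
          (\<Sum>k=1..p. cos s * hess (?w (\<lambda>k. x k + u * r k)) j k * r k)) (at u)" for x r u
      proof -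
        have "((\<lambda>u. grad (?w (\<lambda>k. x k + u * r k)) j) has_real_derivative
          (\<Sum>k=1..p. hess (?w (\<lambda>k. x k + u * r k)) j k * (cos s * r k))) (at u)"
          by (rule der_grad[where x="\<lambda>u. ?w (\<lambda>k. x k + u * r k)" and v="\<lambda>i. cos s * r i"]) (rule d, rule j)
        then show ?thesis by (simp add: mult_ac)
      qed
      show "continuous_on UNIV (\<lambda>u. cos s * hess (?w (\<lambda>k. x k + u * r k)) j k)" if k: "k \<in> {1..p}" for x r k
      proof (rule continuous_on_mult[OF continuous_on_const])
        have "((\<lambda>u. hess (?w (\<lambda>k. x k + u * r k)) j k) has_real_derivative
          third (\<lambda>u. ?w (\<lambda>k. x k + u * r k)) (\<lambda>i. cos s * r i) u j k) (at u)" for u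
          by (rule der_hess[where x="\<lambda>u. ?w (\<lambda>k. x k + u * r k)" and v="\<lambda>i. cos s * r i"]) (rule d, rule j, rule k)
        then show "continuous_on UNIV (\<lambda>u. hess (?w (\<lambda>k. x k + u * r k)) j k)"
          by (intro DERIV_continuous_on) (rule has_field_derivative_at_within)
      qed
    qed
    have Weq: "?w (Y \<omega>') = W s (\<omega>, \<omega>')" for \<omega>' by (simp add: W_def)
    have iYg: "integrable N (\<lambda>\<omega>'. Y \<omega>' j * grad (W s (\<omega>, \<omega>')) j)" if j: "j \<in> {1..p}" for j
    proof (rule Bochner_Integration.integrable_bound)
      show "integrable N (\<lambda>\<omega>'. \<alpha> * \<beta> * Y \<omega>' j)" using G.integrable_coord[OF j] by simp
      show "(\<lambda>\<omega>'. Y \<omega>' j * grad (W s (\<omega>, \<omega>')) j) \<in> borel_measurable N"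
        by (intro borel_measurable_times G.comp_measurable j measurable_grad mN)
      show "AE \<omega>' in N. norm (Y \<omega>' j * grad (W s (\<omega>, \<omega>')) j) \<le> norm (\<alpha> * \<beta> * Y \<omega>' j)"
      proof (rule AE_I2)
        fix \<omega>'
        have "\<bar>Y \<omega>' j\<bar> * \<bar>grad (W s (\<omega>, \<omega>')) j\<bar> \<le> \<bar>Y \<omega>' j\<bar> * (\<alpha> * \<beta>)" using grad_bd[OF j] by (intro mult_left_mono) auto
        then show "norm (Y \<omega>' j * grad (W s (\<omega>, \<omega>')) j) \<le> norm (\<alpha> * \<beta> * Y \<omega>' j)"
          using \<alpha> \<beta> by (simp add: abs_mult mult_ac)
      qed
    qed
    have "G.expectation (\<lambda>\<omega>'. ?g (\<omega>, \<omega>')) = (\<Sum>j=1..p. G.expectation (\<lambda>\<omega>'. Y \<omega>' j * grad (W s (\<omega>, \<omega>')) j))"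
      using iYg by (subst Bochner_Integration.integral_sum[symmetric]) auto
    also have "\<dots> = (\<Sum>j=1..p. \<Sum>k=1..p. Sig j k * G.expectation (\<lambda>\<omega>'. cos s * hess (W s (\<omega>, \<omega>')) j k))"
      using st cov_eq unfolding Weq by (intro sum.cong refl) (auto intro!: sum.cong)
    also have "\<dots> = cos s * (\<Sum>j=1..p. \<Sum>k=1..p. G.expectation (\<lambda>\<omega>'. Sig j k * hess (W s (\<omega>, \<omega>')) j k))"
      by (simp add: sum_distrib_left mult_ac)
    also have "(\<Sum>j=1..p. \<Sum>k=1..p. G.expectation (\<lambda>\<omega>'. Sig j k * hess (W s (\<omega>, \<omega>')) j k)) = G.expectation (\<lambda>\<omega>'. HH s (\<omega>, \<omega>'))"
      unfolding HH_def using ih by (intro integral_sum2[symmetric]) auto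
    finally show ?thesis .
  qed
  have "(LINT x|(M \<Otimes>\<^sub>M N). ?g x) = (LINT \<omega>|M. LINT \<omega>'|N. ?g (\<omega>, \<omega>'))" by (rule MN.integral_fst'[OF ig, symmetric])
  also have "\<dots> = (LINT \<omega>|M. cos s * (LINT \<omega>'|N. HH s (\<omega>, \<omega>')))"
    by (rule Bochner_Integration.integral_cong[OF refl]) (rule inner)
  also have "\<dots> = cos s * (LINT \<omega>|M. LINT \<omega>'|N. HH s (\<omega>, \<omega>'))" by simp
  also have "(LINT \<omega>|M. LINT \<omega>'|N. HH s (\<omega>, \<omega>')) = (LINT x|(M \<Otimes>\<^sub>M N). HH s x)" by (rule MN.integral_fst'[OF int_HH])
  finally show ?thesis .
qed

lemma int_f: "integrable (M \<Otimes>\<^sub>M N) (\<lambda>x. f (W s x))"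
  by (rule MN.integrable_const_bound[where B=1])
    (use f_bounds in \<open>auto intro!: measurable_f W_measurable simp: less_imp_le\<close>)

definition "FF s = (LINT x|(M \<Otimes>\<^sub>M N). f (W s x))"

lemma der_FF: "(FF has_real_derivative
    (LINT x|(M \<Otimes>\<^sub>M N). (\<Sum>j=1..p. (cos s * S (fst x) j + - sin s * Y (snd x) j) * grad (W s x) j))) (at s)"
  unfolding FF_def[abs_def]
proof (rule has_real_derivative_integral[OF int_f int_bnd grad_lincomb_measurable])
  fix s and x :: "'a \<times> 'b" assume x: "x \<in> space (M \<Otimes>\<^sub>M N)"
  have "((\<lambda>s. W s x j) has_real_derivative cos s * S (fst x) j + - sin s * Y (snd x) j) (at s)" for j
    unfolding W_def by (intro DERIV_add DERIV_cmult_right DERIV_sin DERIV_cos)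
  then have "((\<lambda>s. f (W s x)) has_real_derivative (\<Sum>j=1..p. grad (W s x) j * (cos s * S (fst x) j + - sin s * Y (snd x) j))) (at s)"
    by (rule der_f[where x="\<lambda>s. W s x" and v="\<lambda>j. cos s * S (fst x) j + - sin s * Y (snd x) j"])
  then show "((\<lambda>s. f (W s x)) has_real_derivative (\<Sum>j=1..p. (cos s * S (fst x) j + - sin s * Y (snd x) j) * grad (W s x) j)) (at s)"
    by (simp only: mult.commute)
  show "\<bar>\<Sum>j=1..p. (cos s * S (fst x) j + - sin s * Y (snd x) j) * grad (W s x) j\<bar> \<le> bnd x"
    by (rule grad_lincomb_bd[OF x]) auto
qed

lemma der_FF_bound:
  assumes s: "0 \<le> s" "s \<le> pi / 2"
  shows "\<bar>LINT x|(M \<Otimes>\<^sub>M N). (\<Sum>j=1..p. (cos s * S (fst x) j + - sin s * Y (snd x) j) * grad (W s x) j)\<bar> \<le> Err"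
proof -
  let ?A = "LINT x|(M \<Otimes>\<^sub>M N). (\<Sum>j=1..p. S (fst x) j * grad (W s x) j)"
  let ?B = "LINT x|(M \<Otimes>\<^sub>M N). (\<Sum>j=1..p. Y (snd x) j * grad (W s x) j)"
  have ia: "integrable (M \<Otimes>\<^sub>M N) (\<lambda>x. \<Sum>j=1..p. S (fst x) j * grad (W s x) j)"
    using int_grad_lincomb[of 1 0 s] by simp
  have ib: "integrable (M \<Otimes>\<^sub>M N) (\<lambda>x. \<Sum>j=1..p. Y (snd x) j * grad (W s x) j)"
    using int_grad_lincomb[of 0 1 s] by simp
  have "(\<Sum>j=1..p. (cos s * S (fst x) j + - sin s * Y (snd x) j) * grad (W s x) j) =
      cos s * (\<Sum>j=1..p. S (fst x) j * grad (W s x) j) - sin s * (\<Sum>j=1..p. Y (snd x) j * grad (W s x) j)" for x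
    by (simp add: sum_distrib_left sum_subtractf left_diff_distrib mult.assoc)
  then have "(LINT x|(M \<Otimes>\<^sub>M N). (\<Sum>j=1..p. (cos s * S (fst x) j + - sin s * Y (snd x) j) * grad (W s x) j)) = cos s * ?A - sin s * ?B"
    using ia ib by simp
  \<comment> \<open>\<open>Y_part\<close> turns the Gaussian term into \<open>sin s * cos s\<close>
    times the mean of \<open>HH s\<close>, which is just what \<open>S_part\<close>
    subtracts.\<close>
  also have "\<dots> = cos s * (?A - sin s * (LINT x|(M \<Otimes>\<^sub>M N). HH s x))" unfolding Y_part by (simp add: algebra_simps)
  also have "\<bar>\<dots>\<bar> \<le> 1 * Err" unfolding abs_mult using S_part[OF s] by (intro mult_mono) auto
  finally show ?thesis by simp
qed

theorem expectation_f_diff: "\<bar>expectation (\<lambda>\<omega>. f (S \<omega>)) - G.expectation (\<lambda>\<omega>. f (Y \<omega>))\<bar> \<le> 2 * Err"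
proof -
  have "\<exists>z>0. z < pi / 2 \<and> FF (pi / 2) - FF 0 = (pi / 2 - 0) *
      (LINT x|(M \<Otimes>\<^sub>M N). (\<Sum>j=1..p. (cos z * S (fst x) j + - sin z * Y (snd x) j) * grad (W z x) j))"
    by (rule MVT2) (simp, rule der_FF)
  then obtain z where z: "0 < z" "z < pi / 2" and eq: "FF (pi / 2) - FF 0 = pi / 2 *
      (LINT x|(M \<Otimes>\<^sub>M N). (\<Sum>j=1..p. (cos z * S (fst x) j + - sin z * Y (snd x) j) * grad (W z x) j))"
    by auto
  \<comment> \<open>The factor 2 bounds the length \<open>pi / 2\<close> of the parameter
    interval.\<close>
  have "\<bar>FF (pi / 2) - FF 0\<bar> \<le> 2 * Err"
    unfolding eq abs_mult using der_FF_bound[of z] z pi_less_4 by (intro mult_mono) auto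
  moreover have "FF (pi / 2) = expectation (\<lambda>\<omega>. f (S \<omega>))"
  proof -
    have "FF (pi / 2) = (LINT \<omega>|M. LINT \<omega>'|N. f (W (pi / 2) (\<omega>, \<omega>')))"
      unfolding FF_def by (rule MN.integral_fst'[OF int_f, symmetric])
    then show ?thesis by (simp add: W_def G.prob_space)
  qed
  moreover have "FF 0 = G.expectation (\<lambda>\<omega>. f (Y \<omega>))"
  proof -
    have "FF 0 = (LINT \<omega>|M. LINT \<omega>'|N. f (W 0 (\<omega>, \<omega>')))"
      unfolding FF_def by (rule MN.integral_fst'[OF int_f, symmetric])
    then show ?thesis by (simp add: W_def prob_space)
  qed
  ultimately show ?thesis by simp
qed

end

section \<open>From smooth test functions to distribution functions\<close>

lemma linf_le_measurable:
  assumes "p \<ge> 1" "\<And>j. j \<in> {1..p} \<Longrightarrow> (\<lambda>\<omega>. X \<omega> j) \<in> borel_measurable M"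
  shows "{\<omega>\<in>space M. linf_norm p (X \<omega>) \<le> t} \<in> sets M"
proof -
  have "{\<omega>\<in>space M. \<forall>j\<in>{1..p}. X \<omega> j \<in> {-t..t}} \<in> sets M"
    by (rule sets_rectangle) (use assms in auto)
  also have "{\<omega>\<in>space M. \<forall>j\<in>{1..p}. X \<omega> j \<in> {-t..t}} = {\<omega>\<in>space M. linf_norm p (X \<omega>) \<le> t}"
    unfolding linf_norm_le_iff[OF assms(1)] by (auto simp: abs_le_iff)
  finally show ?thesis .
qed

context softmax
begin

lemma prob_linf_le_expectation:
  assumes "prob_space M" and X: "\<And>j. j \<in> {1..p} \<Longrightarrow> (\<lambda>\<omega>. X \<omega> j) \<in> borel_measurable M"
    and K: "\<alpha> * (ln (2 * real p) + \<beta> * t - \<tau>) \<le> - K" and K0: "K \<ge> 0"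
  shows "measure M {\<omega>\<in>space M. linf_norm p (X \<omega>) \<le> t} \<le> (LINT \<omega>|M. f (X \<omega>)) + exp (- K)"
proof -
  interpret prob_space M by fact
  let ?A = "{\<omega>\<in>space M. linf_norm p (X \<omega>) \<le> t}"
  have A: "?A \<in> sets M" by (rule linf_le_measurable[OF p X])
  have fi: "integrable M (\<lambda>\<omega>. f (X \<omega>))"
    by (rule integrable_const_bound[where B=1]) (use f_bounds in \<open>auto intro!: measurable_f X simp: less_imp_le\<close>)
  have "prob ?A = expectation (indicator ?A)" using A by simp
  also have "\<dots> \<le> expectation (\<lambda>\<omega>. f (X \<omega>) + exp (- K))"
  proof (rule integral_mono)
    show "integrable M (indicator ?A :: _ \<Rightarrow> real)" using A by (simp add: integrable_indicator_iff emeasure_eq_measure)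
    show "indicator ?A \<omega> \<le> f (X \<omega>) + exp (- K)" if "\<omega> \<in> space M" for \<omega>
      using f_ge[OF _ K, of "X \<omega>"] f_bounds[of "X \<omega>"] that
      by (auto simp: indicator_def algebra_simps intro: add_nonneg_nonneg less_imp_le)
  qed (use fi in simp)
  also have "\<dots> = expectation (\<lambda>\<omega>. f (X \<omega>)) + exp (- K)" using fi by (simp add: prob_space)
  finally show ?thesis .
qed

lemma expectation_le_prob_linf:
  assumes "prob_space M" and X: "\<And>j. j \<in> {1..p} \<Longrightarrow> (\<lambda>\<omega>. X \<omega> j) \<in> borel_measurable M"
    and K: "\<alpha> * (\<beta> * t - \<tau>) \<ge> K"
  shows "(LINT \<omega>|M. f (X \<omega>)) \<le> measure M {\<omega>\<in>space M. linf_norm p (X \<omega>) \<le> t} + exp (- K)"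
proof -
  interpret prob_space M by fact
  let ?A = "{\<omega>\<in>space M. linf_norm p (X \<omega>) \<le> t}"
  have A: "?A \<in> sets M" by (rule linf_le_measurable[OF p X])
  have fi: "integrable M (\<lambda>\<omega>. f (X \<omega>))"
    by (rule integrable_const_bound[where B=1]) (use f_bounds in \<open>auto intro!: measurable_f X simp: less_imp_le\<close>)
  have Ai: "integrable M (indicator ?A :: _ \<Rightarrow> real)" using A by (simp add: integrable_indicator_iff emeasure_eq_measure)
  have "expectation (\<lambda>\<omega>. f (X \<omega>)) \<le> expectation (\<lambda>\<omega>. indicator ?A \<omega> + exp (- K))"
  proof (rule integral_mono)
    show "f (X \<omega>) \<le> indicator ?A \<omega> + exp (- K)" if "\<omega> \<in> space M" for \<omega>
      using f_le[OF _ K, of "X \<omega>"] f_bounds(2)[of "X \<omega>"] that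
      by (auto simp: indicator_def not_le intro: add_increasing2 less_imp_le)
  qed (use fi Ai in auto)
  also have "\<dots> = prob ?A + exp (- K)" using Ai A by (simp add: prob_space)
  finally show ?thesis .
qed

end

text \<open>\<open>\<delta>\<close> is the width over which the smoothed indicator falls from nearly
  1 to nearly 0: the slack \<open>ln (2 * p)\<close> of the soft maximum plus a logistic margin
  \<open>K / \<alpha>\<close> on either side, divided by \<open>\<beta>\<close>. Only the Gaussian
  distribution function has to absorb a shift by \<open>\<delta>\<close>.\<close>

theorem kolmogorov_distance_bound:
  fixes \<xi> :: "nat \<Rightarrow> 'a \<Rightarrow> nat \<Rightarrow> real" and Y :: "'b \<Rightarrow> nat \<Rightarrow> real"
  assumes ga: "gauss_approx p \<beta> \<alpha> M n \<xi> Sig l \<mu> \<Delta> N Y"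
    and b: "b > 0" "\<And>j. j \<in> {1..p} \<Longrightarrow> Sig j j \<ge> b" and K: "K \<ge> 0"
  defines "\<delta> \<equiv> (ln (2 * real p) + 2 * K / \<alpha>) / \<beta>"
  shows "\<bar>measure M {\<omega>\<in>space M. linf_norm p (\<lambda>j. \<Sum>i=1..n. \<xi> i \<omega> j) \<le> t} - measure N {\<omega>\<in>space N. linf_norm p (Y \<omega>) \<le> t}\<bar>
    \<le> 2 * (real n * (\<alpha> * \<beta> * \<mu>) + 60 * exp 6 * \<alpha> * \<beta> ^ 3 * (real n * l ^ 3) + 3 * \<alpha> * \<beta>\<^sup>2 * \<Delta>) +
      2 * exp (- K) + exp 4 * (\<delta> / sqrt b) * (sqrt (2 * ln (2 * real p)) + 3)"
proof -
  define E where "E = real n * (\<alpha> * \<beta> * \<mu>) + 60 * exp 6 * \<alpha> * \<beta> ^ 3 * (real n * l ^ 3) + 3 * \<alpha> * \<beta>\<^sup>2 * \<Delta>"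
  define ac where "ac = exp 4 * (\<delta> / sqrt b) * (sqrt (2 * ln (2 * real p)) + 3)"
  define F where "F = (\<lambda>t. measure M {\<omega>\<in>space M. linf_norm p (\<lambda>j. \<Sum>i=1..n. \<xi> i \<omega> j) \<le> t})"
  define H where "H = (\<lambda>t. measure N {\<omega>\<in>space N. linf_norm p (Y \<omega>) \<le> t})"
  \<comment> \<open>\<open>\<tau>\<close> does not occur in the locale predicate, so
    \<open>ga\<close> serves every threshold: 0 is a placeholder here, and \<open>diff\<close>
    reinterprets the locale for arbitrary \<open>\<tau>\<close>.\<close>
  interpret A: gauss_approx p \<beta> \<alpha> 0 M n \<xi> Sig l \<mu> \<Delta> N Y by (rule ga)
  note p = A.p and \<alpha> = A.\<alpha>(1) and \<beta> = A.\<beta>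
  have sm: "softmax p \<beta> \<alpha>" by (rule softmax.intro) (use A.p A.\<alpha> A.\<beta> in auto)
  have psM: "prob_space M" and psN: "prob_space N" by (rule A.prob_space_axioms A.G.prob_space_axioms)+
  have S_eq: "A.S = (\<lambda>\<omega> j. \<Sum>i=1..n. \<xi> i \<omega> j)" by (intro ext) (rule A.S_def)
  note SM = A.S_measurable[unfolded S_eq]
  note YM = A.G.comp_measurable
  have diff: "\<bar>(LINT \<omega>|M. softmax.f p \<beta> \<alpha> \<tau> (\<lambda>j. \<Sum>i=1..n. \<xi> i \<omega> j)) - (LINT \<omega>|N. softmax.f p \<beta> \<alpha> \<tau> (Y \<omega>))\<bar> \<le> 2 * E" for \<tau>
  proof -
    interpret gauss_approx p \<beta> \<alpha> \<tau> M n \<xi> Sig l \<mu> \<Delta> N Y by (rule ga)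
    show ?thesis using expectation_f_diff unfolding Err_def E_def S_eq .
  qed
  have \<delta>: "\<delta> \<ge> 0" unfolding \<delta>_def using p K \<alpha> \<beta> by (intro divide_nonneg_nonneg add_nonneg_nonneg) auto
  have \<beta>\<delta>: "\<beta> * \<delta> = ln (2 * real p) + 2 * K / \<alpha>" unfolding \<delta>_def using \<beta> by simp
  have step: "F t \<le> H (t + \<delta>) + 2 * exp (- K) + 2 * E" "H t \<le> F (t + \<delta>) + 2 * exp (- K) + 2 * E" for t
  proof -
    \<comment> \<open>Places the step \<open>K / \<alpha>\<close> above the upper bound of
      \<open>ln Phi\<close> on the ball of radius \<open>t\<close>; by the choice of
      \<open>\<delta>\<close> it is also \<open>K / \<alpha>\<close> below the lower bound of
      \<open>ln Phi\<close> outside the ball of radius \<open>t + \<delta>\<close>.\<close>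
    define \<tau> where "\<tau> = ln (2 * real p) + \<beta> * t + K / \<alpha>"
    have 1: "\<alpha> * (ln (2 * real p) + \<beta> * t - \<tau>) \<le> - K" using \<alpha> by (simp add: \<tau>_def)
    have 2: "\<alpha> * (\<beta> * (t + \<delta>) - \<tau>) \<ge> K" using \<alpha> unfolding \<tau>_def distrib_left[of \<beta>] \<beta>\<delta> by (simp add: field_simps)
    show "F t \<le> H (t + \<delta>) + 2 * exp (- K) + 2 * E"
      using softmax.prob_linf_le_expectation[OF sm psM, where X="\<lambda>\<omega> j. \<Sum>i=1..n. \<xi> i \<omega> j", OF SM 1 K] softmax.expectation_le_prob_linf[OF sm psN, where X=Y, OF YM 2] diff[of \<tau>]
      unfolding F_def H_def by linarith
    show "H t \<le> F (t + \<delta>) + 2 * exp (- K) + 2 * E"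
      using softmax.prob_linf_le_expectation[OF sm psN, where X=Y, OF YM 1 K] softmax.expectation_le_prob_linf[OF sm psM, where X="\<lambda>\<omega> j. \<Sum>i=1..n. \<xi> i \<omega> j", OF SM 2] diff[of \<tau>]
      unfolding F_def H_def by linarith
  qed
  have anti: "H (t + \<delta>) \<le> H t + ac" for t
  proof -
    have "{\<omega>\<in>space N. linf_norm p (Y \<omega>) \<le> t + \<delta>} =
      {\<omega>\<in>space N. linf_norm p (Y \<omega>) \<le> t} \<union> {\<omega>\<in>space N. t < linf_norm p (Y \<omega>) \<and> linf_norm p (Y \<omega>) \<le> t + \<delta>}"
      using \<delta> by auto
    moreover have "{\<omega>\<in>space N. t < linf_norm p (Y \<omega>) \<and> linf_norm p (Y \<omega>) \<le> t + \<delta>} \<in> sets N"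
    proof -
      have "{\<omega>\<in>space N. t < linf_norm p (Y \<omega>) \<and> linf_norm p (Y \<omega>) \<le> t + \<delta>} =
        {\<omega>\<in>space N. linf_norm p (Y \<omega>) \<le> t + \<delta>} - {\<omega>\<in>space N. linf_norm p (Y \<omega>) \<le> t}" by auto
      then show ?thesis using linf_le_measurable[OF p YM] by auto
    qed
    ultimately have "H (t + \<delta>) \<le> H t + measure N {\<omega>\<in>space N. t < linf_norm p (Y \<omega>) \<and> linf_norm p (Y \<omega>) \<le> t + \<delta>}"
      unfolding H_def using linf_le_measurable[OF p YM]
      by (simp add: measure_Un_le)
    also have "measure N {\<omega>\<in>space N. t < linf_norm p (Y \<omega>) \<and> linf_norm p (Y \<omega>) \<le> t + \<delta>} \<le> ac"
      unfolding ac_def by (rule A.G.linf_anti_concentration[OF p b(1) _ \<delta>]) (use A.cov_eq b(2) in auto)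
    finally show ?thesis by simp
  qed
  have "F t \<le> H t + ac + 2 * exp (- K) + 2 * E" using step(1)[of t] anti[of t] by linarith
  \<comment> \<open>The comparison starts at \<open>t - \<delta>\<close>, so that the shift again
    falls on \<open>H\<close>, the function with the anti-concentration bound.\<close>
  moreover have "H t \<le> F t + ac + 2 * exp (- K) + 2 * E"
    using step(2)[of "t - \<delta>"] anti[of "t - \<delta>"] by simp
  ultimately have "\<bar>F t - H t\<bar> \<le> 2 * E + 2 * exp (- K) + ac" by linarith
  then show ?thesis unfolding F_def H_def E_def ac_def .
qed

section \<open>Truncation and rates\<close>

lemma abs_trunc: "\<kappa> > 0 \<Longrightarrow> \<bar>trunc \<kappa> x\<bar> = min \<bar>x\<bar> \<kappa>"
  by (auto simp: trunc_def min_def max_def abs_if)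

lemma trunc_id: "\<bar>x\<bar> \<le> \<kappa> \<Longrightarrow> trunc \<kappa> x = x"
  by (auto simp: trunc_def)

lemma trunc_measurable[measurable]: "trunc \<kappa> \<in> borel_measurable borel"
  unfolding trunc_def[abs_def] by measurable

text \<open>The error vanishes up to \<open>\<kappa>\<close>. Beyond it,
  \<open>\<bar>x\<bar>\<close> is split into \<open>\<bar>x\<bar> powr (2 + \<theta>)\<close> and a
  power with negative exponent, which is at most the same power of \<open>\<kappa>\<close>.\<close>

lemma trunc_diff_le:
  assumes k: "\<kappa> > 0" and th: "\<theta> > 0"
  shows "\<bar>trunc \<kappa> x - x\<bar> \<le> \<kappa> powr (- 1 - \<theta>) * \<bar>x\<bar> powr (2 + \<theta>)"
proof (cases "\<bar>x\<bar> \<le> \<kappa>")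
  case True
  then show ?thesis by (simp add: trunc_id)
next
  case False
  then have "\<bar>trunc \<kappa> x - x\<bar> \<le> \<bar>x\<bar>" using k by (auto simp: trunc_def min_def max_def abs_if)
  also have "\<bar>x\<bar> = \<bar>x\<bar> powr (- 1 - \<theta>) * \<bar>x\<bar> powr (2 + \<theta>)"
    using False k by (simp flip: powr_add)
  also have "\<dots> \<le> \<kappa> powr (- 1 - \<theta>) * \<bar>x\<bar> powr (2 + \<theta>)"
    using False k th by (intro mult_right_mono powr_mono2') auto
  finally show ?thesis .
qed

lemma trunc_mult_diff_le:
  assumes k: "\<kappa> > 0" and th: "\<theta> > 0"
  shows "\<bar>trunc \<kappa> x * trunc \<kappa> y - x * y\<bar> \<le> \<kappa> powr (- \<theta>) * (\<bar>x\<bar> powr (2 + \<theta>) + \<bar>y\<bar> powr (2 + \<theta>))"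
proof -
  define m where "m = max \<bar>x\<bar> \<bar>y\<bar>"
  show ?thesis
  proof (cases "m \<le> \<kappa>")
    case True
    then show ?thesis by (simp add: trunc_id m_def)
  next
    case False
    \<comment> \<open>Truncation multiplies by a factor in the unit interval, so the product of two
      truncations is such a multiple of \<open>x * y\<close>, and the error is at most
      \<open>m * m\<close>.\<close>
    have tr: "\<exists>s. 0 \<le> s \<and> s \<le> 1 \<and> trunc \<kappa> z = s * z" for z
    proof (cases "\<bar>z\<bar> \<le> \<kappa>")
      case True
      then show ?thesis by (intro exI[of _ 1]) (simp add: trunc_id)
    next
      case False
      then show ?thesis using k by (intro exI[of _ "\<kappa> / \<bar>z\<bar>"]) (auto simp: trunc_def abs_if divide_simps min_def max_def)
    qed
    obtain s t where s: "0 \<le> s" "s \<le> 1" "trunc \<kappa> x = s * x" and t: "0 \<le> t" "t \<le> 1" "trunc \<kappa> y = t * y"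
      using tr[of x] tr[of y] by blast
    have st: "0 \<le> s * t" "s * t \<le> 1" using s t by (auto intro: mult_le_one)
    have "trunc \<kappa> x * trunc \<kappa> y - x * y = - ((1 - s * t) * (x * y))" by (simp add: s(3) t(3) algebra_simps)
    then have "\<bar>trunc \<kappa> x * trunc \<kappa> y - x * y\<bar> = (1 - s * t) * (\<bar>x\<bar> * \<bar>y\<bar>)"
      using st by (simp add: abs_mult)
    also have "\<dots> \<le> 1 * (m * m)" using st by (intro mult_mono) (auto simp: m_def)
    also have "1 * (m * m) = m powr (- \<theta>) * m powr (2 + \<theta>)"
      using False k by (simp flip: powr_add) (simp add: power2_eq_square)
    also have "\<dots> \<le> \<kappa> powr (- \<theta>) * (\<bar>x\<bar> powr (2 + \<theta>) + \<bar>y\<bar> powr (2 + \<theta>))"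
      using False k th by (intro mult_mono powr_mono2') (auto simp: m_def max_def)
    finally show ?thesis .
  qed
qed

text \<open>Here \<open>\<theta> \<le> 1\<close> matters:
  \<open>3 = (1 - \<theta>) + (2 + \<theta>)\<close> splits the cube into two powers with
  nonnegative exponents, the first bounded through \<open>\<kappa>\<close> and the second through
  \<open>\<bar>x\<bar>\<close>.\<close>

lemma trunc_cube_le:
  assumes k: "\<kappa> > 0" and th: "\<theta> > 0" "\<theta> \<le> 1"
  shows "\<bar>trunc \<kappa> x\<bar> ^ 3 \<le> \<kappa> powr (1 - \<theta>) * \<bar>x\<bar> powr (2 + \<theta>)"
proof (cases "x = 0")
  case True
  then show ?thesis using k by (simp add: abs_trunc)
next
  case False
  define u where "u = min \<bar>x\<bar> \<kappa>"
  have u: "u > 0" "u \<le> \<bar>x\<bar>" "u \<le> \<kappa>" using False k by (auto simp: u_def)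
  have "u ^ 3 = u powr (1 - \<theta>) * u powr (2 + \<theta>)" using u by (simp flip: powr_add powr_numeral)
  also have "\<dots> \<le> \<kappa> powr (1 - \<theta>) * \<bar>x\<bar> powr (2 + \<theta>)"
    using u th by (intro mult_mono powr_mono2) auto
  finally show ?thesis using k by (simp add: abs_trunc u_def)
qed

lemma (in prob_space) truncated_moments:
  fixes x y :: "'a \<Rightarrow> real"
  assumes k: "\<kappa> > 0" and th: "\<theta> > 0" "\<theta> \<le> 1"
    and [measurable]: "x \<in> borel_measurable M" "y \<in> borel_measurable M"
    and ix: "integrable M (\<lambda>\<omega>. \<bar>x \<omega>\<bar> powr (2 + \<theta>))" "expectation (\<lambda>\<omega>. \<bar>x \<omega>\<bar> powr (2 + \<theta>)) \<le> m"
    and iy: "integrable M (\<lambda>\<omega>. \<bar>y \<omega>\<bar> powr (2 + \<theta>))" "expectation (\<lambda>\<omega>. \<bar>y \<omega>\<bar> powr (2 + \<theta>)) \<le> m"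
  shows "integrable M x" "integrable M (\<lambda>\<omega>. x \<omega> * y \<omega>)"
    "\<bar>expectation (\<lambda>\<omega>. trunc \<kappa> (x \<omega>)) - expectation x\<bar> \<le> \<kappa> powr (- 1 - \<theta>) * m"
    "\<bar>expectation (\<lambda>\<omega>. trunc \<kappa> (x \<omega>) * trunc \<kappa> (y \<omega>)) - expectation (\<lambda>\<omega>. x \<omega> * y \<omega>)\<bar> \<le> \<kappa> powr (- \<theta>) * (2 * m)"
    "expectation (\<lambda>\<omega>. \<bar>trunc \<kappa> (x \<omega>)\<bar> ^ 3) \<le> \<kappa> powr (1 - \<theta>) * m"
proof -
  have it: "integrable M (\<lambda>\<omega>. trunc \<kappa> (x \<omega>))" "integrable M (\<lambda>\<omega>. trunc \<kappa> (x \<omega>) * trunc \<kappa> (y \<omega>))"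
    "integrable M (\<lambda>\<omega>. \<bar>trunc \<kappa> (x \<omega>)\<bar> ^ 3)"
  proof -
    have b: "\<bar>trunc \<kappa> z\<bar> \<le> \<kappa>" for z using k by (simp add: abs_trunc)
    have "\<bar>trunc \<kappa> z\<bar> * \<bar>trunc \<kappa> w\<bar> \<le> \<kappa> * \<kappa>" for z w using b k by (intro mult_mono) auto
    then show "integrable M (\<lambda>\<omega>. trunc \<kappa> (x \<omega>) * trunc \<kappa> (y \<omega>))"
      by (intro integrable_const_bound[where B="\<kappa> * \<kappa>"]) (auto simp: abs_mult)
    show "integrable M (\<lambda>\<omega>. trunc \<kappa> (x \<omega>))"
      using b by (intro integrable_const_bound[where B=\<kappa>]) auto
    show "integrable M (\<lambda>\<omega>. \<bar>trunc \<kappa> (x \<omega>)\<bar> ^ 3)"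
      using power_mono[OF b abs_ge_zero, where n=3] by (intro integrable_const_bound[where B="\<kappa> ^ 3"]) (auto simp: power_abs)
  qed
  have "integrable M (\<lambda>\<omega>. x \<omega> - trunc \<kappa> (x \<omega>))"
  proof (rule Bochner_Integration.integrable_bound[OF integrable_mult_right[OF ix(1), of "\<kappa> powr (- 1 - \<theta>)"]])
    show "AE \<omega> in M. norm (x \<omega> - trunc \<kappa> (x \<omega>)) \<le> norm (\<kappa> powr (- 1 - \<theta>) * \<bar>x \<omega>\<bar> powr (2 + \<theta>))"
      using trunc_diff_le[OF k th(1)] by (intro AE_I2) (simp add: abs_minus_commute)
  qed simp
  from Bochner_Integration.integrable_add[OF this it(1)] show intx: "integrable M x" by simp
  have "integrable M (\<lambda>\<omega>. x \<omega> * y \<omega> - trunc \<kappa> (x \<omega>) * trunc \<kappa> (y \<omega>))"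
  proof (rule Bochner_Integration.integrable_bound[OF integrable_mult_right[OF Bochner_Integration.integrable_add[OF ix(1) iy(1)], of "\<kappa> powr (- \<theta>)"]])
    show "AE \<omega> in M. norm (x \<omega> * y \<omega> - trunc \<kappa> (x \<omega>) * trunc \<kappa> (y \<omega>)) \<le>
        norm (\<kappa> powr (- \<theta>) * (\<bar>x \<omega>\<bar> powr (2 + \<theta>) + \<bar>y \<omega>\<bar> powr (2 + \<theta>)))"
      using trunc_mult_diff_le[OF k th(1)] by (intro AE_I2) (simp add: abs_minus_commute abs_mult)
  qed simp
  from Bochner_Integration.integrable_add[OF this it(2)] show intxy: "integrable M (\<lambda>\<omega>. x \<omega> * y \<omega>)" by simp
  have "\<bar>expectation (\<lambda>\<omega>. trunc \<kappa> (x \<omega>) - x \<omega>)\<bar> \<le> expectation (\<lambda>\<omega>. \<kappa> powr (- 1 - \<theta>) * \<bar>x \<omega>\<bar> powr (2 + \<theta>))"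
    by (rule abs_expectation_le) (use it intx ix trunc_diff_le[OF k th(1)] in auto)
  also have "\<dots> \<le> \<kappa> powr (- 1 - \<theta>) * m" using ix by (simp add: mult_left_mono)
  finally show "\<bar>expectation (\<lambda>\<omega>. trunc \<kappa> (x \<omega>)) - expectation x\<bar> \<le> \<kappa> powr (- 1 - \<theta>) * m"
    using it intx by simp
  have "\<bar>expectation (\<lambda>\<omega>. trunc \<kappa> (x \<omega>) * trunc \<kappa> (y \<omega>) - x \<omega> * y \<omega>)\<bar> \<le>
      expectation (\<lambda>\<omega>. \<kappa> powr (- \<theta>) * (\<bar>x \<omega>\<bar> powr (2 + \<theta>) + \<bar>y \<omega>\<bar> powr (2 + \<theta>)))"
    by (rule abs_expectation_le) (use it intxy ix iy trunc_mult_diff_le[OF k th(1)] in auto)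
  also have "\<dots> = \<kappa> powr (- \<theta>) * (expectation (\<lambda>\<omega>. \<bar>x \<omega>\<bar> powr (2 + \<theta>)) + expectation (\<lambda>\<omega>. \<bar>y \<omega>\<bar> powr (2 + \<theta>)))"
    using ix iy by simp
  also have "\<dots> \<le> \<kappa> powr (- \<theta>) * (2 * m)" using ix iy by (intro mult_left_mono) auto
  finally show "\<bar>expectation (\<lambda>\<omega>. trunc \<kappa> (x \<omega>) * trunc \<kappa> (y \<omega>)) - expectation (\<lambda>\<omega>. x \<omega> * y \<omega>)\<bar> \<le> \<kappa> powr (- \<theta>) * (2 * m)"
    using it intxy by simp
  have "expectation (\<lambda>\<omega>. \<bar>trunc \<kappa> (x \<omega>)\<bar> ^ 3) \<le> expectation (\<lambda>\<omega>. \<kappa> powr (1 - \<theta>) * \<bar>x \<omega>\<bar> powr (2 + \<theta>))"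
    by (rule integral_mono) (use it ix trunc_cube_le[OF k th] in auto)
  also have "\<dots> \<le> \<kappa> powr (1 - \<theta>) * m" using ix by (simp add: mult_left_mono)
  finally show "expectation (\<lambda>\<omega>. \<bar>trunc \<kappa> (x \<omega>)\<bar> ^ 3) \<le> \<kappa> powr (1 - \<theta>) * m" .
qed

lemma covariance_centered:
  "(LINT \<omega>|M. U \<omega>) = 0 \<Longrightarrow> (LINT \<omega>|M. V \<omega>) = 0 \<Longrightarrow> covariance M U V = (LINT \<omega>|M. U \<omega> * V \<omega>)"
  by (simp add: covariance_def)

text \<open>The dictionary to \<open>gauss_approx\<close>: the summands are
  \<open>trunc \<kappa> (X i \<omega> j) / sqrt n\<close>, the truncation error of the mean gives
  \<open>\<mu>\<close>, that of the products gives \<open>\<Delta>\<close>, and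
  \<open>\<beta> * \<kappa> \<le> sqrt n\<close> is the size condition on the summands.
  \<open>\<alpha>\<close>, \<open>\<beta>\<close> and \<open>K\<close> stay free for tuning.\<close>

theorem truncated_mean_bound:
  fixes X :: "nat \<Rightarrow> 'a \<Rightarrow> nat \<Rightarrow> real" and Y :: "'b \<Rightarrow> nat \<Rightarrow> real"
  assumes th: "0 < \<theta>" "\<theta> \<le> 1" and b: "b > 0" and p: "p \<ge> 1" and n: "n \<ge> 1" and k: "\<kappa> > 0" and m: "m > 0"
    and M: "prob_space M" and N: "prob_space N"
    and ind: "prob_space.indep_vars M (\<lambda>_. borel_vec p) X {1..n}"
    and mean_X: "\<And>i j. i \<in> {1..n} \<Longrightarrow> j \<in> {1..p} \<Longrightarrow> (LINT \<omega>|M. X i \<omega> j) = 0"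
    and cov_X: "\<And>i. i \<in> {1..n} \<Longrightarrow> has_cov_matrix M p (X i) Sig"
    and var: "\<And>j. j \<in> {1..p} \<Longrightarrow> Sig j j \<ge> b"
    and mom: "\<And>i j. i \<in> {1..n} \<Longrightarrow> j \<in> {1..p} \<Longrightarrow> integrable M (\<lambda>\<omega>. \<bar>X i \<omega> j\<bar> powr (2 + \<theta>))"
      "\<And>i j. i \<in> {1..n} \<Longrightarrow> j \<in> {1..p} \<Longrightarrow> (LINT \<omega>|M. \<bar>X i \<omega> j\<bar> powr (2 + \<theta>)) \<le> m"
    and Y: "gaussian_vector N p Y" and mean_Y: "\<And>j. j \<in> {1..p} \<Longrightarrow> (LINT \<omega>|N. Y \<omega> j) = 0"
    and cov_Y: "has_cov_matrix N p Y Sig"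
    and \<alpha>: "0 < \<alpha>" "\<alpha> \<le> 1" and \<beta>: "0 < \<beta>" "\<beta> * \<kappa> \<le> sqrt (real n)" and K: "K \<ge> 0"
  shows "\<bar>measure M {\<omega>\<in>space M. sqrt (real n) * linf_norm p (trunc_mean n \<kappa> X \<omega>) \<le> t} - measure N {\<omega>\<in>space N. linf_norm p (Y \<omega>) \<le> t}\<bar>
    \<le> 2 * (\<alpha> * \<beta> * (sqrt (real n) * (\<kappa> powr (- 1 - \<theta>) * m)) + 60 * exp 6 * \<alpha> * \<beta> ^ 3 * (\<kappa> powr (1 - \<theta>) * m / sqrt (real n)) +
        3 * \<alpha> * \<beta>\<^sup>2 * (\<kappa> powr (- \<theta>) * (2 * m))) +
      2 * exp (- K) + exp 4 * ((ln (2 * real p) + 2 * K / \<alpha>) / \<beta> / sqrt b) * (sqrt (2 * ln (2 * real p)) + 3)"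
proof -
  interpret prob_space M by fact
  define r where "r = sqrt (real n)"
  have r: "r > 0" "r * r = real n" using n by (simp_all add: r_def)
  define \<xi> where "\<xi> = (\<lambda>i \<omega>. \<lambda>j\<in>{1..p}. trunc \<kappa> (X i \<omega> j) / r)"
  \<comment> \<open>A cube root, so that \<open>l ^ 3\<close> is exactly the bound for the third
    absolute moment of a scaled summand.\<close>
  define l where "l = root 3 (\<kappa> powr (1 - \<theta>) * m / r ^ 3)"
  have l: "l > 0" "l ^ 3 = \<kappa> powr (1 - \<theta>) * m / r ^ 3" using k m r by (simp_all add: l_def)
  have Xm: "(\<lambda>\<omega>. X i \<omega> j) \<in> borel_measurable M" if "i \<in> {1..n}" "j \<in> {1..p}" for i j
  proof -
    have "X i \<in> measurable M (borel_vec p)" using ind that(1) unfolding indep_vars_def by auto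
    from measurable_compose[OF this measurable_component_singleton[OF that(2)]] show ?thesis .
  qed
  note tm = truncated_moments[OF k th Xm Xm mom mom]
  have Sig: "Sig j k = expectation (\<lambda>\<omega>. X 1 \<omega> j * X 1 \<omega> k)" if "j \<in> {1..p}" "k \<in> {1..p}" for j k
    using cov_X[of 1] n that mean_X[of 1] covariance_centered[of M "\<lambda>\<omega>. X 1 \<omega> j" "\<lambda>\<omega>. X 1 \<omega> k"]
    by (simp add: has_cov_matrix_def)
  have Sigi: "Sig j k = expectation (\<lambda>\<omega>. X i \<omega> j * X i \<omega> k)" if "i \<in> {1..n}" "j \<in> {1..p}" "k \<in> {1..p}" for i j k
    using cov_X[of i] that mean_X[of i] covariance_centered[of M "\<lambda>\<omega>. X i \<omega> j" "\<lambda>\<omega>. X i \<omega> k"]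
    by (simp add: has_cov_matrix_def)
  interpret G: gaussian_centered N p Y
    by (rule gaussian_centered.intro[OF N]) (unfold_locales, use Y mean_Y in auto)
  have cov: "G.cov j k = Sig j k" if "j \<in> {1..p}" "k \<in> {1..p}" for j k
    using cov_Y that mean_Y covariance_centered[of N "\<lambda>\<omega>. Y \<omega> j" "\<lambda>\<omega>. Y \<omega> k"]
    by (simp add: has_cov_matrix_def G.cov_def)
  have ga: "gauss_approx p \<beta> \<alpha> M n \<xi> Sig l (\<kappa> powr (- 1 - \<theta>) * m / r) (\<kappa> powr (- \<theta>) * (2 * m)) N Y"
  proof
    show "1 \<le> p" "0 < \<beta>" "0 < \<alpha>" "\<alpha> \<le> 1" "1 \<le> n" "0 < l" by fact+
    show "indep_vars (\<lambda>_. borel_vec p) \<xi> {1..n}"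
      unfolding \<xi>_def
    proof (rule indep_vars_compose2[OF ind, of "\<lambda>_ x. \<lambda>j\<in>{1..p}. trunc \<kappa> (x j) / r"])
      show "(\<lambda>x. \<lambda>j\<in>{1..p}. trunc \<kappa> (x j) / r) \<in> measurable (borel_vec p) (borel_vec p)"
        by (rule measurable_restrict) measurable
    qed
    show "\<beta> * \<bar>\<xi> i \<omega> j\<bar> \<le> 1" if "j \<in> {1..p}" for i j \<omega>
    proof -
      have "\<beta> * \<bar>trunc \<kappa> (X i \<omega> j)\<bar> \<le> \<beta> * \<kappa>" using k \<beta> by (intro mult_left_mono) (auto simp: abs_trunc)
      also have "\<dots> \<le> r" using \<beta> by (simp add: r_def)
      finally show ?thesis using that r by (simp add: \<xi>_def abs_divide)
    qed
    show "\<bar>expectation (\<lambda>\<omega>. \<xi> i \<omega> j)\<bar> \<le> \<kappa> powr (- 1 - \<theta>) * m / r" if "i \<in> {1..n}" "j \<in> {1..p}" for i j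
      using tm(3)[OF that that that that that that] mean_X[OF that] that r
      by (simp add: \<xi>_def abs_divide divide_right_mono)
    show "\<bar>expectation (\<lambda>\<omega>. \<xi> i \<omega> j * \<xi> i \<omega> k) - Sig j k / real n\<bar> \<le> \<kappa> powr (- \<theta>) * (2 * m) / real n"
      if i: "i \<in> {1..n}" and j: "j \<in> {1..p}" and k: "k \<in> {1..p}" for i j k
    proof -
      have "expectation (\<lambda>\<omega>. \<xi> i \<omega> j * \<xi> i \<omega> k) = expectation (\<lambda>\<omega>. trunc \<kappa> (X i \<omega> j) * trunc \<kappa> (X i \<omega> k)) / real n"
        using j k by (simp add: \<xi>_def r(2))
      then have "expectation (\<lambda>\<omega>. \<xi> i \<omega> j * \<xi> i \<omega> k) - Sig j k / real n =
        (expectation (\<lambda>\<omega>. trunc \<kappa> (X i \<omega> j) * trunc \<kappa> (X i \<omega> k)) - expectation (\<lambda>\<omega>. X i \<omega> j * X i \<omega> k)) / real n"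
        unfolding Sigi[OF i j k] by (simp add: diff_divide_distrib)
      then show ?thesis using tm(4)[OF i j i k i j i j i k i k] by (simp add: abs_divide divide_right_mono)
    qed
    show "expectation (\<lambda>\<omega>. \<bar>\<xi> i \<omega> j\<bar> ^ 3) \<le> l ^ 3" if "i \<in> {1..n}" "j \<in> {1..p}" for i j
    proof -
      have "expectation (\<lambda>\<omega>. \<bar>\<xi> i \<omega> j\<bar> ^ 3) = expectation (\<lambda>\<omega>. \<bar>trunc \<kappa> (X i \<omega> j)\<bar> ^ 3) / r ^ 3"
        using that r by (simp add: \<xi>_def abs_divide power_divide)
      then show ?thesis
        unfolding l(2) using tm(5)[OF that that that that that that] r by (simp add: divide_right_mono)
    qed
    show "G.cov j k = Sig j k" if "j \<in> {1..p}" "k \<in> {1..p}" for j k by (rule cov[OF that])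
    show "0 < G.cov j j" if "j \<in> {1..p}" for j using var[OF that] b cov[OF that that] by simp
  qed
  have ev: "sqrt (real n) * linf_norm p (trunc_mean n \<kappa> X \<omega>) \<le> t \<longleftrightarrow> linf_norm p (\<lambda>j. \<Sum>i=1..n. \<xi> i \<omega> j) \<le> t" for \<omega>
  proof -
    have "r * \<bar>trunc_mean n \<kappa> X \<omega> j\<bar> = \<bar>\<Sum>i=1..n. \<xi> i \<omega> j\<bar>" if "j \<in> {1..p}" for j
    proof -
      have "(\<Sum>i=1..n. \<xi> i \<omega> j) = (\<Sum>i=1..n. trunc \<kappa> (X i \<omega> j)) / r"
        using that by (simp add: \<xi>_def sum_divide_distrib)
      also have "\<dots> = r * trunc_mean n \<kappa> X \<omega> j"
        using r by (simp add: trunc_mean_def trunc_vec_def r(2)[symmetric])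
      finally show ?thesis using r by (simp add: abs_mult)
    qed
    then have "linf_norm p (\<lambda>j. \<Sum>i=1..n. \<xi> i \<omega> j) \<le> t \<longleftrightarrow> (\<forall>j\<in>{1..p}. r * \<bar>trunc_mean n \<kappa> X \<omega> j\<bar> \<le> t)"
      unfolding linf_norm_le_iff[OF p] by simp
    also have "\<dots> \<longleftrightarrow> linf_norm p (trunc_mean n \<kappa> X \<omega>) \<le> t / r"
      unfolding linf_norm_le_iff[OF p] using r by (simp add: pos_le_divide_eq mult.commute)
    also have "\<dots> \<longleftrightarrow> r * linf_norm p (trunc_mean n \<kappa> X \<omega>) \<le> t" using r by (simp add: pos_le_divide_eq mult.commute)
    finally show ?thesis by (simp add: r_def)
  qed
  have e1: "real n * (\<alpha> * \<beta> * (\<kappa> powr (- 1 - \<theta>) * m / r)) = \<alpha> * \<beta> * (r * (\<kappa> powr (- 1 - \<theta>) * m))"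
    using r by (simp add: r(2)[symmetric])
  have e2: "real n * l ^ 3 = \<kappa> powr (1 - \<theta>) * m / r"
    unfolding l(2) using r by (simp add: r(2)[symmetric] power3_eq_cube)
  show ?thesis
    using kolmogorov_distance_bound[OF ga b var K, of t] unfolding e1 e2 ev unfolding r_def .
qed

text \<open>In logarithmic coordinates both sides are linear in \<open>a\<close>, \<open>c\<close>,
  \<open>d\<close>, and the coefficients match. With \<open>l = ln p\<close>, \<open>v = n\<close>
  and \<open>k\<close> the prescribed truncation level, every error term, and in the last line the
  size condition, is a power of the ratio \<open>q\<close> that the growth hypothesis sends to
  0.\<close>

lemma rate_identities:
  fixes l m v \<theta> :: real
  assumes pos: "l > 0" "m > 0" "v > 0" and th: "\<theta> > 0"
  defines "k \<equiv> (v * m / l) powr (1 / (2 + \<theta>))" and "q \<equiv> l powr (4 + 3 * \<theta>) * m\<^sup>2 / v powr \<theta>"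
  shows "l powr (1/2) * v powr (1/2) * k powr (- 1 - \<theta>) * m = q powr (1 / (2 * (2 + \<theta>)))"
    "l powr (7/2) * k powr (1 - \<theta>) * m * v powr (- (1/2)) = q powr (3 / (2 * (2 + \<theta>)))"
    "l powr 2 * k powr (- \<theta>) * m = q powr (1 / (2 + \<theta>))"
    "l powr (3/2) * k * v powr (- (1/2)) = q powr (1 / (2 * (2 + \<theta>)))"
proof -
  obtain a where a: "l = exp a" using pos by (metis exp_ln)
  obtain c where c: "m = exp c" using pos by (metis exp_ln)
  obtain d where d: "v = exp d" using pos by (metis exp_ln)
  have k: "k = exp ((d + c - a) / (2 + \<theta>))"
    unfolding k_def a c d by (simp add: powr_def flip: exp_add exp_diff)
  have q: "q = exp ((4 + 3 * \<theta>) * a + 2 * c - \<theta> * d)"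
    unfolding q_def a c d by (simp add: powr_def flip: exp_add exp_diff exp_double)
  have e: "exp x powr y = exp (y * x)" for x y :: real by (simp add: powr_def)
  have t: "2 + \<theta> \<noteq> 0" using th by simp
  show "l powr (1/2) * v powr (1/2) * k powr (- 1 - \<theta>) * m = q powr (1 / (2 * (2 + \<theta>)))"
    "l powr (7/2) * k powr (1 - \<theta>) * m * v powr (- (1/2)) = q powr (3 / (2 * (2 + \<theta>)))"
    "l powr 2 * k powr (- \<theta>) * m = q powr (1 / (2 + \<theta>))"
    "l powr (3/2) * k * v powr (- (1/2)) = q powr (1 / (2 * (2 + \<theta>)))"
    unfolding k q unfolding a c d e exp_add[symmetric] exp_inj_iff using t by (simp_all add: field_simps)
qed

text \<open>Negative powers of \<open>\<kappa>\<close> use the lower half of the two-sided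
  comparison with \<open>k0\<close>, nonnegative powers the upper half; \<open>L\<close> is replaced
  by \<open>l\<close> at the cost of a power of 2. What remains is a constant times a positive power
  of \<open>q\<close>.\<close>

lemma rates_tendsto_0:
  fixes l m \<kappa> :: "nat \<Rightarrow> real" and \<theta> :: real
  assumes th: "0 < \<theta>" "\<theta> \<le> 1" and l: "\<And>n. n \<ge> 1 \<Longrightarrow> l n > 0" and m: "\<And>n. n \<ge> 1 \<Longrightarrow> m n > 0" and k: "\<And>n. n \<ge> 1 \<Longrightarrow> \<kappa> n > 0"
    and L: "\<And>n. n \<ge> 1 \<Longrightarrow> 0 < L n \<and> L n \<le> 2 * l n"
    and growth: "(\<lambda>n. l n powr (4 + 3 * \<theta>) * (m n)\<^sup>2) \<in> o(\<lambda>n. real n powr \<theta>)"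
    and kappa: "\<kappa> \<in> \<Theta>(\<lambda>n. (real n * m n / l n) powr (1 / (2 + \<theta>)))"
  shows "(\<lambda>n. L n powr (1/2) * (sqrt (real n) * (\<kappa> n powr (- 1 - \<theta>) * m n))) \<longlonglongrightarrow> 0"
    "(\<lambda>n. L n powr (7/2) * (\<kappa> n powr (1 - \<theta>) * m n / sqrt (real n))) \<longlonglongrightarrow> 0"
    "(\<lambda>n. L n powr 2 * (\<kappa> n powr (- \<theta>) * m n)) \<longlonglongrightarrow> 0"
    "(\<lambda>n. L n powr (3/2) * \<kappa> n / sqrt (real n)) \<longlonglongrightarrow> 0"
proof -
  define k0 where "k0 = (\<lambda>n. (real n * m n / l n) powr (1 / (2 + \<theta>)))"
  define q where "q = (\<lambda>n. l n powr (4 + 3 * \<theta>) * (m n)\<^sup>2 / real n powr \<theta>)"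
  have q0: "q \<longlonglongrightarrow> 0" using smalloD_tendsto[OF growth] by (simp add: q_def)
  have qn: "q n \<ge> 0" for n by (simp add: q_def)
  have qp: "(\<lambda>n. C * q n powr e) \<longlonglongrightarrow> 0" if "e > 0" for e C
  proof -
    have "(\<lambda>n. q n powr e) \<longlonglongrightarrow> 0"
      by (rule tendsto_zero_powrI[OF q0 tendsto_const]) (use qn that in auto)
    from tendsto_mult_left[OF this, of C] show ?thesis by simp
  qed
  obtain C where C: "C > 0" "\<forall>\<^sub>F n in sequentially. norm (\<kappa> n) \<le> C * norm (k0 n)"
    using bigthetaD1[OF kappa] unfolding k0_def[symmetric] by (elim landau_o.bigE)
  obtain D where D: "D > 0" "\<forall>\<^sub>F n in sequentially. norm (k0 n) \<le> D * norm (\<kappa> n)"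
    using bigthetaD2[OF kappa] unfolding k0_def[symmetric] bigomega_iff_bigo by (elim landau_o.bigE)
  have ev: "\<forall>\<^sub>F n in sequentially. n \<ge> 1 \<and> k0 n > 0 \<and> \<kappa> n \<le> C * k0 n \<and> k0 n / D \<le> \<kappa> n"
    using C(2) D(2) eventually_ge_at_top[of 1]
  proof eventually_elim
    case (elim n)
    then have kp: "\<kappa> n > 0" using k by simp
    have k0: "k0 n \<ge> 0" by (simp add: k0_def)
    then show ?case using elim kp D(1) by (auto simp: pos_divide_le_eq mult.commute order_less_le)
  qed
  have Lp: "L n powr e \<le> 2 powr e * l n powr e" if "n \<ge> 1" "e \<ge> 0" for n e
    using L[OF that(1)] l[OF that(1)] that(2) by (simp flip: powr_mult add: powr_mono2)
  have sq: "sqrt (real n) = real n powr (1/2)" "1 / sqrt (real n) = real n powr (- (1/2))" if "n \<ge> 1" for n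
    using that by (simp_all add: powr_half_sqrt powr_minus inverse_eq_divide)
  show "(\<lambda>n. L n powr (1/2) * (sqrt (real n) * (\<kappa> n powr (- 1 - \<theta>) * m n))) \<longlonglongrightarrow> 0"
  proof (rule Lim_null_comparison[OF _ qp])
    show "\<forall>\<^sub>F n in sequentially. norm (L n powr (1/2) * (sqrt (real n) * (\<kappa> n powr (- 1 - \<theta>) * m n))) \<le>
       (2 powr (1/2) * (1 / D) powr (- 1 - \<theta>)) * q n powr (1 / (2 * (2 + \<theta>)))"
      using ev
    proof eventually_elim
      case (elim n)
      then have n: "n \<ge> 1" by simp
      have "\<kappa> n powr (- 1 - \<theta>) \<le> (1 / D * k0 n) powr (- 1 - \<theta>)"
        using elim D(1) k[OF n] th by (intro powr_mono2') auto
      also have "\<dots> = (1 / D) powr (- 1 - \<theta>) * k0 n powr (- 1 - \<theta>)" by (rule powr_mult)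
      finally have "L n powr (1/2) * (sqrt (real n) * (\<kappa> n powr (- 1 - \<theta>) * m n)) \<le>
        (2 powr (1/2) * l n powr (1/2)) * (sqrt (real n) * ((1 / D) powr (- 1 - \<theta>) * k0 n powr (- 1 - \<theta>) * m n))"
        using Lp[OF n] m[OF n] by (intro mult_mono) auto
      also have "\<dots> = (2 powr (1/2) * (1 / D) powr (- 1 - \<theta>)) * (l n powr (1/2) * real n powr (1/2) * k0 n powr (- 1 - \<theta>) * m n)"
        unfolding sq[OF n] by (simp only: mult_ac)
      also have "\<dots> = (2 powr (1/2) * (1 / D) powr (- 1 - \<theta>)) * q n powr (1 / (2 * (2 + \<theta>)))"
        unfolding k0_def q_def using n by (subst rate_identities(1)[OF l m _ th(1)]) auto
      finally show ?case using m[OF n] by simp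
    qed
  qed (use th in simp)
  show "(\<lambda>n. L n powr (7/2) * (\<kappa> n powr (1 - \<theta>) * m n / sqrt (real n))) \<longlonglongrightarrow> 0"
  proof (rule Lim_null_comparison[OF _ qp])
    show "\<forall>\<^sub>F n in sequentially. norm (L n powr (7/2) * (\<kappa> n powr (1 - \<theta>) * m n / sqrt (real n))) \<le>
       (2 powr (7/2) * C powr (1 - \<theta>)) * q n powr (3 / (2 * (2 + \<theta>)))"
      using ev
    proof eventually_elim
      case (elim n)
      then have n: "n \<ge> 1" by simp
      have "\<kappa> n powr (1 - \<theta>) \<le> (C * k0 n) powr (1 - \<theta>)"
        using elim k[OF n] th by (intro powr_mono2) auto
      also have "\<dots> = C powr (1 - \<theta>) * k0 n powr (1 - \<theta>)" by (rule powr_mult)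
      finally have "L n powr (7/2) * (\<kappa> n powr (1 - \<theta>) * m n * (1 / sqrt (real n))) \<le>
        (2 powr (7/2) * l n powr (7/2)) * (C powr (1 - \<theta>) * k0 n powr (1 - \<theta>) * m n * (1 / sqrt (real n)))"
        using Lp[OF n] m[OF n] by (intro mult_mono) auto
      also have "\<dots> = (2 powr (7/2) * C powr (1 - \<theta>)) * (l n powr (7/2) * k0 n powr (1 - \<theta>) * m n * real n powr (- (1/2)))"
        unfolding sq(2)[OF n] by (simp only: mult_ac)
      also have "\<dots> = (2 powr (7/2) * C powr (1 - \<theta>)) * q n powr (3 / (2 * (2 + \<theta>)))"
        unfolding k0_def q_def using n by (subst rate_identities(2)[OF l m _ th(1)]) auto
      finally show ?case using m[OF n] by simp
    qed
  qed (use th in simp)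
  show "(\<lambda>n. L n powr 2 * (\<kappa> n powr (- \<theta>) * m n)) \<longlonglongrightarrow> 0"
  proof (rule Lim_null_comparison[OF _ qp])
    show "\<forall>\<^sub>F n in sequentially. norm (L n powr 2 * (\<kappa> n powr (- \<theta>) * m n)) \<le>
       (2 powr 2 * (1 / D) powr (- \<theta>)) * q n powr (1 / (2 + \<theta>))"
      using ev
    proof eventually_elim
      case (elim n)
      then have n: "n \<ge> 1" by simp
      have "\<kappa> n powr (- \<theta>) \<le> (1 / D * k0 n) powr (- \<theta>)"
        using elim D(1) k[OF n] th by (intro powr_mono2') auto
      also have "\<dots> = (1 / D) powr (- \<theta>) * k0 n powr (- \<theta>)" by (rule powr_mult)
      finally have "L n powr 2 * (\<kappa> n powr (- \<theta>) * m n) \<le>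
        (2 powr 2 * l n powr 2) * ((1 / D) powr (- \<theta>) * k0 n powr (- \<theta>) * m n)"
        using Lp[OF n, of 2] m[OF n] by (intro mult_mono) auto
      also have "\<dots> = (2 powr 2 * (1 / D) powr (- \<theta>)) * (l n powr 2 * k0 n powr (- \<theta>) * m n)"
        by (simp only: mult_ac)
      also have "\<dots> = (2 powr 2 * (1 / D) powr (- \<theta>)) * q n powr (1 / (2 + \<theta>))"
        unfolding k0_def q_def using n by (subst rate_identities(3)[OF l m _ th(1)]) auto
      finally show ?case using m[OF n] by simp
    qed
  qed (use th in simp)
  show "(\<lambda>n. L n powr (3/2) * \<kappa> n / sqrt (real n)) \<longlonglongrightarrow> 0"
  proof (rule Lim_null_comparison[OF _ qp])
    show "\<forall>\<^sub>F n in sequentially. norm (L n powr (3/2) * \<kappa> n / sqrt (real n)) \<le>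
       (2 powr (3/2) * C) * q n powr (1 / (2 * (2 + \<theta>)))"
      using ev
    proof eventually_elim
      case (elim n)
      then have n: "n \<ge> 1" by simp
      have "L n powr (3/2) * \<kappa> n * (1 / sqrt (real n)) \<le> (2 powr (3/2) * l n powr (3/2)) * (C * k0 n) * (1 / sqrt (real n))"
        using Lp[OF n] k[OF n] elim C(1) by (intro mult_mono mult_nonneg_nonneg) auto
      also have "\<dots> = (2 powr (3/2) * C) * (l n powr (3/2) * k0 n * real n powr (- (1/2)))"
        unfolding sq(2)[OF n] by (simp only: mult_ac)
      also have "\<dots> = (2 powr (3/2) * C) * q n powr (1 / (2 * (2 + \<theta>)))"
        unfolding k0_def q_def using n by (subst rate_identities(4)[OF l m _ th(1)]) auto
      finally show ?case using k[OF n] by simp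
    qed
  qed (use th in simp)
qed

text \<open>With \<open>\<alpha> = 1 / L\<close> both parts of the smoothing width, \<open>L\<close>
  and \<open>2 * K / \<alpha>\<close>, are multiples of \<open>L\<close>; dividing by
  \<open>\<beta>\<close> and multiplying by the anti-concentration factor of order
  \<open>sqrt L\<close> cancels \<open>L\<close> completely and leaves a constant over
  \<open>A\<close>.\<close>

lemma scaled_bound_simps:
  fixes L A b K s k1 k2 k3 :: real
  assumes L: "L \<ge> 1" and A: "A > 0" and b: "b > 0" and K: "K \<ge> 0"
  defines "\<alpha> \<equiv> 1 / L" and "\<beta> \<equiv> A * L powr (3/2)"
  shows "\<alpha> * \<beta> = A * L powr (1/2)" "\<alpha> * \<beta> ^ 3 = A ^ 3 * L powr (7/2)" "\<alpha> * \<beta>\<^sup>2 = A\<^sup>2 * L powr 2"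
    "exp 4 * ((L + 2 * K / \<alpha>) / \<beta> / sqrt b) * (sqrt (2 * L) + 3) \<le> 5 * exp 4 * (1 + 2 * K) / (A * sqrt b)"
proof -
  have L0: "L > 0" using L by simp
  have i: "1 / L = L powr (- 1)" using L0 by (simp add: powr_minus inverse_eq_divide)
  have "\<alpha> * \<beta> = A * (L powr (- 1) * L powr (3/2))" by (simp add: \<alpha>_def \<beta>_def i)
  also have "L powr (- 1) * L powr (3/2) = L powr (1/2)" unfolding powr_add[symmetric] by simp
  finally show "\<alpha> * \<beta> = A * L powr (1/2)" .
  have "\<alpha> * \<beta> ^ 3 = A ^ 3 * (L powr (- 1) * (L powr (3/2)) ^ 3)" by (simp add: \<alpha>_def \<beta>_def i power_mult_distrib)
  also have "L powr (- 1) * (L powr (3/2)) ^ 3 = L powr (7/2)"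
    unfolding power3_eq_cube powr_add[symmetric] by simp
  finally show "\<alpha> * \<beta> ^ 3 = A ^ 3 * L powr (7/2)" .
  have "\<alpha> * \<beta>\<^sup>2 = A\<^sup>2 * (L powr (- 1) * (L powr (3/2))\<^sup>2)" by (simp add: \<alpha>_def \<beta>_def i power_mult_distrib)
  also have "L powr (- 1) * (L powr (3/2))\<^sup>2 = L powr 2"
    unfolding power2_eq_square powr_add[symmetric] by simp
  finally show "\<alpha> * \<beta>\<^sup>2 = A\<^sup>2 * L powr 2" .
  \<comment> \<open>The 5 is 2 + 3, from \<open>sqrt (2 * L) \<le> 2 * sqrt L\<close> and
    \<open>1 \<le> sqrt L\<close>.\<close>
  have s: "sqrt (2 * L) + 3 \<le> 5 * L powr (1/2)"
  proof -
    have "sqrt (2 * L) \<le> sqrt (4 * L)" using L0 by simp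
    also have "\<dots> = 2 * sqrt L" by (simp add: real_sqrt_mult)
    finally have "sqrt (2 * L) \<le> 2 * sqrt L" .
    moreover have "1 \<le> sqrt L" using L by simp
    ultimately have "sqrt (2 * L) + 3 \<le> 5 * sqrt L" by linarith
    then show ?thesis using L0 by (simp add: powr_half_sqrt)
  qed
  have "L * L powr (1/2) = L powr (3/2)" using L0 powr_add[of L 1 "1/2"] by simp
  then have q: "(L + 2 * K / \<alpha>) / \<beta> * L powr (1/2) = (1 + 2 * K) / A"
    using L0 A by (simp add: \<alpha>_def \<beta>_def field_simps)
  have "exp 4 * (Q / sqrt b) * (5 * s) = 5 * exp 4 * (Q * s) / sqrt b" for Q s :: real by simp
  from this[of "(L + 2 * K / \<alpha>) / \<beta>" "L powr (1/2)"]
  have e: "exp 4 * ((L + 2 * K / \<alpha>) / \<beta> / sqrt b) * (5 * L powr (1/2)) = 5 * exp 4 * (1 + 2 * K) / (A * sqrt b)"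
    unfolding q by simp
  have "exp 4 * ((L + 2 * K / \<alpha>) / \<beta> / sqrt b) * (sqrt (2 * L) + 3) \<le> exp 4 * ((L + 2 * K / \<alpha>) / \<beta> / sqrt b) * (5 * L powr (1/2))"
    using s L0 A b K by (intro mult_left_mono) (auto simp: \<alpha>_def \<beta>_def)
  then show "exp 4 * ((L + 2 * K / \<alpha>) / \<beta> / sqrt b) * (sqrt (2 * L) + 3) \<le> 5 * exp 4 * (1 + 2 * K) / (A * sqrt b)"
    unfolding e .
qed

theorem theorem2p1:
  fixes \<theta> b :: real
    and p :: "nat \<Rightarrow> nat"
    and M :: "nat \<Rightarrow> 'a measure"
    and X :: "nat \<Rightarrow> nat \<Rightarrow> 'a \<Rightarrow> nat \<Rightarrow> real"
    and \<Sigma> :: "nat \<Rightarrow> nat \<Rightarrow> nat \<Rightarrow> real"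
    and M\<theta> \<kappa> :: "nat \<Rightarrow> real"
    and N :: "nat \<Rightarrow> 'b measure"
    and Y :: "nat \<Rightarrow> 'b \<Rightarrow> nat \<Rightarrow> real"
  assumes theta: "0 < \<theta>" "\<theta> \<le> 1" and b: "b > 0"
    and p: "\<And>n. n \<ge> 1 \<Longrightarrow> p n \<ge> 2"
    and M: "\<And>n. n \<ge> 1 \<Longrightarrow> prob_space (M n)"
    and iid: "\<And>n. n \<ge> 1 \<Longrightarrow> iid_vars (M n) (borel_vec (p n)) (X n) {1..n}"
    and mean_X: "\<And>n i j. n \<ge> 1 \<Longrightarrow> i \<in> {1..n} \<Longrightarrow> j \<in> {1..p n} \<Longrightarrow>
          (\<integral>\<omega>. X n i \<omega> j \<partial>M n) = 0"
    and cov_X: "\<And>n i. n \<ge> 1 \<Longrightarrow> i \<in> {1..n} \<Longrightarrow> has_cov_matrix (M n) (p n) (X n i) (\<Sigma> n)"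
    and var_lower: "\<And>n i. n \<ge> 1 \<Longrightarrow> i \<in> {1..n} \<Longrightarrow>
          (MIN j\<in>{1..p n}. \<integral>\<omega>. \<bar>X n i \<omega> j\<bar>\<^sup>2 \<partial>M n) \<ge> b"
    and moment_finite: "\<And>n i j. n \<ge> 1 \<Longrightarrow> i \<in> {1..n} \<Longrightarrow> j \<in> {1..p n} \<Longrightarrow>
          integrable (M n) (\<lambda>\<omega>. \<bar>X n i \<omega> j\<bar> powr (2 + \<theta>))"
    and moment: "\<And>n i. n \<ge> 1 \<Longrightarrow> i \<in> {1..n} \<Longrightarrow>
          M\<theta> n = (MAX j\<in>{1..p n}. \<integral>\<omega>. \<bar>X n i \<omega> j\<bar> powr (2 + \<theta>) \<partial>M n)"
    and growth: "(\<lambda>n. ln (real (p n)) powr (4 + 3 * \<theta>) * (M\<theta> n)\<^sup>2) \<in> o(\<lambda>n. real n powr \<theta>)"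
    and kappa_pos: "\<And>n. n \<ge> 1 \<Longrightarrow> \<kappa> n > 0"
    and kappa: "\<kappa> \<in> \<Theta>(\<lambda>n. (real n * M\<theta> n / ln (real (p n))) powr (1 / (2 + \<theta>)))"
    and N: "\<And>n. n \<ge> 1 \<Longrightarrow> prob_space (N n)"
    and Y: "\<And>n. n \<ge> 1 \<Longrightarrow> gaussian_vector (N n) (p n) (Y n)"
    and mean_Y: "\<And>n j. n \<ge> 1 \<Longrightarrow> j \<in> {1..p n} \<Longrightarrow> (\<integral>\<omega>. Y n \<omega> j \<partial>N n) = 0"
    and cov_Y: "\<And>n. n \<ge> 1 \<Longrightarrow> has_cov_matrix (N n) (p n) (Y n) (\<Sigma> n)"
  shows "(\<lambda>n. SUP t::real.
            \<bar>measure (M n) {\<omega> \<in> space (M n).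
                sqrt (real n) * linf_norm (p n) (trunc_mean n (\<kappa> n) (X n) \<omega>) \<le> t}
             - measure (N n) {\<omega> \<in> space (N n). linf_norm (p n) (Y n \<omega>) \<le> t}\<bar>)
         \<longlonglongrightarrow> 0"
proof (rule LIMSEQ_I)
  fix r :: real assume r: "0 < r"
  define \<epsilon> where "\<epsilon> = r / 2"
  have \<epsilon>: "\<epsilon> > 0" "\<epsilon> < r" using r by (simp_all add: \<epsilon>_def)
  \<comment> \<open>Constants are fixed in order: \<open>K\<close> from the tolerance, then
    \<open>A\<close> from \<open>K\<close>, and only then \<open>n\<close> grows, so powers of
    \<open>A\<close> do not disturb the rates. \<open>K\<close> makes the two logistic tails
    together at most \<open>\<epsilon> / 4\<close>.\<close>
  define K where "K = max 0 (ln (8 / \<epsilon>))"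
  have K: "K \<ge> 0" "2 * exp (- K) \<le> \<epsilon> / 4"
  proof -
    have "exp (- K) \<le> exp (- ln (8 / \<epsilon>))" by (simp add: K_def)
    also have "\<dots> = \<epsilon> / 8" using \<epsilon> by (simp add: exp_minus)
    finally show "2 * exp (- K) \<le> \<epsilon> / 4" by simp
  qed (simp add: K_def)
  \<comment> \<open>Solves \<open>5 * exp 4 * (1 + 2 * K) / (A * sqrt b) = \<epsilon> / 4\<close>,
    whose left side is the anti-concentration term of \<open>scaled_bound_simps\<close>.\<close>
  define A where "A = 20 * exp 4 * (1 + 2 * K) / (sqrt b * \<epsilon>)"
  have A: "A > 0" using K \<epsilon> b by (auto simp: A_def intro!: divide_pos_pos mult_pos_pos add_pos_nonneg)
  have Aac: "5 * exp 4 * (1 + 2 * K) / (A * sqrt b) \<le> \<epsilon> / 4"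
  proof -
    define c where "c = 1 + 2 * K"
    have "c > 0" using K by (simp add: c_def)
    then have "5 * exp 4 * c / (A * sqrt b) = \<epsilon> / 4"
      using \<epsilon> b by (simp add: A_def c_def[symmetric])
    then show ?thesis by (simp add: c_def)
  qed
  \<comment> \<open>The slack of the soft maximum. As \<open>p n \<ge> 2\<close>, it is at least
    \<open>ln 4 \<ge> 1\<close>, which gives \<open>\<alpha> = 1 / L n \<le> 1\<close>, and at most
    twice \<open>ln (p n)\<close>.\<close>
  define L where "L = (\<lambda>n. ln (2 * real (p n)))"
  have lp: "ln (real (p n)) > 0" if "n \<ge> 1" for n using p[OF that] by simp
  have L: "1 \<le> L n" "L n \<le> 2 * ln (real (p n))" if "n \<ge> 1" for n
  proof -
    have p2: "real (p n) \<ge> 2" using p[OF that] by simp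
    have "exp 1 \<le> (4::real)" using exp_le by linarith
    also have "\<dots> \<le> 2 * real (p n)" using p2 by simp
    finally show "1 \<le> L n" unfolding L_def using p2 by (subst ln_ge_iff) auto
    have "L n = ln 2 + ln (real (p n))" unfolding L_def using p2 by (subst ln_mult) auto
    also have "ln 2 \<le> ln (real (p n))" using p2 by simp
    finally show "L n \<le> 2 * ln (real (p n))" by simp
  qed
  have mom_le: "(\<integral>\<omega>. \<bar>X n i \<omega> j\<bar> powr (2 + \<theta>) \<partial>M n) \<le> M\<theta> n" if "n \<ge> 1" "i \<in> {1..n}" "j \<in> {1..p n}" for n i j
    unfolding moment[OF that(1,2)] using that(3) by (intro Max_ge) auto
  have m0: "M\<theta> n \<ge> 0" if "n \<ge> 1" for n
    using mom_le[of n 1 1] that p[OF that] by (intro order_trans[OF _ mom_le[of n 1 1]] Bochner_Integration.integral_nonneg) auto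
  \<comment> \<open>If \<open>M\<theta> n\<close> were 0, the comparison value in
    \<open>kappa\<close> would be a \<open>powr\<close> with base 0, hence 0, while
    \<open>\<kappa> n\<close> is positive and eventually bounded by a multiple of it.\<close>
  have ev_m: "\<forall>\<^sub>F n in sequentially. M\<theta> n > 0"
  proof -
    obtain C where C: "C > 0" "\<forall>\<^sub>F n in sequentially. norm (\<kappa> n) \<le> C * norm ((real n * M\<theta> n / ln (real (p n))) powr (1 / (2 + \<theta>)))"
      using bigthetaD1[OF kappa] by (elim landau_o.bigE)
    from C(2) eventually_ge_at_top[of 1] show ?thesis
    proof eventually_elim
      case (elim n)
      have "M\<theta> n \<noteq> 0"
      proof
        assume "M\<theta> n = 0"
        then show False using elim kappa_pos[of n] theta by simp
      qed
      then show ?case using m0[OF elim(2)] by simp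
    qed
  qed
  then obtain n0 where n0: "\<And>n. n \<ge> n0 \<Longrightarrow> M\<theta> n > 0" by (auto simp: eventually_sequentially)
  \<comment> \<open>The rate lemma wants positivity at every index \<open>n \<ge> 1\<close>; the
    value 1 is a default at finitely many indices, invisible to the Landau relations.\<close>
  define m where "m = (\<lambda>n. if M\<theta> n > 0 then M\<theta> n else 1)"
  have m: "m n > 0" for n by (simp add: m_def)
  have mM: "\<forall>\<^sub>F n in sequentially. m n = M\<theta> n" using ev_m by eventually_elim (simp add: m_def)
  have "\<forall>\<^sub>F n in sequentially. ln (real (p n)) powr (4 + 3 * \<theta>) * (m n)\<^sup>2 = ln (real (p n)) powr (4 + 3 * \<theta>) * (M\<theta> n)\<^sup>2"
    using mM by eventually_elim simp
  then have growth': "(\<lambda>n. ln (real (p n)) powr (4 + 3 * \<theta>) * (m n)\<^sup>2) \<in> o(\<lambda>n. real n powr \<theta>)"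
    using growth by (rule landau_o.small.in_cong[THEN iffD2])
  have "\<forall>\<^sub>F n in sequentially. (real n * m n / ln (real (p n))) powr (1 / (2 + \<theta>)) = (real n * M\<theta> n / ln (real (p n))) powr (1 / (2 + \<theta>))"
    using mM by eventually_elim simp
  from landau_theta.cong[OF this] have kappa': "\<kappa> \<in> \<Theta>(\<lambda>n. (real n * m n / ln (real (p n))) powr (1 / (2 + \<theta>)))"
    using kappa by simp
  have LL: "0 < L n \<and> L n \<le> 2 * ln (real (p n))" if "n \<ge> 1" for n using L[OF that] by simp
  note rates = rates_tendsto_0[of \<theta> "\<lambda>n. ln (real (p n))" m \<kappa> L, OF theta lp m kappa_pos LL growth' kappa']
  let ?g1 = "\<lambda>n. L n powr (1/2) * (sqrt (real n) * (\<kappa> n powr (- 1 - \<theta>) * m n))"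
  let ?g2 = "\<lambda>n. L n powr (7/2) * (\<kappa> n powr (1 - \<theta>) * m n / sqrt (real n))"
  let ?g3 = "\<lambda>n. L n powr 2 * (\<kappa> n powr (- \<theta>) * m n)"
  let ?g4 = "\<lambda>n. L n powr (3/2) * \<kappa> n / sqrt (real n)"
  let ?E = "\<lambda>n. 2 * (A * ?g1 n + 60 * exp 6 * A ^ 3 * ?g2 n + 6 * A\<^sup>2 * ?g3 n)"
  have "?E \<longlonglongrightarrow> 2 * (A * 0 + 60 * exp 6 * A ^ 3 * 0 + 6 * A\<^sup>2 * 0)"
    by (intro tendsto_intros rates)
  then have "\<forall>\<^sub>F n in sequentially. ?E n < \<epsilon> / 2" using \<epsilon> by (intro order_tendstoD(2)) auto
  moreover have "(\<lambda>n. A * ?g4 n) \<longlonglongrightarrow> A * 0" by (intro tendsto_intros rates)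
  then have "\<forall>\<^sub>F n in sequentially. A * ?g4 n < 1" by (intro order_tendstoD(2)) auto
  ultimately have "\<forall>\<^sub>F n in sequentially. ?E n < \<epsilon> / 2 \<and> A * ?g4 n < 1 \<and> m n = M\<theta> n \<and> n \<ge> 1"
    using mM eventually_ge_at_top[of 1] by eventually_elim auto
  then obtain n1 where n1: "\<And>n. n \<ge> n1 \<Longrightarrow> ?E n < \<epsilon> / 2 \<and> A * ?g4 n < 1 \<and> m n = M\<theta> n \<and> n \<ge> 1"
    by (auto simp: eventually_sequentially)
  let ?d = "\<lambda>n t. \<bar>measure (M n) {\<omega> \<in> space (M n). sqrt (real n) * linf_norm (p n) (trunc_mean n (\<kappa> n) (X n) \<omega>) \<le> t}
             - measure (N n) {\<omega> \<in> space (N n). linf_norm (p n) (Y n \<omega>) \<le> t}\<bar>"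
  show "\<exists>no. \<forall>n\<ge>no. norm ((SUP t::real. ?d n t) - 0) < r"
  proof (intro exI allI impI)
    fix n assume "n \<ge> n1"
    then have E: "?E n < \<epsilon> / 2" and g4: "A * ?g4 n < 1" and mn: "m n = M\<theta> n" and n: "n \<ge> 1" using n1[of n] by auto
    have L1: "L n \<ge> 1" by (rule L(1)[OF n])
    have sn: "sqrt (real n) > 0" using n by simp
    have p1: "p n \<ge> 1" using p[OF n] by simp
    have one: "1 \<in> {1..n}" using n by simp
    have ind: "prob_space.indep_vars (M n) (\<lambda>_. borel_vec (p n)) (X n) {1..n}"
      using iid[OF n] by (simp add: iid_vars_def)
    have var: "\<Sigma> n j j \<ge> b" if j: "j \<in> {1..p n}" for j
    proof -
      have "covariance (M n) (\<lambda>\<omega>. X n 1 \<omega> j) (\<lambda>\<omega>. X n 1 \<omega> j) = (\<integral>\<omega>. X n 1 \<omega> j * X n 1 \<omega> j \<partial>M n)"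
        using mean_X[OF n one j] by (intro covariance_centered)
      then have S: "\<Sigma> n j j = (\<integral>\<omega>. \<bar>X n 1 \<omega> j\<bar>\<^sup>2 \<partial>M n)"
        using cov_X[OF n one] j by (simp add: has_cov_matrix_def power2_eq_square)
      have "(MIN j\<in>{1..p n}. \<integral>\<omega>. \<bar>X n 1 \<omega> j\<bar>\<^sup>2 \<partial>M n) \<le> (\<integral>\<omega>. \<bar>X n 1 \<omega> j\<bar>\<^sup>2 \<partial>M n)"
        using j by (intro Min_le) auto
      with var_lower[OF n one] show ?thesis unfolding S by linarith
    qed
    \<comment> \<open>The fourth rate, in the form \<open>A * ?g4 n < 1\<close>, is the size
      condition \<open>\<beta> * \<kappa> \<le> sqrt n\<close>.\<close>
    have bet: "A * L n powr (3/2) * \<kappa> n \<le> sqrt (real n)" using g4 sn by (simp add: divide_simps mult_ac)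
    note simps = scaled_bound_simps[OF L1 A b K(1)]
    have d: "?d n t \<le> \<epsilon>" for t
    proof -
      have "?d n t \<le> 2 * (1 / L n * (A * L n powr (3/2)) * (sqrt (real n) * (\<kappa> n powr (- 1 - \<theta>) * M\<theta> n)) +
          60 * exp 6 * (1 / L n) * (A * L n powr (3/2)) ^ 3 * (\<kappa> n powr (1 - \<theta>) * M\<theta> n / sqrt (real n)) +
          3 * (1 / L n) * (A * L n powr (3/2))\<^sup>2 * (\<kappa> n powr (- \<theta>) * (2 * M\<theta> n))) +
        2 * exp (- K) + exp 4 * ((ln (2 * real (p n)) + 2 * K / (1 / L n)) / (A * L n powr (3/2)) / sqrt b) * (sqrt (2 * ln (2 * real (p n))) + 3)"
      proof (rule truncated_mean_bound)
        show "M\<theta> n > 0" using m[of n] mn by simp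
        show "(LINT \<omega>|M n. \<bar>X n i \<omega> j\<bar> powr (2 + \<theta>)) \<le> M\<theta> n" if "i \<in> {1..n}" "j \<in> {1..p n}" for i j
          by (rule mom_le[OF n that])
        show "0 < A * L n powr (3/2)" using A L1 by simp
        show "0 < 1 / L n" "1 / L n \<le> 1" using L1 by simp_all
      qed (fact theta b p1 n kappa_pos[OF n] M[OF n] N[OF n] ind var bet K(1) mean_X[OF n] cov_X[OF n] moment_finite[OF n]
          Y[OF n] mean_Y[OF n] cov_Y[OF n])+
      also have "\<dots> = ?E n + 2 * exp (- K) +
          exp 4 * ((L n + 2 * K / (1 / L n)) / (A * L n powr (3/2)) / sqrt b) * (sqrt (2 * L n) + 3)"
      proof -
        have Ln: "ln (2 * real (p n)) = L n" by (simp add: L_def)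
        have e2: "60 * exp 6 * (1 / L n) * (A * L n powr (3/2)) ^ 3 = 60 * exp 6 * (A ^ 3 * L n powr (7/2))"
          unfolding simps(2)[symmetric] by simp
        have e3: "3 * (1 / L n) * (A * L n powr (3/2))\<^sup>2 = 3 * (A\<^sup>2 * L n powr 2)"
          unfolding simps(3)[symmetric] by simp
        show ?thesis unfolding Ln simps(1) e2 e3 mn by (simp only: mult_ac distrib_left)
      qed
      also have "\<dots> \<le> \<epsilon> / 2 + \<epsilon> / 4 + \<epsilon> / 4"
        using E K(2) order_trans[OF simps(4) Aac] by (intro add_mono) auto
      finally show ?thesis by simp
    qed
    have "(SUP t::real. ?d n t) \<le> \<epsilon>" by (rule cSUP_least) (use d in auto)
    \<comment> \<open>A supremum over the reals dominates its members only for sets bounded above,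
      so the uniform bound \<open>d\<close> is used here as well; nonnegativity of any single member
      then suffices.\<close>
    moreover have "0 \<le> (SUP t::real. ?d n t)"
    proof (rule cSUP_upper2[of _ _ 0])
      show "bdd_above (range (?d n))" using d by (intro bdd_aboveI[of _ \<epsilon>]) auto
    qed auto
    ultimately show "norm ((SUP t::real. ?d n t) - 0) < r" using \<epsilon> by simp
  qed
qed

end
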